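(* Let $G$ be a semisimple connected Lie group of non-compact type with finite center, with maximal compact subgroup $K$, minimal parabolic subgroup $P$ and maximal split torus $A<P$, and let $w_0$ be a representative of the longest element of the Weyl group. Let $(G/P)^3_{\mathrm{p-opp}}$ be the set of triples of pairwise opposite points in $G/P$. If $w_0$ acts as $-1$ on the Lie algebra of $A$, then there exists a $G$-equivariant continuous map $$\Phi:(G/P)^{3}_{\mathrm{p-opp}}\longrightarrow G/K$$ such that, furthermore, $\Phi(x,y,z)$ belongs to the unique maximal flat $F_{x,y}$ of $G/K$ having $x$ and $y$ in its boundary, for every $(x,y,z)\in(G/P)^3_{\mathrm{p-opp}}$.
   Context: The choices are compatible in the standard way: there is a Cartan decomposition $\mathfrak{g}=\mathfrak{k}\oplus\mathfrak{p}$ with $\mathfrak{k}=\mathrm{Lie}(K)$, a maximal abelian subspace $\mathfrak{a}\subset\mathfrak{p}$ with $A=\exp(\mathfrak{a})$, and a choice of positive restricted roots such that $P=MAN$, where $M=Z_K(A)$ is the centralizer of $A$ in $K$ and $N$ is the unipotent radical of $P$. Let $T=N_K(A)$ be the normalizer of $A$ in $K$ and $W=T/M$ the Weyl group; $w_0\in T$ represents the longest element of $W$ (longest with respect to this choice of positive roots). That $w_0$ acts as $-1$ on the Lie algebra of $A$ means $\mathrm{Ad}(w_0)X=-X$ for all $X\in\mathfrak{a}$, equivalently $w_0aw_0^{-1}=a^{-1}$ for all $a\in A$. The canonical maximal flat is $F_A:=\{aK\mid a\in A\}\subset G/K$; every maximal flat of $G/K$ is of the form $gF_A$ with $g\in G$.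 The boundary of $F_A$ is $\partial F_A=\{wP\mid w\in W\}\subset G/P$, and $\partial(gF_A)=g(\partial F_A)$. A pair of points of $G/P$ is called opposite if it lies in the $G$-orbit (diagonal action) of $(P,w_0P)$; this relation is symmetric. Two opposite points $x,y$ lie in the boundary of a unique maximal flat $F_{x,y}$: if $(x,y)=g(P,w_0P)$ then $F_{x,y}=gF_A$. $G$ acts diagonally on $(G/P)^3_{\mathrm{p-opp}}$, which carries the subspace topology from $(G/P)^3$, and by left multiplication on $G/K$. *)

theory Defs
  imports
    "HOL-Analysis.Analysis"
    "HOL-Algebra.Coset"
    "HOL-Algebra.Left_Coset"
    "HOL-Algebra.Generated_Groups"
begin

section \<open>Smooth maps between open subsets of Euclidean spaces\<close>

text \<open>The following two notions are meant for open sets \<open>S\<close> only; there \<open>f\<close> is \<open>C\<^sup>k\<^sup>+\<^sup>1\<close> iff it is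
  differentiable and all its directional derivatives are \<open>C\<^sup>k\<close>.\<close>

primrec Ck_on ::
    "nat \<Rightarrow> ('a::euclidean_space \<Rightarrow> 'b::euclidean_space) \<Rightarrow> 'a set \<Rightarrow> bool" where
  "Ck_on 0 f S \<longleftrightarrow> continuous_on S f"
| "Ck_on (Suc k) f S \<longleftrightarrow>
     (\<forall>x\<in>S. f differentiable (at x)) \<and> (\<forall>v. Ck_on k (\<lambda>x. frechet_derivative f (at x) v) S)"

definition smooth_on ::
    "('a::euclidean_space \<Rightarrow> 'b::euclidean_space) \<Rightarrow> 'a set \<Rightarrow> bool" where
  "smooth_on f S \<longleftrightarrow> (\<forall>k. Ck_on k f S)"


section \<open>Lie groups\<close>

text \<open>A chart is a pair \<open>(U, \<phi>)\<close> of an open set and a coordinate map, of which only the values on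
  \<open>U\<close> matter.\<close>

record ('a, 'e) lie_group = "'a monoid" +
  gtop  :: "'a topology"
  atlas :: "('a set \<times> ('a \<Rightarrow> 'e)) set"

definition chart_inv :: "'a set \<times> ('a \<Rightarrow> 'e) \<Rightarrow> 'e \<Rightarrow> 'a" where
  "chart_inv c = inv_into (fst c) (snd c)"

locale lie_group = group G
  for G :: "('a, 'e::euclidean_space) lie_group" (structure) +
  assumes topspace_gtop: "topspace (gtop G) = carrier G"
    and Hausdorff: "Hausdorff_space (gtop G)"
    and second_countable: "second_countable (gtop G)"
    and atlas_cover: "(\<Union>c\<in>atlas G. fst c) = carrier G"
    and chart_open: "c \<in> atlas G \<Longrightarrow> openin (gtop G) (fst c)"
    and chart_image_open: "c \<in> atlas G \<Longrightarrow> open (snd c ` fst c)"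
    and chart_homeomorphic: "c \<in> atlas G \<Longrightarrow>
      homeomorphic_map (subtopology (gtop G) (fst c)) (top_of_set (snd c ` fst c)) (snd c)"
    and transition_smooth: "\<lbrakk>c \<in> atlas G; d \<in> atlas G\<rbrakk> \<Longrightarrow>
      smooth_on (\<lambda>p. snd d (chart_inv c p)) (snd c ` (fst c \<inter> fst d))"
    and mult_continuous:
      "continuous_map (prod_topology (gtop G) (gtop G)) (gtop G) (\<lambda>(x, y). x \<otimes> y)"
    and inv_continuous: "continuous_map (gtop G) (gtop G) (\<lambda>x. inv x)"
    and mult_smooth: "\<lbrakk>c \<in> atlas G; d \<in> atlas G; e \<in> atlas G\<rbrakk> \<Longrightarrow>
      smooth_on (\<lambda>(p, q). snd e (chart_inv c p \<otimes> chart_inv d q))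
        {(p, q). p \<in> snd c ` fst c \<and> q \<in> snd d ` fst d \<and> chart_inv c p \<otimes> chart_inv d q \<in> fst e}"
    and inv_smooth: "\<lbrakk>c \<in> atlas G; d \<in> atlas G\<rbrakk> \<Longrightarrow>
      smooth_on (\<lambda>p. snd d (inv (chart_inv c p)))
        {p \<in> snd c ` fst c. inv (chart_inv c p) \<in> fst d}"


section \<open>The Lie algebra\<close>

text \<open>We fix a chart around \<open>\<one>\<close> and use its differential to identify the tangent space at \<open>\<one>\<close>,
  i.e. the Lie algebra of \<open>G\<close>, with the whole model space \<open>'e\<close>. The bracket is given by the
  differential of the adjoint representation at \<open>\<one>\<close>. The inner product of \<open>'e\<close> has no
  significance; it only enters the formula for the trace, which does not depend on it.\<close>

definition one_chart :: "('a, 'e) lie_group \<Rightarrow> 'a set \<times> ('a \<Rightarrow> 'e)" where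
  "one_chart G = (SOME c. c \<in> atlas G \<and> \<one>\<^bsub>G\<^esub> \<in> fst c)"

abbreviation coord :: "('a, 'e) lie_group \<Rightarrow> 'a \<Rightarrow> 'e" where
  "coord G \<equiv> snd (one_chart G)"

abbreviation coord_inv :: "('a, 'e) lie_group \<Rightarrow> 'e \<Rightarrow> 'a" where
  "coord_inv G \<equiv> chart_inv (one_chart G)"

definition Ad :: "('a, 'e::euclidean_space) lie_group \<Rightarrow> 'a \<Rightarrow> 'e \<Rightarrow> 'e" where
  "Ad G g = frechet_derivative (\<lambda>p. coord G (g \<otimes>\<^bsub>G\<^esub> coord_inv G p \<otimes>\<^bsub>G\<^esub> inv\<^bsub>G\<^esub> g))
              (at (coord G \<one>\<^bsub>G\<^esub>))"

definition bracket :: "('a, 'e::euclidean_space) lie_group \<Rightarrow> 'e \<Rightarrow> 'e \<Rightarrow> 'e" where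
  "bracket G X Y = frechet_derivative (\<lambda>p. Ad G (coord_inv G p) Y) (at (coord G \<one>\<^bsub>G\<^esub>)) X"

definition lin_trace :: "('e::euclidean_space \<Rightarrow> 'e) \<Rightarrow> real" where
  "lin_trace f = (\<Sum>b\<in>Basis. f b \<bullet> b)"

definition killing :: "('a, 'e::euclidean_space) lie_group \<Rightarrow> 'e \<Rightarrow> 'e \<Rightarrow> real" where
  "killing G X Y = lin_trace (\<lambda>Z. bracket G X (bracket G Y Z))"

definition one_param_subgroup ::
    "('a, 'e::euclidean_space) lie_group \<Rightarrow> 'e \<Rightarrow> (real \<Rightarrow> 'a) \<Rightarrow> bool" where
  "one_param_subgroup G X \<gamma> \<longleftrightarrow>
     continuous_map euclideanreal (gtop G) \<gamma> \<and>
     (\<forall>s t. \<gamma> (s + t) = \<gamma> s \<otimes>\<^bsub>G\<^esub> \<gamma> t) \<and>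
     ((\<lambda>t. coord G (\<gamma> t)) has_vector_derivative X) (at 0)"

definition lie_exp :: "('a, 'e::euclidean_space) lie_group \<Rightarrow> 'e \<Rightarrow> 'a" where
  "lie_exp G X = (THE g. \<exists>\<gamma>. one_param_subgroup G X \<gamma> \<and> \<gamma> 1 = g)"

text \<open>Lie algebra of a closed subgroup.\<close>

definition lie_of :: "('a, 'e::euclidean_space) lie_group \<Rightarrow> 'a set \<Rightarrow> 'e set" where
  "lie_of G H = {X. \<forall>t::real. lie_exp G (t *\<^sub>R X) \<in> H}"

text \<open>The analytic (i.e. connected Lie) subgroup with Lie algebra \<open>\<h>\<close>.\<close>

definition analytic_subgroup ::
    "('a, 'e::euclidean_space) lie_group \<Rightarrow> 'e set \<Rightarrow> 'a set" where
  "analytic_subgroup G \<h> = generate G (lie_exp G ` \<h>)"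


section \<open>Semisimplicity and non-compact type\<close>

definition lie_ideal :: "('a, 'e::euclidean_space) lie_group \<Rightarrow> 'e set \<Rightarrow> bool" where
  "lie_ideal G I \<longleftrightarrow> subspace I \<and> (\<forall>X. \<forall>Y\<in>I. bracket G X Y \<in> I)"

definition derived_algebra ::
    "('a, 'e::euclidean_space) lie_group \<Rightarrow> 'e set \<Rightarrow> 'e set" where
  "derived_algebra G I = span {bracket G X Y | X Y. X \<in> I \<and> Y \<in> I}"

definition solvable :: "('a, 'e::euclidean_space) lie_group \<Rightarrow> 'e set \<Rightarrow> bool" where
  "solvable G I \<longleftrightarrow> (\<exists>n. (derived_algebra G ^^ n) I = {0})"

definition semisimple :: "('a, 'e::euclidean_space) lie_group \<Rightarrow> bool" where
  "semisimple G \<longleftrightarrow> (\<forall>I. lie_ideal G I \<and> solvable G I \<longrightarrow> I = {0})"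

text \<open>A semisimple Lie algebra is of non-compact type if it has no non-zero compact ideal, a
  semisimple Lie algebra being compact if its Killing form is negative definite. The Killing form
  of an ideal is the restriction of the ambient one.\<close>

definition noncompact_type :: "('a, 'e::euclidean_space) lie_group \<Rightarrow> bool" where
  "noncompact_type G \<longleftrightarrow>
     (\<forall>I. lie_ideal G I \<and> (\<forall>X\<in>I. X \<noteq> 0 \<longrightarrow> killing G X X < 0) \<longrightarrow> I = {0})"

definition group_center :: "('a, 'b) monoid_scheme \<Rightarrow> 'a set" where
  "group_center G = {z \<in> carrier G. \<forall>g\<in>carrier G. z \<otimes>\<^bsub>G\<^esub> g = g \<otimes>\<^bsub>G\<^esub> z}"

definition maximal_compact_subgroup :: "('a, 'e) lie_group \<Rightarrow> 'a set \<Rightarrow> bool" where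
  "maximal_compact_subgroup G K \<longleftrightarrow>
     subgroup K G \<and> compactin (gtop G) K \<and>
     (\<forall>L. subgroup L G \<and> compactin (gtop G) L \<and> K \<subseteq> L \<longrightarrow> L = K)"


section \<open>Cartan decomposition and restricted roots\<close>

definition cartan_involution ::
    "('a, 'e::euclidean_space) lie_group \<Rightarrow> ('e \<Rightarrow> 'e) \<Rightarrow> bool" where
  "cartan_involution G \<theta> \<longleftrightarrow>
     linear \<theta> \<and> (\<forall>X. \<theta> (\<theta> X) = X) \<and>
     (\<forall>X Y. \<theta> (bracket G X Y) = bracket G (\<theta> X) (\<theta> Y)) \<and>
     (\<forall>X. X \<noteq> 0 \<longrightarrow> - killing G X (\<theta> X) > 0)"

definition cartan_decomposition ::
    "('a, 'e::euclidean_space) lie_group \<Rightarrow> 'e set \<Rightarrow> 'e set \<Rightarrow> bool" where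
  "cartan_decomposition G \<k> \<p> \<longleftrightarrow>
     (\<exists>\<theta>. cartan_involution G \<theta> \<and> \<k> = {X. \<theta> X = X} \<and> \<p> = {X. \<theta> X = - X})"

definition abelian_subspace :: "('a, 'e::euclidean_space) lie_group \<Rightarrow> 'e set \<Rightarrow> bool" where
  "abelian_subspace G \<a> \<longleftrightarrow> subspace \<a> \<and> (\<forall>X\<in>\<a>. \<forall>Y\<in>\<a>. bracket G X Y = 0)"

definition maximal_abelian_in ::
    "('a, 'e::euclidean_space) lie_group \<Rightarrow> 'e set \<Rightarrow> 'e set \<Rightarrow> bool" where
  "maximal_abelian_in G \<p> \<a> \<longleftrightarrow>
     \<a> \<subseteq> \<p> \<and> abelian_subspace G \<a> \<and>
     (\<forall>\<b>. \<b> \<subseteq> \<p> \<and> abelian_subspace G \<b> \<and> \<a> \<subseteq> \<b> \<longrightarrow> \<b> = \<a>)"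

definition root_space ::
    "('a, 'e::euclidean_space) lie_group \<Rightarrow> 'e set \<Rightarrow> ('e \<Rightarrow> real) \<Rightarrow> 'e set" where
  "root_space G \<a> \<alpha> = {X. \<forall>H\<in>\<a>. bracket G H X = \<alpha> H *\<^sub>R X}"

text \<open>Functionals on \<open>\<a>\<close> are represented by extensional functions, so that each root is represented
  exactly once. Linearity on \<open>\<a>\<close> follows from the root space being non-zero.\<close>

definition restricted_roots ::
    "('a, 'e::euclidean_space) lie_group \<Rightarrow> 'e set \<Rightarrow> ('e \<Rightarrow> real) set" where
  "restricted_roots G \<a> =
     {\<alpha> \<in> extensional \<a>. (\<exists>H\<in>\<a>. \<alpha> H \<noteq> 0) \<and> root_space G \<a> \<alpha> \<noteq> {0}}"

text \<open>Positive systems are those given by Weyl chambers, the chamber being that of \<open>H\<^sub>0\<close>.\<close>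

definition positive_roots ::
    "('a, 'e::euclidean_space) lie_group \<Rightarrow> 'e set \<Rightarrow> ('e \<Rightarrow> real) set \<Rightarrow> bool" where
  "positive_roots G \<a> \<Sigma>p \<longleftrightarrow>
     (\<exists>H\<^sub>0\<in>\<a>. (\<forall>\<alpha>\<in>restricted_roots G \<a>. \<alpha> H\<^sub>0 \<noteq> 0) \<and>
        \<Sigma>p = {\<alpha> \<in> restricted_roots G \<a>. \<alpha> H\<^sub>0 > 0})"

definition positive_root_sum ::
    "('a, 'e::euclidean_space) lie_group \<Rightarrow> 'e set \<Rightarrow> ('e \<Rightarrow> real) set \<Rightarrow> 'e set" where
  "positive_root_sum G \<a> \<Sigma>p = span (\<Union>\<alpha>\<in>\<Sigma>p. root_space G \<a> \<alpha>)"


section \<open>The Weyl group\<close>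

definition centralizer_in :: "('a, 'b) monoid_scheme \<Rightarrow> 'a set \<Rightarrow> 'a set \<Rightarrow> 'a set" where
  "centralizer_in G K A = {k \<in> K. \<forall>a\<in>A. k \<otimes>\<^bsub>G\<^esub> a = a \<otimes>\<^bsub>G\<^esub> k}"

definition normalizer_in :: "('a, 'b) monoid_scheme \<Rightarrow> 'a set \<Rightarrow> 'a set \<Rightarrow> 'a set" where
  "normalizer_in G K A = {k \<in> K. (\<lambda>a. k \<otimes>\<^bsub>G\<^esub> a \<otimes>\<^bsub>G\<^esub> inv\<^bsub>G\<^esub> k) ` A = A}"

definition simple_roots :: "'e set \<Rightarrow> ('e \<Rightarrow> real) set \<Rightarrow> ('e \<Rightarrow> real) set" where
  "simple_roots \<a> \<Sigma>p =
     {\<alpha> \<in> \<Sigma>p. \<not> (\<exists>\<beta>\<in>\<Sigma>p. \<exists>\<gamma>\<in>\<Sigma>p. \<forall>H\<in>\<a>. \<alpha> H = \<beta> H + \<gamma> H)}"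

definition root_dual ::
    "('a, 'e::euclidean_space) lie_group \<Rightarrow> 'e set \<Rightarrow> ('e \<Rightarrow> real) \<Rightarrow> 'e" where
  "root_dual G \<a> \<alpha> = (THE H. H \<in> \<a> \<and> (\<forall>X\<in>\<a>. killing G H X = \<alpha> X))"

definition root_reflection ::
    "('a, 'e::euclidean_space) lie_group \<Rightarrow> 'e set \<Rightarrow> ('e \<Rightarrow> real) \<Rightarrow> 'e \<Rightarrow> 'e" where
  "root_reflection G \<a> \<alpha> X =
     (let H = root_dual G \<a> \<alpha> in X - (2 * \<alpha> X / \<alpha> H) *\<^sub>R H)"

text \<open>Word length, with respect to the simple reflections, of the Weyl group element represented by
  \<open>w\<close>; the Weyl group acts faithfully on \<open>\<a>\<close> through \<open>Ad\<close>.\<close>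

definition weyl_length ::
    "('a, 'e::euclidean_space) lie_group \<Rightarrow> 'e set \<Rightarrow> ('e \<Rightarrow> real) set \<Rightarrow> 'a \<Rightarrow> nat" where
  "weyl_length G \<a> \<Sigma>p w =
     (LEAST n. \<exists>\<alpha>s. length \<alpha>s = n \<and> set \<alpha>s \<subseteq> simple_roots \<a> \<Sigma>p \<and>
        (\<forall>X\<in>\<a>. Ad G w X = foldr (root_reflection G \<a>) \<alpha>s X))"

definition represents_longest ::
    "('a, 'e::euclidean_space) lie_group \<Rightarrow> 'a set \<Rightarrow> 'e set \<Rightarrow> ('e \<Rightarrow> real) set \<Rightarrow> 'a \<Rightarrow> bool" where
  "represents_longest G K \<a> \<Sigma>p w\<^sub>0 \<longleftrightarrow>
     (let T = normalizer_in G K (lie_exp G ` \<a>) in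
        w\<^sub>0 \<in> T \<and> (\<forall>w\<in>T. weyl_length G \<a> \<Sigma>p w \<le> weyl_length G \<a> \<Sigma>p w\<^sub>0))"


section \<open>Homogeneous spaces, flats and opposition\<close>

definition quotient_topology :: "'a topology \<Rightarrow> ('a \<Rightarrow> 'b) \<Rightarrow> 'b topology" where
  "quotient_topology X f =
     topology (\<lambda>U. U \<subseteq> f ` topspace X \<and> openin X {x \<in> topspace X. f x \<in> U})"

lemma openin_quotient_topology:
  "openin (quotient_topology X f) U \<longleftrightarrow>
     U \<subseteq> f ` topspace X \<and> openin X {x \<in> topspace X. f x \<in> U}"
proof -
  let ?pre = "\<lambda>U. {x \<in> topspace X. f x \<in> U}"
  have Int: "?pre (S \<inter> T) = ?pre S \<inter> ?pre T" for S T
    by blast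
  have Un: "?pre (\<Union>\<K>) = \<Union>(?pre ` \<K>)" for \<K>
    by blast
  have "istopology (\<lambda>U. U \<subseteq> f ` topspace X \<and> openin X (?pre U))"
    unfolding istopology_def Int Un by blast
  then show ?thesis
    by (simp only: quotient_topology_def topology_inverse')
qed

text \<open>Points of \<open>G/H\<close> are left cosets, and \<open>G\<close> acts on them by \<open>g <# x\<close>.\<close>

definition coset_space :: "('a, 'e) lie_group \<Rightarrow> 'a set \<Rightarrow> 'a set topology" where
  "coset_space G H = quotient_topology (gtop G) (\<lambda>g. g <#\<^bsub>G\<^esub> H)"

definition std_flat :: "('a, 'e) lie_group \<Rightarrow> 'a set \<Rightarrow> 'a set \<Rightarrow> 'a set set" where
  "std_flat G K A = {a <#\<^bsub>G\<^esub> K | a. a \<in> A}"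

definition std_flat_boundary ::
    "('a, 'e) lie_group \<Rightarrow> 'a set \<Rightarrow> 'a set \<Rightarrow> 'a set \<Rightarrow> 'a set set" where
  "std_flat_boundary G K A P = {w <#\<^bsub>G\<^esub> P | w. w \<in> normalizer_in G K A}"

definition translate :: "('a, 'b) monoid_scheme \<Rightarrow> 'a \<Rightarrow> 'a set set \<Rightarrow> 'a set set" where
  "translate G g S = (\<lambda>x. g <#\<^bsub>G\<^esub> x) ` S"

text \<open>\<open>F\<close> is a maximal flat of \<open>G/K\<close>, with boundary \<open>B\<close> in \<open>G/P\<close>.\<close>

definition maximal_flat_with_boundary ::
    "('a, 'e) lie_group \<Rightarrow> 'a set \<Rightarrow> 'a set \<Rightarrow> 'a set \<Rightarrow> 'a set set \<Rightarrow> 'a set set \<Rightarrow> bool" where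
  "maximal_flat_with_boundary G K A P F B \<longleftrightarrow>
     (\<exists>g\<in>carrier G. F = translate G g (std_flat G K A) \<and>
        B = translate G g (std_flat_boundary G K A P))"

definition flat_through ::
    "('a, 'e) lie_group \<Rightarrow> 'a set \<Rightarrow> 'a set \<Rightarrow> 'a set \<Rightarrow> 'a set \<Rightarrow> 'a set \<Rightarrow> 'a set set" where
  "flat_through G K A P x y =
     (THE F. \<exists>B. maximal_flat_with_boundary G K A P F B \<and> x \<in> B \<and> y \<in> B)"

definition opposite ::
    "('a, 'b) monoid_scheme \<Rightarrow> 'a set \<Rightarrow> 'a \<Rightarrow> 'a set \<Rightarrow> 'a set \<Rightarrow> bool" where
  "opposite G P w\<^sub>0 x y \<longleftrightarrow>
     (\<exists>g\<in>carrier G. x = g <#\<^bsub>G\<^esub> P \<and> y = g <#\<^bsub>G\<^esub> (w\<^sub>0 <#\<^bsub>G\<^esub> P))"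

definition opposite_triples ::
    "('a, 'b) monoid_scheme \<Rightarrow> 'a set \<Rightarrow> 'a \<Rightarrow> ('a set \<times> 'a set \<times> 'a set) set" where
  "opposite_triples G P w\<^sub>0 =
     {(x, y, z). opposite G P w\<^sub>0 x y \<and> opposite G P w\<^sub>0 y z \<and> opposite G P w\<^sub>0 x z}"

definition opposite_triples_topology ::
    "('a, 'e) lie_group \<Rightarrow> 'a set \<Rightarrow> 'a \<Rightarrow> ('a set \<times> 'a set \<times> 'a set) topology" where
  "opposite_triples_topology G P w\<^sub>0 =
     subtopology
       (prod_topology (coset_space G P) (prod_topology (coset_space G P) (coset_space G P)))
       (opposite_triples G P w\<^sub>0)"

end

theory Submission
  imports Defs
begin

text \<open>
  Let \<open>N\<^sup>-\<close> be the conjugate of \<open>N\<close> under \<open>w\<^sub>0\<close>. The factorization in the big cell \<open>N\<^sup>-MAN\<close> is unique,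
  and it is continuous because the cell contains a neighbourhood of \<open>\<one>\<close>. If \<open>z\<close> is opposite to
  \<open>P\<close> and to \<open>w\<^sub>0P\<close>, then \<open>z = nw\<^sub>0P\<close> for a unique \<open>n \<in> N\<close>, and \<open>nw\<^sub>0\<close> lies in the big cell. Since \<open>w\<^sub>0\<close>
  inverts \<open>A\<close>, replacing \<open>z\<close> by \<open>bz\<close> with \<open>b \<in> A\<close> multiplies the \<open>A\<close>-component of \<open>nw\<^sub>0\<close> by \<open>b\<^sup>2\<close>, and
  \<open>M\<close> does not change it. Its square root \<open>\<beta>\<close> is therefore equivariant under \<open>MA\<close>, the stabilizer
  of \<open>(P, w\<^sub>0P)\<close>, and \<open>\<Phi>(gP, gw\<^sub>0P, gz) = g\<beta>(z)K\<close> is well defined.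

  The structure theory needed for this is reduced to the contraction \<open>exp(-tH\<^sub>0) n exp(tH\<^sub>0) \<rightarrow> \<one>\<close>
  for \<open>n \<in> N\<close> and \<open>H\<^sub>0\<close> in the positive chamber: it shows that an element of \<open>N\<close> which fixes \<open>H\<^sub>0\<close> is
  trivial, and it replaces the Bruhat decomposition in the proof that the flat through two opposite
  points is unique.
\<close>

section \<open>Preliminaries\<close>

text \<open>In the hyperbolic plane, with x at infinity, y at 0 and z at the real number s, the
  A-component of \<open>n w0\<close> is diag(|s|, 1/|s|). Its square root moves the base point i to
  i|s|, the foot of the perpendicular from z to the geodesic xy; this is the origin of the square
  root. The component is taken of \<open>n w0\<close> and not of an arbitrary representative of z,
  because right factors from P would change it. The main obstacle lies below the geometry.
  \<open>Ad\<close>, \<open>bracket\<close> and \<open>lie_exp\<close> are defined through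
  derivatives and a definite description, so they say nothing until differentiability, existence and
  uniqueness are proved; a large part of the development does this in a single chart. The
  differential equation gives the exponential map modest regularity: continuity near 0 and a
  derivative at 0. The later limit arguments are therefore moved to the identity, by the contracting
  flow or by translations of the big cell, and openness of the cell is drawn from the derivative at
  one point.\<close>

context group
begin

lemma cancel_left [simp]:
  assumes "x \<in> carrier G" "y \<in> carrier G"
  shows "inv x \<otimes> (x \<otimes> y) = y" "x \<otimes> (inv x \<otimes> y) = y"
  using assms by (simp_all add: m_assoc[symmetric])

lemma int_pow_commute:
  assumes "x \<in> carrier G" "y \<in> carrier G" "x \<otimes> y = y \<otimes> x"
  shows "x [^] (i::int) \<otimes> y = y \<otimes> x [^] i"
proof (cases i rule: int_cases)
  case (nonneg n)
  then show ?thesis using assms by (simp add: int_pow_int group_commutes_pow)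
next
  case (neg n)
  have "x [^] Suc n \<otimes> y = y \<otimes> x [^] Suc n" using assms by (intro group_commutes_pow)
  then have "inv (x [^] Suc n) \<otimes> y = y \<otimes> inv (x [^] Suc n)"
    using assms by (metis (no_types, lifting) inv_solve_left inv_solve_right m_assoc m_closed inv_closed nat_pow_closed)
  then show ?thesis unfolding neg by (simp only: int_pow_neg_int[OF assms(1)])
qed

lemma conj_mult:
  "\<lbrakk>g \<in> carrier G; x \<in> carrier G; y \<in> carrier G\<rbrakk> \<Longrightarrow>
    g \<otimes> (x \<otimes> y) \<otimes> inv g = (g \<otimes> x \<otimes> inv g) \<otimes> (g \<otimes> y \<otimes> inv g)"
  by (simp add: m_assoc)

lemma lcos_eq:
  assumes H: "subgroup H G" and ab: "a \<in> carrier G" "b \<in> carrier G"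
  shows "a <# H = b <# H \<longleftrightarrow> inv a \<otimes> b \<in> H"
proof
  assume "a <# H = b <# H"
  then have "b \<in> a <# H" using lcos_self[OF ab(2) H] by simp
  then show "inv a \<otimes> b \<in> H" using subgroup.lcos_module_imp[OF H group_axioms ab(1)] by blast
next
  assume h: "inv a \<otimes> b \<in> H"
  have "b \<in> a <# H"
    unfolding l_coset_def using h ab by (intro UN_I[OF h]) simp
  then show "a <# H = b <# H" using l_repr_independence[OF _ ab(1) H] by blast
qed

lemma lcos_mult: "subgroup H G \<Longrightarrow> a \<in> carrier G \<Longrightarrow> b \<in> carrier G \<Longrightarrow> a <# (b <# H) = (a \<otimes> b) <# H"
  using lcos_m_assoc subgroup.subset by metis

end

lemma limitin_nhdsin: "x \<in> topspace X \<Longrightarrow> limitin X (\<lambda>y. y) x (nhdsin X x)"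
  by (auto simp: limitin_def eventually_nhdsin)

text \<open>Parametrizes a subspace by the whole model space, so that the product of exponentials
  describing the big cell has an open Euclidean domain.\<close>

lemma ex_linear_onto_subspace:
  fixes S :: "'e::euclidean_space set"
  assumes "subspace S"
  obtains q :: "'e \<Rightarrow> 'e" where "linear q" "range q = S"
proof -
  obtain b where b: "b \<subseteq> S" "independent b" "S \<subseteq> span b" using maximal_independent_subset by blast
  then have "span b = S" using assms by (simp add: span_subspace)
  moreover obtain g :: "'e \<Rightarrow> 'e" where "linear g" "range g = span (id ` b)"
    using linear_independent_extend_subspace[OF b(2), of id] by blast
  ultimately show thesis using that[of g] by simp
qed

section \<open>Ordinary differential equations\<close>

text \<open>Mean value inequality behind the Picard estimates. Times in \<open>J\<close> have
  absolute value at most 1, so the factor \<open>|t|\<close> drops out of the bound.\<close>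

lemma vector_derivative_zero_bound:
  fixes h :: "real \<Rightarrow> 'b::real_normed_vector"
  assumes "\<And>t. t \<in> J \<Longrightarrow> (h has_vector_derivative h' t) (at t within J)"
    and "convex J" "0 \<in> J" "J \<subseteq> {-1..1}" "h 0 = 0" "t \<in> J" "B \<ge> 0"
    and "\<And>s. s \<in> J \<Longrightarrow> norm (h' s) \<le> B"
  shows "norm (h t) \<le> B"
proof -
  have "onorm (\<lambda>x. x *\<^sub>R h' s) \<le> B" if "s \<in> J" for s
    by (rule onorm_le) (use assms(8)[OF that] in \<open>simp add: mult.commute[of B] mult_left_mono\<close>)
  then have "norm (h t - h 0) \<le> B * norm (t - 0)"
    using assms by (intro differentiable_bound[where f' = "\<lambda>s x. x *\<^sub>R h' s" and S = J])
      (auto simp: has_vector_derivative_def)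
  also have "\<dots> \<le> B * 1"
    using assms(7) subsetD[OF assms(4,6)] by (intro mult_left_mono) auto
  finally show ?thesis using assms by simp
qed

text \<open>Each partial derivative is bounded on a compact ball; the sum of these bounds over the
  basis bounds the operator norm of the derivative, and the mean value inequality applies.\<close>

lemma Ck_on_1_local_Lipschitz:
  fixes f :: "'a::euclidean_space \<Rightarrow> 'b::euclidean_space"
  assumes f: "Ck_on 1 f S" and "open S" "x \<in> S"
  obtains r L where "r > 0" "cball x r \<subseteq> S" "L \<ge> 0"
    "\<And>y z. y \<in> cball x r \<Longrightarrow> z \<in> cball x r \<Longrightarrow> norm (f y - f z) \<le> L * norm (y - z)"
proof -
  let ?D = "\<lambda>y. frechet_derivative f (at y)"
  obtain r where r: "r > 0" "cball x r \<subseteq> S"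
    using assms open_contains_cball by blast
  have "\<exists>B. \<forall>y\<in>cball x r. norm (?D y b) \<le> B" for b
  proof -
    have "continuous_on (cball x r) (\<lambda>y. ?D y b)"
      using f r(2) by (auto intro: continuous_on_subset[of S])
    then have "bounded ((\<lambda>y. ?D y b) ` cball x r)"
      by (intro compact_imp_bounded compact_continuous_image compact_cball)
    then show ?thesis by (auto simp: bounded_iff)
  qed
  then obtain B where B: "\<And>b y. y \<in> cball x r \<Longrightarrow> norm (?D y b) \<le> B b"
    by metis
  have B0: "0 \<le> B b" for b
    using B[of x b] r(1) by (meson norm_ge_zero order_trans centre_in_cball less_imp_le)
  have hd: "(f has_derivative ?D y) (at y)" if "y \<in> S" for y
    using f that by (simp add: frechet_derivative_works[symmetric])
  have on: "onorm (?D y) \<le> (\<Sum>b\<in>Basis. B b)" if y: "y \<in> cball x r" for y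
  proof (rule onorm_le)
    fix v
    interpret bounded_linear "?D y"
      using hd r(2) y has_derivative_bounded_linear by blast
    have "?D y v = (\<Sum>b\<in>Basis. (v \<bullet> b) *\<^sub>R ?D y b)"
      by (subst (1) euclidean_representation[of v, symmetric]) (simp add: sum scaleR)
    also have "norm \<dots> \<le> (\<Sum>b\<in>Basis. norm v * B b)"
    proof (rule sum_norm_le)
      fix b :: 'a assume "b \<in> Basis"
      then show "norm ((v \<bullet> b) *\<^sub>R ?D y b) \<le> norm v * B b"
        using B[OF y] by (simp add: mult_mono Basis_le_norm)
    qed
    finally show "norm (?D y v) \<le> (\<Sum>b\<in>Basis. B b) * norm v"
      by (simp add: sum_distrib_left mult.commute)
  qed
  have "norm (f y - f z) \<le> (\<Sum>b\<in>Basis. B b) * norm (y - z)" if "y \<in> cball x r" "z \<in> cball x r" for y z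
  proof (rule differentiable_bound[of "cball x r" f ?D])
    show "(f has_derivative ?D w) (at w within cball x r)" if "w \<in> cball x r" for w
      using hd[of w] that r(2) has_derivative_at_withinI by blast
  qed (use that on in auto)
  then show thesis
    using that[of r "\<Sum>b\<in>Basis. B b"] r B0 by (simp add: sum_nonneg)
qed

text \<open>The equation is \<open>u' = F u X\<close>, where the parameter \<open>X\<close> enters
  linearly. The bounds scale with \<open>norm X\<close>, so the time interval stays [-1, 1] and the
  parameter is made small instead.\<close>

locale Picard =
  fixes F :: "'e::euclidean_space \<Rightarrow> 'e \<Rightarrow> 'e" and e :: 'e and r L C :: real
  assumes r: "r > 0" and L: "L > 0" and C: "C > 0"
    and lin: "\<And>p. p \<in> cball e r \<Longrightarrow> linear (F p)"
    and bd: "\<And>p v. p \<in> cball e r \<Longrightarrow> norm (F p v) \<le> C * norm v"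
    and lip: "\<And>p q v. p \<in> cball e r \<Longrightarrow> q \<in> cball e r \<Longrightarrow> norm (F p v - F q v) \<le> L * norm (p - q) * norm v"
begin

text \<open>Starting from the trivial bound \<open>2 * r\<close>, each integration halves the
  distance of the two solutions because \<open>L * norm X \<le> 1/2\<close>. The interval
  \<open>J\<close> is general because it will be the set of times at which both a solution and its
  time shift are defined.\<close>

lemma ode_unique:
  fixes v w :: "real \<Rightarrow> 'e"
  assumes v: "\<And>t. t \<in> J \<Longrightarrow> (v has_vector_derivative F (v t) X) (at t within J)"
    and w: "\<And>t. t \<in> J \<Longrightarrow> (w has_vector_derivative F (w t) X) (at t within J)"
    and vr: "\<And>t. t \<in> J \<Longrightarrow> v t \<in> cball e r" and wr: "\<And>t. t \<in> J \<Longrightarrow> w t \<in> cball e r"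
    and J: "convex J" "0 \<in> J" "J \<subseteq> {-1..1}" and X: "L * norm X \<le> 1/2" and eq: "v 0 = w 0"
    and t: "t \<in> J"
  shows "v t = w t"
proof -
  have est: "\<forall>t\<in>J. norm (v t - w t) \<le> 2 * r * (1/2) ^ n" for n
  proof (induction n)
    case 0
    show ?case
    proof
      fix t assume "t \<in> J"
      then have "norm (v t - e) \<le> r" "norm (w t - e) \<le> r"
        using vr wr by (simp_all add: dist_norm norm_minus_commute)
      then have "norm ((v t - e) - (w t - e)) \<le> r + r"
        by (intro order_trans[OF norm_triangle_ineq4]) auto
      then show "norm (v t - w t) \<le> 2 * r * (1/2) ^ 0" by simp
    qed
  next
    case (Suc n)
    show ?case
    proof
      fix t assume t: "t \<in> J"
      show "norm (v t - w t) \<le> 2 * r * (1/2) ^ Suc n"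
      proof (rule vector_derivative_zero_bound[where h' = "\<lambda>t. F (v t) X - F (w t) X", OF _ J _ t])
        show "((\<lambda>t. v t - w t) has_vector_derivative F (v s) X - F (w s) X) (at s within J)"
          if "s \<in> J" for s
          using v w that by (intro has_vector_derivative_diff) auto
        fix s assume s: "s \<in> J"
        have "norm (F (v s) X - F (w s) X) \<le> L * norm (v s - w s) * norm X"
          using lip vr wr s by blast
        also have "\<dots> = (L * norm X) * norm (v s - w s)" by simp
        also have "\<dots> \<le> 1/2 * (2 * r * (1/2) ^ n)"
          using Suc s X by (intro mult_mono) auto
        finally show "norm (F (v s) X - F (w s) X) \<le> 2 * r * (1/2) ^ Suc n" by simp
      qed (use eq r in auto)
    qed
  qed
  have "(\<lambda>n. 2 * r * (1/2) ^ n) \<longlonglongrightarrow> 2 * r * 0"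
    by (intro tendsto_mult tendsto_const LIMSEQ_power_zero) simp
  then have "norm (v t - w t) \<le> 2 * r * 0"
    using est t by (intro LIMSEQ_le_const) auto
  then show ?thesis by simp
qed

text \<open>Composing with the projection onto the ball makes the vector field globally Lipschitz, so that
  the Picard iteration is defined on all of \<open>[-1, 1]\<close>.\<close>

definition proj :: "'e \<Rightarrow> 'e" where "proj = closest_point (cball e r)"

text \<open>Integration starts at the left endpoint -1, the form in which the integral is
  differentiated; subtracting the integral up to 0 puts the initial value \<open>e\<close> at time
  0.\<close>

definition Pint :: "'e \<Rightarrow> (real \<Rightarrow>\<^sub>C 'e) \<Rightarrow> real \<Rightarrow> 'e" where
  "Pint X u t = e + (integral {-1..t} (\<lambda>s. F (proj (u s)) X) - integral {-1..0} (\<lambda>s. F (proj (u s)) X))"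

text \<open>Clamping the time turns curves on [-1, 1] into bounded continuous functions on the whole
  line, a complete metric space in which the contraction principle applies.\<close>

definition clampt :: "real \<Rightarrow> real" where "clampt t = max (-1) (min 1 t)"

definition Pmap :: "'e \<Rightarrow> (real \<Rightarrow>\<^sub>C 'e) \<Rightarrow> (real \<Rightarrow>\<^sub>C 'e)" where
  "Pmap X u = Bcontfun (\<lambda>t. Pint X u (clampt t))"

lemma proj_in: "proj x \<in> cball e r"
  unfolding proj_def using r by (intro closest_point_in_set) auto

lemma proj_lip: "norm (proj x - proj y) \<le> norm (x - y)"
  using closest_point_lipschitz[of "cball e r" x y] r by (auto simp: proj_def dist_norm)

lemma clampt: "clampt t \<in> {-1..1}" "t \<in> {-1..1} \<Longrightarrow> clampt t = t"
  by (auto simp: clampt_def)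

lemma continuous_F: "continuous_on (cball e r) (\<lambda>p. F p X)"
proof (rule lipschitz_on_continuous_on)
  show "(L * norm X)-lipschitz_on (cball e r) (\<lambda>p. F p X)"
    using lip L by (intro lipschitz_onI) (auto simp: dist_norm algebra_simps)
qed

lemma continuous_proj: "continuous_on S proj"
  unfolding proj_def using r by (intro continuous_on_subset[OF continuous_on_closest_point]) auto

lemma continuous_Fproj: "continuous_on S (\<lambda>s. F (proj (apply_bcontfun u s)) X)"
  by (intro continuous_on_compose2[OF continuous_F] continuous_on_compose2[OF continuous_proj[of UNIV]])
    (use proj_in in auto)

lemma Pint_0 [simp]: "Pint X u 0 = e"
  by (simp add: Pint_def)

lemma Pint_deriv:
  assumes "t \<in> {-1..1}"
  shows "(Pint X u has_vector_derivative F (proj (u t)) X) (at t within {-1..1})"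
proof -
  have "((\<lambda>t. integral {-1..t} (\<lambda>s. F (proj (u s)) X)) has_vector_derivative F (proj (u t)) X)
      (at t within {-1..1})"
    by (intro integral_has_vector_derivative continuous_Fproj assms)
  then show ?thesis
    unfolding Pint_def by (auto intro!: derivative_eq_intros)
qed

lemma Pint_bound:
  assumes "t \<in> {-1..1}"
  shows "norm (Pint X u t - e) \<le> C * norm X"
proof (rule vector_derivative_zero_bound[where J = "{-1..1}" and h' = "\<lambda>s. F (proj (u s)) X - 0"
      and h = "\<lambda>t. Pint X u t - e"])
  show "((\<lambda>t. Pint X u t - e) has_vector_derivative F (proj (u t)) X - 0) (at t within {-1..1})"
    if "t \<in> {-1..1}" for t
    using that by (intro has_vector_derivative_diff Pint_deriv has_vector_derivative_const)
  show "norm (F (proj (u s)) X - 0) \<le> C * norm X" for s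
    using bd[OF proj_in] by simp
qed (use assms C in auto)

lemma apply_Pmap: "apply_bcontfun (Pmap X u) t = Pint X u (clampt t)"
proof -
  have c: "continuous_on {-1..1} (Pint X u)"
    using Pint_deriv by (meson continuous_on_vector_derivative)
  have "continuous_on UNIV (\<lambda>t. Pint X u (clampt t))"
    by (rule continuous_on_compose2[OF c]) (use clampt in \<open>auto simp: clampt_def intro!: continuous_intros\<close>)
  moreover have "norm (Pint X u (clampt t)) \<le> norm e + C * norm X" for t
    using norm_triangle_sub[of "Pint X u (clampt t)" e] Pint_bound[OF clampt(1), of X u t]
    by linarith
  ultimately have "(\<lambda>t. Pint X u (clampt t)) \<in> bcontfun"
    by (rule bcontfun_normI)
  then show ?thesis by (simp add: Pmap_def Bcontfun_inverse)
qed

text \<open>Curve and parameter vary together: for \<open>X = Y\<close> this is the contraction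
  property, and for two fixed points it gives Lipschitz dependence on the parameter.\<close>

lemma Pmap_dist:
  assumes Y: "L * norm Y \<le> 1/2"
  shows "dist (Pmap X u) (Pmap Y v) \<le> C * norm (X - Y) + 1/2 * dist u v"
proof (rule dist_bound)
  fix t
  let ?t = "clampt t"
  have "norm (Pint X u ?t - Pint Y v ?t) \<le> C * norm (X - Y) + 1/2 * dist u v"
  proof (rule vector_derivative_zero_bound[where J = "{-1..1}" and
        h' = "\<lambda>s. F (proj (u s)) X - F (proj (v s)) Y"])
    fix s :: real
    let ?p = "proj (u s)" and ?q = "proj (v s)"
    have "F ?p X - F ?q Y = F ?p (X - Y) + (F ?p Y - F ?q Y)"
      using lin[OF proj_in] by (simp add: linear_diff)
    also have "norm \<dots> \<le> C * norm (X - Y) + 1/2 * dist u v"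
    proof (intro order_trans[OF norm_triangle_ineq] add_mono bd proj_in)
      have "norm (F ?p Y - F ?q Y) \<le> L * norm (?p - ?q) * norm Y"
        by (intro lip proj_in)
      also have "\<dots> = (L * norm Y) * norm (?p - ?q)" by simp
      also have "\<dots> \<le> 1/2 * dist u v"
        using Y proj_lip[of "u s" "v s"] dist_bounded[of u s v]
        by (intro mult_mono) (auto simp: dist_norm)
      finally show "norm (F ?p Y - F ?q Y) \<le> 1/2 * dist u v" .
    qed
    finally show "norm (F ?p X - F ?q Y) \<le> C * norm (X - Y) + 1/2 * dist u v" .
  next
    fix t :: real
    assume "t \<in> {-1..1}"
    then show "((\<lambda>t. Pint X u t - Pint Y v t) has_vector_derivative
        F (proj (u t)) X - F (proj (v t)) Y) (at t within {-1..1})"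
      by (intro has_vector_derivative_diff Pint_deriv)
  qed (use clampt C in auto)
  then show "dist (Pmap X u t) (Pmap Y v t) \<le> C * norm (X - Y) + 1/2 * dist u v"
    by (simp add: apply_Pmap dist_norm)
qed

definition sol :: "'e \<Rightarrow> (real \<Rightarrow>\<^sub>C 'e)" where "sol X = (THE u. Pmap X u = u)"

lemma Pmap_sol:
  assumes "L * norm X \<le> 1/2"
  shows "Pmap X (sol X) = sol X"
proof -
  have "\<exists>!u. Pmap X u = u"
    by (rule banach_fix_type[of "1/2"]) (use Pmap_dist[OF assms, of X] in auto)
  then show ?thesis unfolding sol_def by (rule theI')
qed

lemma sol_eq: "L * norm X \<le> 1/2 \<Longrightarrow> t \<in> {-1..1} \<Longrightarrow> sol X t = Pint X (sol X) t"
  using apply_Pmap[of X "sol X" t] Pmap_sol[of X] clampt(2)[of t] by simp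

text \<open>The term \<open>1/2 * dist u v\<close> of \<open>Pmap_dist\<close> is absorbed into the
  left-hand side, hence the factor 2.\<close>

lemma sol_dist:
  assumes "L * norm X \<le> 1/2" "L * norm Y \<le> 1/2"
  shows "dist (sol X) (sol Y) \<le> 2 * C * norm (X - Y)"
  using Pmap_dist[OF assms(2), of X "sol X" "sol Y"] Pmap_sol assms by simp

text \<open>Below the first bound the Picard map contracts; below the second its fixed point stays
  in the ball, where \<open>proj\<close> is the identity and the original equation holds.\<close>

definition \<delta> :: real where "\<delta> = min (1 / (2 * L)) (r / C)"

lemma \<delta>_pos: "\<delta> > 0"
  using r L C by (simp add: \<delta>_def)

lemma \<delta>D: "norm X \<le> \<delta> \<Longrightarrow> L * norm X \<le> 1/2 \<and> C * norm X \<le> r"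
  using L C by (auto simp: \<delta>_def field_simps)

lemma sol_0: "norm X \<le> \<delta> \<Longrightarrow> sol X 0 = e"
  using sol_eq[of X 0] \<delta>D[of X] by simp

lemma sol_bound: "norm X \<le> \<delta> \<Longrightarrow> t \<in> {-1..1} \<Longrightarrow> norm (sol X t - e) \<le> C * norm X"
  using sol_eq[of X t] \<delta>D[of X] Pint_bound by simp

lemma sol_in: "norm X \<le> \<delta> \<Longrightarrow> t \<in> {-1..1} \<Longrightarrow> sol X t \<in> cball e r"
  using sol_bound[of X t] \<delta>D[of X] by (simp add: dist_norm norm_minus_commute)

lemma sol_deriv:
  assumes "norm X \<le> \<delta>" "t \<in> {-1..1}"
  shows "(sol X has_vector_derivative F (sol X t) X) (at t within {-1..1})"
proof -
  have p: "proj (sol X t) = sol X t"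
    unfolding proj_def using sol_in[OF assms] by (rule closest_point_self)
  have "(Pint X (sol X) has_vector_derivative F (sol X t) X) (at t within {-1..1})"
    using Pint_deriv[OF assms(2), of X "sol X"] p by simp
  then show ?thesis
    by (rule has_vector_derivative_transform[rotated 2]) (use assms sol_eq \<delta>D in auto)
qed

lemma continuous_sol: "continuous_on (cball 0 \<delta>) (\<lambda>X. sol X 1)"
proof (rule lipschitz_on_continuous_on)
  show "(2 * C)-lipschitz_on (cball 0 \<delta>) (\<lambda>X. sol X 1)"
  proof (rule lipschitz_onI)
    fix X Y :: 'e assume "X \<in> cball 0 \<delta>" "Y \<in> cball 0 \<delta>"
    then have "dist (sol X) (sol Y) \<le> 2 * C * norm (X - Y)"
      by (intro sol_dist) (use \<delta>D in auto)
    then show "dist (sol X 1) (sol Y 1) \<le> 2 * C * dist X Y"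
      using dist_bounded[of "sol X" 1 "sol Y"] by (simp add: dist_norm)
  qed (use C in auto)
qed

text \<open>The line \<open>e + t X\<close> satisfies the equation up to
  \<open>F (sol X s) X - F e X\<close>, which is of second order in \<open>X\<close> because the
  solution stays within \<open>C * norm X\<close> of \<open>e\<close>.\<close>

lemma sol_deriv_0:
  assumes Fe: "F e = id"
  shows "((\<lambda>X. sol X 1) has_derivative (\<lambda>X. X)) (at 0)"
proof (rule has_derivativeI_sandwich[where e = \<delta> and H = "\<lambda>X. L * C * norm X"])
  fix X :: 'e assume X: "X \<in> UNIV" "X \<noteq> 0" "dist X 0 < \<delta>"
  have s0: "sol 0 1 = e"
    using sol_bound[of 0 1] \<delta>_pos by simp
  have X': "norm X \<le> \<delta>" using X by simp
  have "norm (sol X 1 - e - 1 *\<^sub>R X) \<le> L * (C * norm X) * norm X"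
  proof (rule vector_derivative_zero_bound[where J = "{-1..1}" and
        h' = "\<lambda>s. F (sol X s) X - F e X" and h = "\<lambda>t. sol X t - e - t *\<^sub>R X"])
    fix s :: real assume s: "s \<in> {-1..1}"
    show "norm (F (sol X s) X - F e X) \<le> L * (C * norm X) * norm X"
      using sol_bound[OF X' s] r L
      by (intro order_trans[OF lip[OF sol_in[OF X' s]]] mult_left_mono mult_right_mono) auto
    have "((\<lambda>t. t *\<^sub>R X) has_vector_derivative X) (at s within {-1..1})"
      by (auto intro!: derivative_eq_intros)
    from has_vector_derivative_diff[OF has_vector_derivative_diff[OF sol_deriv[OF X' s] has_vector_derivative_const] this]
    show "((\<lambda>t. sol X t - e - t *\<^sub>R X) has_vector_derivative F (sol X s) X - F e X) (at s within {-1..1})"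
      by (simp add: Fe)
  qed (use L C sol_0[OF X'] in auto)
  then have "norm (sol X 1 - e - X) \<le> (L * C * norm X) * norm X"
    by (simp only: scaleR_one mult.assoc)
  then have "norm (sol X 1 - e - X) / norm X \<le> L * C * norm X"
    by (subst pos_divide_le_eq) (use X(2) in simp_all)
  then show "norm (sol X 1 - sol 0 1 - (X - 0)) / norm (X - 0) \<le> L * C * norm X"
    by (simp only: s0 diff_0_right)
next
  have "((\<lambda>X. L * C * norm X) \<longlongrightarrow> L * C * 0) (at (0::'e))"
    by (intro tendsto_mult tendsto_const tendsto_norm_zero tendsto_ident_at)
  then show "((\<lambda>X. L * C * norm X) \<longlongrightarrow> 0) (at (0::'e))" by simp
qed (use \<delta>_pos in auto)

end

section \<open>Chart calculus at the identity\<close>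

context lie_group
begin

lemma chart_sub: "c \<in> atlas G \<Longrightarrow> fst c \<subseteq> carrier G"
  using atlas_cover by blast

lemma chart_inj: "c \<in> atlas G \<Longrightarrow> inj_on (snd c) (fst c)"
  using chart_homeomorphic[of c] chart_sub[of c] topspace_gtop
  by (simp add: homeomorphic_map_def Int_absorb1)

lemma chart_inv_left: "c \<in> atlas G \<Longrightarrow> x \<in> fst c \<Longrightarrow> chart_inv c (snd c x) = x"
  unfolding chart_inv_def by (intro inv_into_f_f chart_inj)

lemma chart_inv_right: "p \<in> snd c ` fst c \<Longrightarrow> snd c (chart_inv c p) = p"
  unfolding chart_inv_def by (rule f_inv_into_f)

lemma chart_inv_in: "p \<in> snd c ` fst c \<Longrightarrow> chart_inv c p \<in> fst c"
  unfolding chart_inv_def by (rule inv_into_into)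

lemma continuous_chart:
  "c \<in> atlas G \<Longrightarrow> continuous_map (subtopology (gtop G) (fst c)) euclidean (snd c)"
  using homeomorphic_imp_continuous_map[OF chart_homeomorphic[of c]]
  by (simp add: continuous_map_in_subtopology)

lemma continuous_chart_inv:
  assumes c: "c \<in> atlas G"
  shows "continuous_map (top_of_set (snd c ` fst c)) (gtop G) (chart_inv c)"
proof -
  obtain g where g: "homeomorphic_maps (subtopology (gtop G) (fst c)) (top_of_set (snd c ` fst c)) (snd c) g"
    using chart_homeomorphic[OF c] by (auto simp: homeomorphic_map_maps)
  have "g p = chart_inv c p" if "p \<in> snd c ` fst c" for p
    using g that chart_sub[OF c] topspace_gtop chart_inv_left[OF c]
    by (auto simp: homeomorphic_maps_def)
  moreover have "continuous_map (top_of_set (snd c ` fst c)) (gtop G) g"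
    using g by (auto simp: homeomorphic_maps_def continuous_map_in_subtopology)
  ultimately show ?thesis
    by (auto intro: continuous_map_eq)
qed

text \<open>Continuity is phrased through limits along arbitrary filters, so that the same rules
  serve neighbourhoods, the flow at infinity and product topologies.\<close>

lemma lim_chart:
  assumes c: "c \<in> atlas G" and lim: "limitin (gtop G) f l F" and l: "l \<in> fst c"
  shows "\<forall>\<^sub>F x in F. f x \<in> fst c" "((\<lambda>x. snd c (f x)) \<longlongrightarrow> snd c l) F"
proof -
  show ev: "\<forall>\<^sub>F x in F. f x \<in> fst c"
    using limitinD[OF lim chart_open[OF c] l] .
  have "limitin (subtopology (gtop G) (fst c)) f l F"
    using lim l ev by (simp add: limitin_subtopology)
  from continuous_map_limit[OF continuous_chart[OF c] this]
  show "((\<lambda>x. snd c (f x)) \<longlongrightarrow> snd c l) F" by (simp add: o_def)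
qed

lemma lim_chart_inv:
  assumes c: "c \<in> atlas G" and lim: "(f \<longlongrightarrow> p) F" and p: "p \<in> snd c ` fst c"
  shows "limitin (gtop G) (\<lambda>x. chart_inv c (f x)) (chart_inv c p) F"
proof -
  have "\<forall>\<^sub>F x in F. f x \<in> snd c ` fst c"
    using topological_tendstoD[OF lim chart_image_open[OF c] p] .
  then have "limitin (top_of_set (snd c ` fst c)) f p F"
    using lim p by (simp add: limitin_subtopology)
  from continuous_map_limit[OF continuous_chart_inv[OF c] this]
  show ?thesis by (simp add: o_def)
qed

lemma lim_of_chart:
  assumes c: "c \<in> atlas G" and l: "l \<in> fst c" and ev: "\<forall>\<^sub>F x in F. f x \<in> fst c"
    and lim: "((\<lambda>x. snd c (f x)) \<longlongrightarrow> snd c l) F"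
  shows "limitin (gtop G) f l F"
proof -
  have "limitin (gtop G) (\<lambda>x. chart_inv c (snd c (f x))) l F"
    using lim_chart_inv[OF c lim] l chart_inv_left[OF c l] by auto
  then show ?thesis
    by (rule limitin_transform_eventually[rotated])
      (use ev chart_inv_left[OF c] in \<open>auto elim: eventually_mono\<close>)
qed

lemma lim_carrier: "limitin (gtop G) f l F \<Longrightarrow> l \<in> carrier G"
  using limitin_topspace[of "gtop G" f l F] topspace_gtop by simp

lemma lim_const: "g \<in> carrier G \<Longrightarrow> limitin (gtop G) (\<lambda>x. g) g F"
  by (simp add: topspace_gtop)

lemma lim_mult:
  assumes "limitin (gtop G) f l F" "limitin (gtop G) g m F"
  shows "limitin (gtop G) (\<lambda>x. f x \<otimes> g x) (l \<otimes> m) F"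
proof -
  have "limitin (prod_topology (gtop G) (gtop G)) (\<lambda>x. (f x, g x)) (l, m) F"
    using assms by (simp add: limitin_pairwise o_def)
  from continuous_map_limit[OF mult_continuous this] show ?thesis by (simp add: o_def)
qed

lemma lim_inv:
  assumes "limitin (gtop G) f l F"
  shows "limitin (gtop G) (\<lambda>x. inv f x) (inv l) F"
  using continuous_map_limit[OF inv_continuous assms] by (simp add: o_def)

lemma lim_unique:
  "limitin (gtop G) f l F \<Longrightarrow> limitin (gtop G) f m F \<Longrightarrow> F \<noteq> bot \<Longrightarrow> l = m"
  using Hausdorff limitin_Hausdorff_unique by metis

lemma ex_chart: "g \<in> carrier G \<Longrightarrow> \<exists>c\<in>atlas G. g \<in> fst c"
  using atlas_cover by auto

lemma one_chart: "one_chart G \<in> atlas G" "\<one> \<in> fst (one_chart G)"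
proof -
  have "\<exists>c. c \<in> atlas G \<and> \<one> \<in> fst c" using ex_chart[of \<one>] by auto
  from someI_ex[OF this] show "one_chart G \<in> atlas G" "\<one> \<in> fst (one_chart G)"
    by (auto simp: one_chart_def)
qed

section \<open>The chart at the identity and the multiplication in it\<close>

abbreviation "U \<equiv> fst (one_chart G)"
abbreviation "D \<equiv> coord G ` U"
abbreviation "e0 \<equiv> coord G \<one>"

lemma coord_simps [simp]:
  "x \<in> U \<Longrightarrow> coord_inv G (coord G x) = x"
  "p \<in> D \<Longrightarrow> coord G (coord_inv G p) = p"
  "p \<in> D \<Longrightarrow> coord_inv G p \<in> U"
  "p \<in> D \<Longrightarrow> coord_inv G p \<in> carrier G"
  "\<one> \<in> U" "e0 \<in> D" "coord_inv G e0 = \<one>"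
  using chart_inv_left[OF one_chart(1)] chart_inv_right[of _ "one_chart G"]
    chart_inv_in[of _ "one_chart G"] one_chart chart_sub[OF one_chart(1)]
  by (blast, metis, metis, blast, blast, blast, metis)

lemma U_carrier: "x \<in> U \<Longrightarrow> x \<in> carrier G"
  using chart_sub[OF one_chart(1)] by auto

lemma openin_U: "openin (gtop G) U" and open_D: "open D"
  using one_chart chart_open chart_image_open by auto

lemmas lim_coord = lim_chart[OF one_chart(1)]
lemmas lim_coord_inv = lim_chart_inv[OF one_chart(1)]
lemmas lim_of_coord = lim_of_chart[OF one_chart(1)]

definition \<mu> :: "'e \<times> 'e \<Rightarrow> 'e" where
  "\<mu> = (\<lambda>(p, q). coord G (coord_inv G p \<otimes> coord_inv G q))"

definition O\<mu> :: "('e \<times> 'e) set" where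
  "O\<mu> = {(p, q). p \<in> D \<and> q \<in> D \<and> coord_inv G p \<otimes> coord_inv G q \<in> U}"

lemma smooth_\<mu>: "Ck_on k \<mu> O\<mu>"
  using mult_smooth[OF one_chart(1) one_chart(1) one_chart(1)]
  unfolding smooth_on_def \<mu>_def O\<mu>_def by auto

text \<open>\<open>Ck_on\<close> has its intended meaning on open sets, and the local Lipschitz
  estimate asks for an open domain.\<close>

lemma open_O\<mu>: "open O\<mu>"
proof (subst open_subopen, safe)
  fix p q assume pq: "(p, q) \<in> O\<mu>"
  let ?F = "nhds (p, q)"
  have lf: "(fst \<longlongrightarrow> p) ?F" "(snd \<longlongrightarrow> q) ?F"
    using filterlim_ident[of ?F] tendsto_fst[of "\<lambda>x. x" "(p,q)" ?F] tendsto_snd[of "\<lambda>x. x" "(p,q)" ?F] by auto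
  have D: "p \<in> D" "q \<in> D" "coord_inv G p \<otimes> coord_inv G q \<in> U" using pq by (auto simp: O\<mu>_def)
  have "limitin (gtop G) (\<lambda>x. coord_inv G (fst x) \<otimes> coord_inv G (snd x))
      (coord_inv G p \<otimes> coord_inv G q) ?F"
    using lf D by (intro lim_mult lim_coord_inv) auto
  from lim_coord(1)[OF this D(3)] topological_tendstoD[OF lf(1) open_D D(1)]
    topological_tendstoD[OF lf(2) open_D D(2)]
  have "\<forall>\<^sub>F x in ?F. x \<in> O\<mu>"
    by eventually_elim (auto simp: O\<mu>_def)
  then show "\<exists>T. open T \<and> (p, q) \<in> T \<and> T \<subseteq> O\<mu>"
    unfolding eventually_nhds by blast
qed

abbreviation "D\<mu> x \<equiv> frechet_derivative \<mu> (at x)"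

lemma \<mu>_deriv: "x \<in> O\<mu> \<Longrightarrow> (\<mu> has_derivative D\<mu> x) (at x)"
  using smooth_\<mu>[of 1] by (simp add: frechet_derivative_works[symmetric])

lemma D\<mu>_diff: "x \<in> O\<mu> \<Longrightarrow> (\<lambda>x. D\<mu> x v) differentiable (at x)"
  using smooth_\<mu>[of "Suc (Suc 0)"] unfolding Ck_on.simps by blast

lemma D\<mu>_C1: "Ck_on 1 (\<lambda>x. D\<mu> x v) O\<mu>"
  using smooth_\<mu>[of "Suc 1"] by (simp only: Ck_on.simps)

lemma O\<mu>_e0: "p \<in> D \<Longrightarrow> (p, e0) \<in> O\<mu>" "p \<in> D \<Longrightarrow> (e0, p) \<in> O\<mu>"
  by (auto simp: O\<mu>_def U_carrier)

lemma \<mu>_e0: "p \<in> D \<Longrightarrow> \<mu> (p, e0) = p" "p \<in> D \<Longrightarrow> \<mu> (e0, p) = p"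
  by (auto simp: \<mu>_def U_carrier)

lemma linear_D\<mu>: "x \<in> O\<mu> \<Longrightarrow> linear (D\<mu> x)"
  using \<mu>_deriv has_derivative_linear by blast

lemma D\<mu>_e0: 
  assumes p: "p \<in> D"
  shows "D\<mu> (p, e0) (v, 0) = v" "D\<mu> (e0, p) (0, v) = v"
proof -
  have "((\<lambda>q. \<mu> (q, e0)) has_derivative (\<lambda>v. D\<mu> (p, e0) (v, 0))) (at p)"
    by (rule has_derivative_compose[of "\<lambda>q. (q, e0)" _ _ _ \<mu>])
      (use p O\<mu>_e0 \<mu>_deriv in \<open>auto intro!: derivative_eq_intros\<close>)
  moreover have "((\<lambda>q. \<mu> (q, e0)) has_derivative (\<lambda>v. v)) (at p)"
    by (rule has_derivative_transform_within_open[OF has_derivative_ident open_D p]) (simp add: \<mu>_e0)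
  ultimately show "D\<mu> (p, e0) (v, 0) = v"
    using has_derivative_unique by metis
  have "((\<lambda>q. \<mu> (e0, q)) has_derivative (\<lambda>v. D\<mu> (e0, p) (0, v))) (at p)"
    by (rule has_derivative_compose[of "\<lambda>q. (e0, q)" _ _ _ \<mu>])
      (use p O\<mu>_e0 \<mu>_deriv in \<open>auto intro!: derivative_eq_intros\<close>)
  moreover have "((\<lambda>q. \<mu> (e0, q)) has_derivative (\<lambda>v. v)) (at p)"
    by (rule has_derivative_transform_within_open[OF has_derivative_ident open_D p]) (simp add: \<mu>_e0)
  ultimately show "D\<mu> (e0, p) (0, v) = v"
    using has_derivative_unique by metis
qed

lemma D\<mu>_one: "D\<mu> (e0, e0) (v, w) = v + w"
  using linear_add[OF linear_D\<mu>[of "(e0,e0)"], of "(v,0)" "(0,w)"] D\<mu>_e0[of e0] O\<mu>_e0[of e0] by simp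

text \<open>Derivative of a group-valued map at a point where its value is \<open>\<one>\<close>,
  read in the chart there. The values near the point must lie in the chart, since
  \<open>coord G\<close> is arbitrary outside it.\<close>

definition has_cder :: "('x::real_normed_vector \<Rightarrow> 'a) \<Rightarrow> ('x \<Rightarrow> 'e) \<Rightarrow> 'x \<Rightarrow> bool" where
  "has_cder f f' x \<longleftrightarrow> f x = \<one> \<and> (\<forall>\<^sub>F y in nhds x. f y \<in> U) \<and>
     ((\<lambda>y. coord G (f y)) has_derivative f') (at x)"

lemma has_cder_lim: "has_cder f f' x \<Longrightarrow> limitin (gtop G) f \<one> (nhds x)"
  unfolding has_cder_def
  by (metis coord_simps(5) has_derivative_continuous isCont_def lim_of_coord tendsto_at_iff_tendsto_nhds)

lemma has_cder_unique: "has_cder f f' x \<Longrightarrow> has_cder f g' x \<Longrightarrow> f' = g'"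
  unfolding has_cder_def using has_derivative_unique by blast

lemma has_cderI:
  assumes "limitin (gtop G) f \<one> (nhds x)" "f x = \<one>" "((\<lambda>y. coord G (f y)) has_derivative f') (at x)"
  shows "has_cder f f' x"
  using assms lim_coord(1)[OF assms(1)] by (simp add: has_cder_def)

lemma has_cder_cong:
  assumes "has_cder f f' x" "\<forall>\<^sub>F y in nhds x. f y = g y"
  shows "has_cder g f' x"
proof -
  have "\<forall>\<^sub>F y in nhds x. g y \<in> U"
    using assms unfolding has_cder_def by (auto elim: eventually_elim2)
  moreover have "\<forall>\<^sub>F y in at x. coord G (f y) = coord G (g y)"
    using assms(2) by (auto simp: eventually_at_filter elim: eventually_mono)
  moreover have "g x = f x" using eventually_nhds_x_imp_x[OF assms(2)] by simp
  ultimately show ?thesis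
    using assms(1) unfolding has_cder_def
    by (auto intro: has_derivative_transform_eventually)
qed

lemma has_cder_compose:
  assumes "has_cder f f' (h x)" "(h has_derivative h') (at x)"
  shows "has_cder (\<lambda>y. f (h y)) (\<lambda>v. f' (h' v)) x"
proof (rule has_cderI)
  have "(h \<longlongrightarrow> h x) (nhds x)"
    using has_derivative_continuous[OF assms(2)] by (simp add: isCont_def tendsto_at_iff_tendsto_nhds)
  with has_cder_lim[OF assms(1)] show "limitin (gtop G) (\<lambda>y. f (h y)) \<one> (nhds x)"
    unfolding limitin_def filterlim_iff by blast
  show "((\<lambda>y. coord G (f (h y))) has_derivative (\<lambda>v. f' (h' v))) (at x)"
    using assms has_derivative_compose[of h h' x UNIV "\<lambda>y. coord G (f y)" f'] by (simp add: has_cder_def)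
qed (use assms in \<open>simp add: has_cder_def\<close>)

lemma has_cder_mult:
  assumes f: "has_cder f f' x" and g: "has_cder g g' x"
  shows "has_cder (\<lambda>y. f y \<otimes> g y) (\<lambda>v. f' v + g' v) x"
proof (rule has_cderI)
  show "limitin (gtop G) (\<lambda>y. f y \<otimes> g y) \<one> (nhds x)"
    using lim_mult[OF has_cder_lim[OF f] has_cder_lim[OF g]] by simp
  have fg: "f x = \<one>" "g x = \<one>" using f g by (auto simp: has_cder_def)
  then show "f x \<otimes> g x = \<one>" by simp
  have "((\<lambda>y. (coord G (f y), coord G (g y))) has_derivative (\<lambda>v. (f' v, g' v))) (at x)"
    using f g by (intro has_derivative_Pair) (auto simp: has_cder_def)
  from has_derivative_compose[OF this, of \<mu> "D\<mu> (e0, e0)"]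
  have d: "((\<lambda>y. \<mu> (coord G (f y), coord G (g y))) has_derivative (\<lambda>v. f' v + g' v)) (at x)"
    using \<mu>_deriv[of "(e0, e0)"] O\<mu>_e0 fg by (simp add: D\<mu>_one)
  have "\<forall>\<^sub>F y in nhds x. f y \<in> U" "\<forall>\<^sub>F y in nhds x. g y \<in> U"
    using f g by (auto simp: has_cder_def)
  then have "\<forall>\<^sub>F y in nhds x. \<mu> (coord G (f y), coord G (g y)) = coord G (f y \<otimes> g y)"
    by eventually_elim (simp add: \<mu>_def)
  then have "\<forall>\<^sub>F y in at x. \<mu> (coord G (f y), coord G (g y)) = coord G (f y \<otimes> g y)"
    by (auto simp: eventually_at_filter elim: eventually_mono)
  from has_derivative_transform_eventually[OF d this]
  show "((\<lambda>y. coord G (f y \<otimes> g y)) has_derivative (\<lambda>v. f' v + g' v)) (at x)"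
    using fg O\<mu>_e0 \<mu>_e0 by simp
qed

lemma has_cder_coord_inv: "has_cder (coord_inv G) (\<lambda>v. v) e0"
proof (rule has_cderI)
  show "((\<lambda>y. coord G (coord_inv G y)) has_derivative (\<lambda>v. v)) (at e0)"
    by (rule has_derivative_transform_within_open[OF has_derivative_ident open_D]) auto
  show "limitin (gtop G) (coord_inv G) \<one> (nhds e0)"
    using lim_coord_inv[of "\<lambda>x. x" e0 "nhds e0"] by (simp add: filterlim_ident)
qed auto

text \<open>\<open>Ad\<close> is a chosen derivative, so differentiability of the conjugation has to
  be established first. As \<open>g\<close> may lie outside the chart at \<open>\<one>\<close>, the
  conjugation is factored through charts around \<open>g\<close> and \<open>inv g\<close>.\<close>

lemma Ad_deriv:
  assumes g: "g \<in> carrier G"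
  shows "((\<lambda>p. coord G (g \<otimes> coord_inv G p \<otimes> inv g)) has_derivative Ad G g) (at e0)"
proof -
  obtain c d where c: "c \<in> atlas G" "g \<in> fst c" and d: "d \<in> atlas G" "inv g \<in> fst d"
    using ex_chart g by (meson inv_closed)
  let ?m = "\<lambda>(p, q). snd c (chart_inv c p \<otimes> coord_inv G q)"
  let ?n = "\<lambda>(p, q). coord G (chart_inv c p \<otimes> chart_inv d q)"
  note o = one_chart(1)
  have "?m differentiable (at (snd c g, e0))"
    using mult_smooth[OF c(1) o c(1)] c g chart_inv_left[OF c]
    unfolding smooth_on_def by (auto dest!: spec[of _ "Suc 0"])
  then have m: "(\<lambda>q. ?m (snd c g, q)) differentiable (at e0)"
    by (rule differentiable_compose[where f = ?m]) (auto intro!: derivative_intros)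
  have "?n differentiable (at (snd c g, snd d (inv g)))"
    using mult_smooth[OF c(1) d(1) o] c d g chart_inv_left[OF c] chart_inv_left[OF d]
    unfolding smooth_on_def by (auto dest!: spec[of _ "Suc 0"])
  then have n: "(\<lambda>p. ?n (p, snd d (inv g))) differentiable (at (snd c g))"
    by (rule differentiable_compose[where f = ?n]) (auto intro!: derivative_intros)
  have "(\<lambda>q. ?n (?m (snd c g, q), snd d (inv g))) differentiable (at e0)"
    by (rule differentiable_compose[OF _ m, where f = "\<lambda>p. ?n (p, snd d (inv g))"])
      (use n c g chart_inv_left[OF c] in auto)
  moreover have "\<forall>\<^sub>F p in nhds e0. ?n (?m (snd c g, p), snd d (inv g)) =
      coord G (g \<otimes> coord_inv G p \<otimes> inv g)"
  proof -
    have "limitin (gtop G) (\<lambda>p. g \<otimes> coord_inv G p) (g \<otimes> \<one>) (nhds e0)"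
      by (intro lim_mult lim_const g has_cder_lim[OF has_cder_coord_inv])
    from lim_chart(1)[OF c(1) this] c g have "\<forall>\<^sub>F p in nhds e0. g \<otimes> coord_inv G p \<in> fst c" by simp
    then show ?thesis
      by eventually_elim (simp add: chart_inv_left c d)
  qed
  ultimately have "(\<lambda>p. coord G (g \<otimes> coord_inv G p \<otimes> inv g)) differentiable (at e0)"
    unfolding differentiable_def eventually_nhds
    using has_derivative_transform_within_open by (metis (no_types, lifting))
  then show ?thesis by (simp add: Ad_def frechet_derivative_works[symmetric])
qed

lemma has_cder_conj:
  assumes g: "g \<in> carrier G" and f: "has_cder f f' x"
  shows "has_cder (\<lambda>y. g \<otimes> f y \<otimes> inv g) (\<lambda>v. Ad G g (f' v)) x"
proof -
  have "has_cder (\<lambda>p. g \<otimes> coord_inv G p \<otimes> inv g) (Ad G g) e0"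
  proof (rule has_cderI[OF _ _ Ad_deriv[OF g]])
    have "limitin (gtop G) (\<lambda>p. g \<otimes> coord_inv G p \<otimes> inv g) (g \<otimes> \<one> \<otimes> inv g) (nhds e0)"
      by (intro lim_mult lim_const g inv_closed has_cder_lim[OF has_cder_coord_inv])
    then show "limitin (gtop G) (\<lambda>p. g \<otimes> coord_inv G p \<otimes> inv g) \<one> (nhds e0)"
      using g by simp
  qed (use g in simp)
  then have "has_cder (\<lambda>y. g \<otimes> coord_inv G (coord G (f y)) \<otimes> inv g) (\<lambda>v. Ad G g (f' v)) x"
    using f by (intro has_cder_compose[where h = "\<lambda>y. coord G (f y)"]) (auto simp: has_cder_def)
  then show ?thesis
    by (rule has_cder_cong) (use f in \<open>auto simp: has_cder_def elim: eventually_mono\<close>)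
qed

lemma linear_Ad: "g \<in> carrier G \<Longrightarrow> linear (Ad G g)"
  using Ad_deriv has_derivative_linear by blast

lemma Ad_mult:
  assumes "g \<in> carrier G" "h \<in> carrier G"
  shows "Ad G (g \<otimes> h) X = Ad G g (Ad G h X)"
proof -
  have "has_cder (\<lambda>p. (g \<otimes> h) \<otimes> coord_inv G p \<otimes> inv (g \<otimes> h)) (\<lambda>v. Ad G (g \<otimes> h) v) e0"
    using assms by (intro has_cder_conj has_cder_coord_inv) auto
  moreover have "has_cder (\<lambda>p. g \<otimes> (h \<otimes> coord_inv G p \<otimes> inv h) \<otimes> inv g) (\<lambda>v. Ad G g (Ad G h v)) e0"
    using assms by (intro has_cder_conj has_cder_coord_inv) auto
  then have "has_cder (\<lambda>p. (g \<otimes> h) \<otimes> coord_inv G p \<otimes> inv (g \<otimes> h)) (\<lambda>v. Ad G g (Ad G h v)) e0"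
    by (rule has_cder_cong)
      (use assms in \<open>auto intro!: eventually_mono[OF eventually_nhds_in_open[OF open_D]] simp: m_assoc inv_mult_group U_carrier\<close>)
  ultimately show ?thesis using has_cder_unique by metis
qed

lemma Ad_one: "Ad G \<one> X = X"
proof -
  have "has_cder (\<lambda>p. \<one> \<otimes> coord_inv G p \<otimes> inv \<one>) (\<lambda>v. Ad G \<one> v) e0"
    by (intro has_cder_conj has_cder_coord_inv) auto
  then have "has_cder (coord_inv G) (\<lambda>v. Ad G \<one> v) e0"
    by (rule has_cder_cong) (auto intro!: eventually_mono[OF eventually_nhds_in_open[OF open_D]] simp: U_carrier)
  then show ?thesis using has_cder_unique has_cder_coord_inv by metis
qed

end

section \<open>One-parameter subgroups and the exponential map\<close>

context lie_group
begin

text \<open>In the chart at \<open>\<one>\<close>, \<open>F p\<close> is the left translation of tangent vectors from \<open>\<one>\<close> to \<open>p\<close>. Hence the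
  one-parameter subgroups are the solutions of \<open>u' = F u X\<close>.\<close>

definition F :: "'e \<Rightarrow> 'e \<Rightarrow> 'e" where "F p v = D\<mu> (p, e0) (0, v)"

lemma F_deriv:
  assumes "q \<in> D"
  shows "((\<lambda>h. \<mu> (q, h)) has_derivative F q) (at e0)"
proof -
  have "((\<lambda>h. (q, h)) has_derivative (\<lambda>v. (0, v))) (at e0)"
    by (intro has_derivative_Pair has_derivative_const has_derivative_ident)
  from has_derivative_compose[OF this \<mu>_deriv[OF O\<mu>_e0(1)[OF assms]]]
  show ?thesis unfolding F_def[abs_def] .
qed

lemma linear_F: "p \<in> D \<Longrightarrow> linear (F p)"
  using F_deriv has_derivative_linear by blast

lemma F_e0: "F e0 = id"
  by (simp add: F_def D\<mu>_e0 fun_eq_iff)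

text \<open>Left invariance of the field: associativity of \<open>\<mu>\<close>, differentiated in
  the last argument at \<open>e0\<close>. It makes a left translate of a solution a solution
  again.\<close>

lemma F_assoc:
  assumes pq: "(p, q) \<in> O\<mu>"
  shows "D\<mu> (p, q) (0, F q v) = F (\<mu> (p, q)) v"
proof -
  have D: "p \<in> D" "q \<in> D" "\<mu> (p, q) \<in> D" "coord_inv G p \<otimes> coord_inv G q \<in> U"
    using pq by (auto simp: O\<mu>_def \<mu>_def)
  have pair: "((\<lambda>h. (x, h)) has_derivative (\<lambda>v. (0, v))) (at y)" for x y :: 'e
    by (intro has_derivative_Pair has_derivative_const has_derivative_ident)
  have d1: "((\<lambda>h. \<mu> (q, h)) has_derivative F q) (at e0)"
    using F_deriv[OF D(2)] .
  have "((\<lambda>h. \<mu> (p, h)) has_derivative (\<lambda>v. D\<mu> (p, q) (0, v))) (at (\<mu> (q, e0)))"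
    using has_derivative_compose[OF pair \<mu>_deriv[OF pq]] \<mu>_e0(1)[OF D(2)] by simp
  from has_derivative_compose[OF d1 this]
  have l: "((\<lambda>h. \<mu> (p, \<mu> (q, h))) has_derivative (\<lambda>v. D\<mu> (p, q) (0, F q v))) (at e0)" .
  have r: "((\<lambda>h. \<mu> (\<mu> (p, q), h)) has_derivative F (\<mu> (p, q))) (at e0)"
    using F_deriv[OF D(3)] .
  define S where "S = {h. (q, h) \<in> O\<mu>}"
  have "open S"
    using open_vimage[OF open_O\<mu>, of "Pair q"] by (simp add: S_def vimage_def continuous_on_Pair)
  moreover have "e0 \<in> S" using O\<mu>_e0(1)[OF D(2)] by (simp add: S_def)
  moreover have "\<mu> (\<mu> (p, q), h) = \<mu> (p, \<mu> (q, h))" if "h \<in> S" for h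
  proof -
    have "h \<in> D" "coord_inv G q \<otimes> coord_inv G h \<in> U" using that by (auto simp: S_def O\<mu>_def)
    then show ?thesis using D by (simp add: \<mu>_def m_assoc)
  qed
  ultimately have "((\<lambda>h. \<mu> (p, \<mu> (q, h))) has_derivative F (\<mu> (p, q))) (at e0)"
    by (rule has_derivative_transform_within_open[OF r])
  with l show ?thesis using has_derivative_unique by metis
qed

text \<open>\<open>F p v\<close> is linear in \<open>v\<close>, so Lipschitz bounds for the finitely
  many basis vectors suffice, on the smallest of their radii.\<close>

lemma ex_Picard: "\<exists>r L C. Picard F e0 r L C \<and> cball e0 r \<subseteq> D"
proof -
  have "\<exists>r L. r > 0 \<and> L \<ge> 0 \<and> cball (e0, e0) r \<subseteq> O\<mu> \<and> (\<forall>y\<in>cball (e0, e0) r. \<forall>z\<in>cball (e0, e0) r.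
      norm (D\<mu> y (0, b) - D\<mu> z (0, b)) \<le> L * norm (y - z))" for b
    using Ck_on_1_local_Lipschitz[OF D\<mu>_C1 open_O\<mu> O\<mu>_e0(1)[of e0]] by (metis coord_simps(6))
  then obtain r L where r: "\<And>b. r b > 0" and L: "\<And>b. L b \<ge> 0"
    and O: "\<And>b. cball (e0, e0) (r b) \<subseteq> O\<mu>"
    and rL: "\<And>b y z. y \<in> cball (e0, e0) (r b) \<Longrightarrow> z \<in> cball (e0, e0) (r b) \<Longrightarrow>
      norm (D\<mu> y (0, b) - D\<mu> z (0, b)) \<le> L b * norm (y - z)"
    by metis
  define R where "R = Min (r ` Basis)"
  \<comment> \<open>The summand 1 makes the constant strictly positive.\<close>
  define LL where "LL = (\<Sum>b\<in>Basis. L b) + 1"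
  have R0: "R > 0" using r by (auto simp: R_def)
  have Rr: "(p, e0) \<in> cball (e0, e0) (r b)" if "p \<in> cball e0 R" "b \<in> Basis" for p b
  proof -
    have "dist e0 p \<le> r b" using that by (auto simp: R_def)
    then show ?thesis by (simp add: dist_Pair_Pair)
  qed
  have RD: "cball e0 R \<subseteq> D"
    using Rr O SOME_Basis by (force simp: O\<mu>_def)
  have lip: "norm (F p v - F q v) \<le> LL * norm (p - q) * norm v" if p: "p \<in> cball e0 R" and q: "q \<in> cball e0 R" for p q v
  proof -
    have rep: "F x v = (\<Sum>b\<in>Basis. (v \<bullet> b) *\<^sub>R F x b)" if "x \<in> D" for x
    proof -
      interpret linear "F x" using linear_F[OF that] .
      show ?thesis by (subst (1) euclidean_representation[of v, symmetric]) (simp add: sum scale)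
    qed
    have "F p v - F q v = (\<Sum>b\<in>Basis. (v \<bullet> b) *\<^sub>R (F p b - F q b))"
      using rep[of p] rep[of q] p q RD by (simp add: sum_subtractf scaleR_diff_right subset_iff)
    also have "norm \<dots> \<le> (\<Sum>b\<in>Basis. norm v * (L b * norm (p - q)))"
    proof (rule sum_norm_le)
      fix b :: 'e assume b: "b \<in> Basis"
      have "norm (F p b - F q b) \<le> L b * norm ((p, e0) - (q, e0))"
        unfolding F_def using p q b by (intro rL Rr)
      then have "norm (F p b - F q b) \<le> L b * norm (p - q)" by (simp add: norm_Pair)
      then show "norm ((v \<bullet> b) *\<^sub>R (F p b - F q b)) \<le> norm v * (L b * norm (p - q))"
        using b by (simp add: mult_mono Basis_le_norm)
    qed
    also have "\<dots> = (\<Sum>b\<in>Basis. L b) * norm (p - q) * norm v"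
      by (simp add: sum_distrib_left sum_distrib_right mult_ac)
    also have "\<dots> \<le> LL * norm (p - q) * norm v"
      by (intro mult_right_mono) (auto simp: LL_def)
    finally show ?thesis .
  qed
  have LL0: "LL > 0" using L by (simp add: LL_def add_nonneg_pos sum_nonneg)
  \<comment> \<open>\<open>F e0\<close> is the identity, and within distance \<open>R\<close> of
    \<open>e0\<close> the field changes by at most \<open>LL * R * norm v\<close>.\<close>
  have "Picard F e0 R LL (1 + LL * R)"
  proof (rule Picard.intro)
    show "linear (F p)" if "p \<in> cball e0 R" for p
      using linear_F that RD by blast
    show "norm (F p v) \<le> (1 + LL * R) * norm v" if p: "p \<in> cball e0 R" for p v
    proof -
      have "norm (F p v) \<le> norm (F e0 v) + norm (F p v - F e0 v)"
        by (metis norm_triangle_sub)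
      also have "\<dots> \<le> norm v + LL * R * norm v"
        using p R0 LL0
        by (intro add_mono order_trans[OF lip[OF p]] mult_right_mono mult_left_mono)
          (auto simp: F_e0 dist_norm norm_minus_commute)
      finally show ?thesis by (simp add: algebra_simps)
    qed
  qed (use R0 LL0 lip in \<open>auto intro: add_pos_pos\<close>)
  then show ?thesis using RD by blast
qed

section \<open>One-parameter subgroups\<close>

lemma one_param_lim:
  assumes "one_param_subgroup G X \<gamma>"
  shows "limitin (gtop G) \<gamma> (\<gamma> t) (nhds t)"
proof -
  have "limitin euclideanreal (\<lambda>x. x) t (nhds t)" by (simp add: filterlim_ident)
  from continuous_map_limit[OF _ this, of "gtop G" \<gamma>] assms show ?thesis
    by (simp add: one_param_subgroup_def o_def)
qed

lemma one_param_carrier: "one_param_subgroup G X \<gamma> \<Longrightarrow> \<gamma> t \<in> carrier G"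
  using one_param_lim lim_carrier by blast

lemma one_param_0:
  assumes "one_param_subgroup G X \<gamma>"
  shows "\<gamma> 0 = \<one>"
proof -
  have "\<gamma> 0 \<otimes> \<gamma> 0 = \<gamma> 0"
    using assms unfolding one_param_subgroup_def by (metis add_0)
  then show ?thesis
    using one_param_carrier[OF assms, of 0] by (simp add: l_cancel_one)
qed

lemma one_param_scale:
  assumes "one_param_subgroup G X \<gamma>"
  shows "one_param_subgroup G (c *\<^sub>R X) (\<lambda>t. \<gamma> (c * t))"
  unfolding one_param_subgroup_def
proof (intro conjI allI)
  have "continuous_map euclideanreal euclideanreal (\<lambda>t. c * t)"
    by (simp add: continuous_intros)
  then show "continuous_map euclideanreal (gtop G) (\<lambda>t. \<gamma> (c * t))"
    using assms continuous_map_compose[of euclideanreal euclideanreal "\<lambda>t. c * t" "gtop G" \<gamma>]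
    by (simp add: one_param_subgroup_def o_def)
  show "\<gamma> (c * (s + t)) = \<gamma> (c * s) \<otimes> \<gamma> (c * t)" for s t
    using assms by (simp add: one_param_subgroup_def distrib_left)
  have "((\<lambda>t. coord G (\<gamma> t)) has_derivative (\<lambda>h. h *\<^sub>R X)) (at (c * 0))"
    using assms by (simp add: one_param_subgroup_def has_vector_derivative_def)
  moreover have "((\<lambda>t. c * t) has_derivative (\<lambda>h. c * h)) (at 0)"
    by (auto intro!: derivative_eq_intros)
  ultimately have "((\<lambda>t. coord G (\<gamma> (c * t))) has_derivative (\<lambda>h. (c * h) *\<^sub>R X)) (at 0)"
    using has_derivative_compose by blast
  then show "((\<lambda>t. coord G (\<gamma> (c * t))) has_vector_derivative c *\<^sub>R X) (at 0)"
    by (simp add: has_vector_derivative_def mult.commute)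
qed

lemma one_param_has_cder:
  assumes "one_param_subgroup G X \<gamma>"
  shows "has_cder \<gamma> (\<lambda>h. h *\<^sub>R X) 0"
  using one_param_lim[OF assms, of 0] one_param_0[OF assms] assms
  by (intro has_cderI) (auto simp: one_param_subgroup_def has_vector_derivative_def)

text \<open>The derivative at \<open>t\<close> comes from the one at 0 through
  \<open>\<gamma> s = \<gamma> t \<otimes> \<gamma> (s - t)\<close>.\<close>

lemma one_param_ode:
  assumes op: "one_param_subgroup G X \<gamma>" and t: "\<gamma> t \<in> U"
  shows "((\<lambda>t. coord G (\<gamma> t)) has_vector_derivative F (coord G (\<gamma> t)) X) (at t)"
proof -
  let ?c = "\<lambda>t. coord G (\<gamma> t)"
  have D: "?c t \<in> D" using t by simp
  have c0: "?c 0 = e0" using one_param_0[OF op] by simp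
  have "((\<lambda>h. (?c t, ?c h)) has_derivative (\<lambda>h. (0, h *\<^sub>R X))) (at 0)"
    using one_param_has_cder[OF op] by (intro has_derivative_Pair) (auto simp: has_cder_def)
  from has_derivative_compose[OF this, of \<mu> "D\<mu> (?c t, e0)"] \<mu>_deriv[OF O\<mu>_e0(1)[OF D]]
  have "((\<lambda>h. \<mu> (?c t, ?c h)) has_derivative (\<lambda>h. D\<mu> (?c t, e0) (0, h *\<^sub>R X))) (at 0)"
    by (simp add: c0)
  then have d: "((\<lambda>h. \<mu> (?c t, ?c h)) has_derivative (\<lambda>h. h *\<^sub>R F (?c t) X)) (at (t - t))"
    using linear_scale[OF linear_F[OF D]] by (simp add: F_def)
  have "((\<lambda>s. s - t) has_derivative (\<lambda>h. h)) (at t)"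
    by (auto intro!: derivative_eq_intros)
  from has_derivative_compose[OF this d]
  have d2: "((\<lambda>s. \<mu> (?c t, ?c (s - t))) has_derivative (\<lambda>h. h *\<^sub>R F (?c t) X)) (at t)" .
  have "\<forall>\<^sub>F h in nhds 0. \<gamma> h \<in> U"
    using one_param_has_cder[OF op] by (simp add: has_cder_def)
  moreover have "((\<lambda>s. s - t) \<longlongrightarrow> t - t) (at t)" by (intro tendsto_intros)
  ultimately have "\<forall>\<^sub>F s in at t. \<gamma> (s - t) \<in> U"
    by (auto simp: filterlim_iff)
  then have "\<forall>\<^sub>F s in at t. \<mu> (?c t, ?c (s - t)) = ?c s"
  proof eventually_elim
    case (elim s)
    have "\<gamma> s = \<gamma> t \<otimes> \<gamma> (s - t)"
      using op unfolding one_param_subgroup_def by (metis add_diff_cancel_left' add_diff_eq diff_add_cancel)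
    then show ?case using elim t by (simp add: \<mu>_def)
  qed
  from has_derivative_transform_eventually[OF d2 this] show ?thesis
    using D \<mu>_e0(1)[OF D] c0 by (simp add: has_vector_derivative_def)
qed

text \<open>Uniqueness for the differential equation covers small times; the homomorphism property
  carries it from \<open>1 / n\<close> to 1 by \<open>n\<close>-th powers.\<close>

lemma one_param_unique:
  assumes 1: "one_param_subgroup G X \<gamma>1" and 2: "one_param_subgroup G X \<gamma>2"
  shows "\<gamma>1 1 = \<gamma>2 1"
proof -
  obtain r L C where P: "Picard F e0 r L C" and rD: "cball e0 r \<subseteq> D" using ex_Picard by blast
  interpret Picard F e0 r L C by (rule P)
  have small: "\<exists>\<tau>>0. \<forall>t. \<bar>t\<bar> \<le> \<tau> \<longrightarrow> \<gamma> t \<in> U \<and> coord G (\<gamma> t) \<in> cball e0 r"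
    if op: "one_param_subgroup G X \<gamma>" for \<gamma>
  proof -
    have g: "\<forall>\<^sub>F t in nhds 0. \<gamma> t \<in> U" and l: "limitin (gtop G) \<gamma> \<one> (nhds 0)"
      using one_param_has_cder[OF op] has_cder_lim by (auto simp: has_cder_def)
    have "\<forall>\<^sub>F t in nhds 0. coord G (\<gamma> t) \<in> ball e0 r"
      using topological_tendstoD[OF lim_coord(2)[OF l] open_ball] r by auto
    with g have "\<forall>\<^sub>F t in nhds 0. \<gamma> t \<in> U \<and> coord G (\<gamma> t) \<in> cball e0 r"
      by eventually_elim auto
    then obtain d where "d > 0" "\<And>t. dist t 0 < d \<Longrightarrow> \<gamma> t \<in> U \<and> coord G (\<gamma> t) \<in> cball e0 r"
      unfolding eventually_nhds_metric by blast
    then show ?thesis by (intro exI[of _ "d/2"]) (auto simp: dist_norm)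
  qed
  obtain t1 where t1: "t1 > 0" "\<And>t. \<bar>t\<bar> \<le> t1 \<Longrightarrow> \<gamma>1 t \<in> U \<and> coord G (\<gamma>1 t) \<in> cball e0 r"
    using small[OF 1] by blast
  obtain t2 where t2: "t2 > 0" "\<And>t. \<bar>t\<bar> \<le> t2 \<Longrightarrow> \<gamma>2 t \<in> U \<and> coord G (\<gamma>2 t) \<in> cball e0 r"
    using small[OF 2] by blast
  \<comment> \<open>The first two bounds keep both rescaled curves in the chart ball on all of
    [-1, 1]; the third gives \<open>L * norm (\<tau> *\<^sub>R X) \<le> 1/2\<close>, the added 1
    covering \<open>X = 0\<close>.\<close>
  define m where "m = min (min t1 t2) (1 / (2 * L * (norm X + 1)))"
  have m0: "m > 0" using t1 t2 L by (simp add: m_def add_nonneg_pos)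
  obtain n :: nat where n: "n > 0" "1 / n < m"
    using m0 by (metis ex_inverse_of_nat_less inverse_eq_divide)
  define \<tau> :: real where "\<tau> = 1 / n"
  have \<tau>: "0 < \<tau>" "\<tau> \<le> t1" "\<tau> \<le> t2" "\<tau> \<le> 1 / (2 * L * (norm X + 1))"
    using n by (auto simp: \<tau>_def m_def)
  have "L * norm (\<tau> *\<^sub>R X) = L * \<tau> * norm X" using \<tau> by simp
  also have "\<dots> \<le> L * (1 / (2 * L * (norm X + 1))) * norm X"
    using \<tau> L by (intro mult_right_mono mult_left_mono) auto
  also have "\<dots> = norm X / (norm X + 1) / 2" using L by simp
  also have "\<dots> \<le> 1/2" by (simp add: divide_le_eq_1 add_nonneg_pos)
  finally have LX: "L * norm (\<tau> *\<^sub>R X) \<le> 1/2" .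
  have ode: "((\<lambda>t. coord G (\<gamma> (\<tau> * t))) has_vector_derivative F (coord G (\<gamma> (\<tau> * t))) (\<tau> *\<^sub>R X))
      (at t within {-1..1})" if "one_param_subgroup G X \<gamma>" "\<gamma> (\<tau> * t) \<in> U" for \<gamma> t
    using one_param_ode[OF one_param_scale[OF that(1), of \<tau>] that(2)]
    by (rule has_vector_derivative_at_within)
  have b: "\<bar>\<tau> * t\<bar> \<le> t1 \<and> \<bar>\<tau> * t\<bar> \<le> t2" if "t \<in> {-1..1}" for t
  proof -
    have "\<bar>\<tau> * t\<bar> = \<tau> * \<bar>t\<bar>" using \<tau> by (simp add: abs_mult)
    also have "\<dots> \<le> \<tau> * 1" using that \<tau> by (intro mult_left_mono) auto
    finally show ?thesis using \<tau> by auto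
  qed
  have "coord G (\<gamma>1 (\<tau> * 1)) = coord G (\<gamma>2 (\<tau> * 1))"
    by (rule ode_unique[where J = "{-1..1}" and X = "\<tau> *\<^sub>R X"])
      (use ode[OF 1] ode[OF 2] t1(2) t2(2) b LX one_param_0[OF 1] one_param_0[OF 2] in auto)
  then have eq: "\<gamma>1 \<tau> = \<gamma>2 \<tau>"
    using t1(2)[of \<tau>] t2(2)[of \<tau>] \<tau> by (metis abs_of_pos coord_simps(1) mult.right_neutral)
  have pow: "\<gamma> (k * \<tau>) = \<gamma> \<tau> [^] (k::nat)" if op: "one_param_subgroup G X \<gamma>" for \<gamma> k
  proof (induction k)
    case 0 then show ?case using one_param_0[OF op] by simp
  next
    case (Suc k)
    have "\<gamma> (Suc k * \<tau>) = \<gamma> (k * \<tau>) \<otimes> \<gamma> \<tau>"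
      using op[unfolded one_param_subgroup_def, THEN conjunct2, THEN conjunct1, rule_format, of "k * \<tau>" \<tau>]
      by (simp add: distrib_right add.commute)
    then show ?case using Suc by simp
  qed
  have "n * \<tau> = 1" using n by (simp add: \<tau>_def)
  then show ?thesis using pow[OF 1, of n] pow[OF 2, of n] eq by simp
qed

lemma lim_compose:
  assumes f: "limitin (gtop G) f l (nhds a)" and h: "(h \<longlongrightarrow> a) \<F>"
  shows "limitin (gtop G) (\<lambda>x. f (h x)) l \<F>"
  unfolding limitin_def
proof (intro conjI allI impI)
  show "l \<in> topspace (gtop G)" using f by (rule limitin_topspace)
  fix V assume "openin (gtop G) V \<and> l \<in> V"
  then have "\<forall>\<^sub>F y in nhds a. f y \<in> V" using limitinD[OF f] by simp
  from eventually_compose_filterlim[OF this h] show "\<forall>\<^sub>F x in \<F>. f (h x) \<in> V" .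
qed

lemma openin_translate:
  assumes c: "c \<in> carrier G" "d \<in> carrier G" and V: "openin (gtop G) V"
  shows "openin (gtop G) {x \<in> carrier G. c \<otimes> x \<otimes> d \<in> V}"
proof -
  have "continuous_map (gtop G) (gtop G) (\<lambda>x. c \<otimes> x \<otimes> d)"
    unfolding continuous_map_atin
  proof
    fix x assume "x \<in> topspace (gtop G)"
    then have "limitin (gtop G) id x (atin (gtop G) x)"
      by (intro limitin_continuous_map) auto
    then show "limitin (gtop G) (\<lambda>x. c \<otimes> x \<otimes> d) (c \<otimes> x \<otimes> d) (atin (gtop G) x)"
      using c by (intro lim_mult lim_const) (simp_all add: id_def)
  qed
  from openin_continuous_map_preimage[OF this V] show ?thesis by (simp add: topspace_gtop)
qed

lemma continuous_map_of_lim: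
  assumes "open S" "\<And>x. x \<in> S \<Longrightarrow> limitin (gtop G) f (f x) (nhds x)"
  shows "continuous_map (top_of_set S) (gtop G) f"
proof (unfold continuous_map_def, intro conjI ballI allI impI)
  show "f \<in> topspace (top_of_set S) \<rightarrow> topspace (gtop G)"
    using assms(2) by (auto intro: limitin_topspace)
  fix V assume V: "openin (gtop G) V"
  have "open {x \<in> S. f x \<in> V}"
  proof (subst open_subopen, safe)
    fix x assume x: "x \<in> S" "f x \<in> V"
    have "\<forall>\<^sub>F y in nhds x. y \<in> S \<and> f y \<in> V"
      using eventually_nhds_in_open[OF assms(1) x(1)] limitinD[OF assms(2)[OF x(1)] V x(2)]
      by eventually_elim simp
    then show "\<exists>T. open T \<and> x \<in> T \<and> T \<subseteq> {x \<in> S. f x \<in> V}"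
      unfolding eventually_nhds by blast
  qed
  then show "openin (top_of_set S) {x \<in> topspace (top_of_set S). f x \<in> V}"
    by (auto simp: openin_open_eq assms(1))
qed

text \<open>The extension uses integer powers of \<open>v 1\<close>. A carry in the addition of
  fractional parts produces one more factor \<open>v 1\<close>, and \<open>v 1\<close> commutes with
  \<open>v a\<close> because 1 splits as \<open>a + (1 - a)\<close> in either order.\<close>

lemma extend_local_hom:
  fixes v :: "real \<Rightarrow> 'a"
  assumes hom: "\<And>s t. s \<in> {-1..1} \<Longrightarrow> t \<in> {-1..1} \<Longrightarrow> s + t \<in> {-1..1} \<Longrightarrow> v (s + t) = v s \<otimes> v t"
    and lim: "limitin (gtop G) v \<one> (nhds 0)" and car: "\<And>t. t \<in> {-1..1} \<Longrightarrow> v t \<in> carrier G"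
  obtains \<gamma> where "\<And>s t. \<gamma> (s + t) = \<gamma> s \<otimes> \<gamma> t" "continuous_map euclideanreal (gtop G) \<gamma>"
    "\<And>t. \<bar>t\<bar> < 1 \<Longrightarrow> \<gamma> t = v t" "\<gamma> 1 = v 1"
proof -
  define \<gamma> where "\<gamma> t = v 1 [^] \<lfloor>t\<rfloor> \<otimes> v (frac t)" for t
  have v1: "v 1 \<in> carrier G" and v0: "v 0 = \<one>"
  proof -
    show "v 1 \<in> carrier G" by (intro car) auto
    have "v 0 \<otimes> v 0 = v 0" using hom[of 0 0] by simp
    then show "v 0 = \<one>" using car[of 0] by (simp add: l_cancel_one)
  qed
  have fr: "v (frac t) \<in> carrier G" for t
  proof (rule car)
    show "frac t \<in> {-1..1}"
      using frac_ge_0[of t] frac_lt_1[of t] unfolding atLeastAtMost_iff by linarith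
  qed
  have comm: "v 1 \<otimes> v (frac t) = v (frac t) \<otimes> v 1" for t
  proof -
    let ?a = "frac t"
    have a: "?a \<in> {-1..1}" "1 - ?a \<in> {-1..1}" using frac_ge_0[of t] frac_lt_1[of t] unfolding atLeastAtMost_iff by linarith+
    have "v 1 = v ?a \<otimes> v (1 - ?a)" "v 1 = v (1 - ?a) \<otimes> v ?a"
      using hom[OF a] hom[OF a(2,1)] by simp_all
    then show ?thesis using car[OF a(1)] car[OF a(2)] by (metis m_assoc)
  qed
  have add: "\<gamma> (s + t) = \<gamma> s \<otimes> \<gamma> t" for s t
  proof -
    let ?a = "frac s" and ?b = "frac t" and ?m = "\<lfloor>s\<rfloor>" and ?n = "\<lfloor>t\<rfloor>"
    have a: "0 \<le> ?a" "?a < 1" "0 \<le> ?b" "?b < 1" by (simp_all add: frac_lt_1)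
    have I: "?a \<in> {-1..1}" "?b \<in> {-1..1}" "1 - ?a \<in> {-1..1}" "?a + ?b - 1 \<in> {-1..1}"
      using a unfolding atLeastAtMost_iff by linarith+
    have "\<gamma> s \<otimes> \<gamma> t = v 1 [^] ?m \<otimes> (v ?a \<otimes> v 1 [^] ?n) \<otimes> v ?b"
      using v1 fr by (simp add: \<gamma>_def m_assoc)
    also have "v ?a \<otimes> v 1 [^] ?n = v 1 [^] ?n \<otimes> v ?a"
      using int_pow_commute[OF v1 fr comm] by simp
    finally have e: "\<gamma> s \<otimes> \<gamma> t = v 1 [^] (?m + ?n) \<otimes> (v ?a \<otimes> v ?b)"
      using v1 fr by (simp add: m_assoc int_pow_mult)
    show ?thesis
    proof (cases "?a + ?b < 1")
      case True
      then have "?a + ?b \<in> {-1..1}" using a unfolding atLeastAtMost_iff by linarith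
      then have "v ?a \<otimes> v ?b = v (?a + ?b)" using I by (intro hom[symmetric])
      then show ?thesis using True e by (simp add: \<gamma>_def floor_add frac_add)
    next
      case False
      \<comment> \<open>The sum \<open>?a + ?b\<close> may leave [-1, 1], so \<open>?b\<close> is
        split at \<open>1 - ?a\<close>, which completes \<open>?a\<close> to 1.\<close>
      have "v ?a \<otimes> v ?b = v ?a \<otimes> (v (1 - ?a) \<otimes> v (?a + ?b - 1))"
        using hom[OF I(3,4)] I(2) by simp
      also have "\<dots> = v 1 \<otimes> v (?a + ?b - 1)"
        using hom[OF I(1,3)] I car by (simp add: m_assoc)
      finally have "\<gamma> s \<otimes> \<gamma> t = v 1 [^] (?m + ?n + 1) \<otimes> v (?a + ?b - 1)"
        using e v1 car[OF I(4)] by (simp add: int_pow_mult m_assoc)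
      then show ?thesis using False by (simp add: \<gamma>_def floor_add frac_add)
    qed
  qed
  have small: "\<gamma> t = v t" if "\<bar>t\<bar> < 1" for t
  proof (cases "t \<ge> 0")
    case True
    then have "\<lfloor>t\<rfloor> = 0" "frac t = t" using that by (auto simp: frac_def floor_eq_iff)
    moreover have "v t \<in> carrier G" using that by (intro car) auto
    ultimately show ?thesis using v1 by (simp add: \<gamma>_def)
  next
    case False
    \<comment> \<open>For negative \<open>t\<close> the definition passes through
      \<open>v (1 + t)\<close>, and the extra factor \<open>v 1\<close> cancels against the power
      -1.\<close>
    then have f: "\<lfloor>t\<rfloor> = -1" using that by (auto simp: floor_eq_iff)
    then have "frac t = 1 + t" by (simp add: frac_def)
    moreover have "v (1 + t) = v 1 \<otimes> v t" using False that by (intro hom) auto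
    moreover have "v t \<in> carrier G" using that by (intro car) auto
    ultimately show ?thesis
      using f v1 by (simp add: \<gamma>_def int_pow_neg m_assoc[symmetric])
  qed
  have g1: "\<gamma> 1 = v 1" using v1 v0 by (simp add: \<gamma>_def)
  have cg: "\<gamma> t \<in> carrier G" for t using v1 fr by (simp add: \<gamma>_def)
  have "limitin (gtop G) \<gamma> (\<gamma> t) (nhds t)" for t
  proof -
    have ev: "\<forall>\<^sub>F s in nhds 0. v s = \<gamma> s"
      using eventually_nhds_in_open[of "ball 0 1" "0::real"] small by (auto elim!: eventually_mono)
    have "limitin (gtop G) \<gamma> \<one> (nhds 0)"
      by (rule limitin_transform_eventually[OF ev lim])
    moreover have "((\<lambda>s. s - t) \<longlongrightarrow> t - t) (nhds t)"
      by (intro tendsto_intros filterlim_ident)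
    ultimately have "limitin (gtop G) (\<lambda>s. \<gamma> (s - t)) \<one> (nhds t)"
      using lim_compose[of \<gamma> \<one> 0 "\<lambda>s. s - t"] by simp
    from lim_mult[OF lim_const[OF cg] this]
    have "limitin (gtop G) (\<lambda>s. \<gamma> t \<otimes> \<gamma> (s - t)) (\<gamma> t) (nhds t)" using cg by simp
    moreover have "(\<lambda>s. \<gamma> t \<otimes> \<gamma> (s - t)) = \<gamma>"
    proof
      show "\<gamma> t \<otimes> \<gamma> (s - t) = \<gamma> s" for s
        unfolding add[symmetric] by simp
    qed
    ultimately show ?thesis by simp
  qed
  then have "continuous_map euclideanreal (gtop G) \<gamma>"
    using continuous_map_of_lim[of UNIV \<gamma>] by simp
  with that add small g1 show thesis by blast
qed

text \<open>Solutions will live in the small ball and their left translates in the large one, where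
  uniqueness is applied. \<open>L\<close> and \<open>C\<close> are shared, so that one smallness
  condition on \<open>X\<close> serves both.\<close>

lemma ex_Picard_mult:
  "\<exists>r r' L C. Picard F e0 r L C \<and> Picard F e0 r' L C \<and> cball e0 r' \<subseteq> cball e0 r \<and> cball e0 r \<subseteq> D \<and>
    (\<forall>p\<in>cball e0 r'. \<forall>q\<in>cball e0 r'. (p, q) \<in> O\<mu> \<and> \<mu> (p, q) \<in> cball e0 r)"
proof -
  obtain r L C where P: "Picard F e0 r L C" and rD: "cball e0 r \<subseteq> D" using ex_Picard by blast
  interpret Picard F e0 r L C by (rule P)
  have O: "(e0, e0) \<in> O\<mu>" using O\<mu>_e0(1)[of e0] by simp
  have "(\<mu> \<longlongrightarrow> \<mu> (e0, e0)) (nhds (e0, e0))"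
    using has_derivative_continuous[OF \<mu>_deriv[OF O]] by (simp add: isCont_def tendsto_at_iff_tendsto_nhds)
  then have "\<forall>\<^sub>F x in nhds (e0, e0). \<mu> x \<in> ball e0 r"
    by (rule topological_tendstoD) (use r \<mu>_e0(1)[of e0] in auto)
  with eventually_nhds_in_open[OF open_O\<mu> O] have "\<forall>\<^sub>F x in nhds (e0, e0). x \<in> O\<mu> \<and> \<mu> x \<in> ball e0 r"
    by eventually_elim simp
  then obtain d where d: "d > 0" "\<And>x. dist x (e0, e0) < d \<Longrightarrow> x \<in> O\<mu> \<and> \<mu> x \<in> ball e0 r"
    unfolding eventually_nhds_metric by blast
  define r' where "r' = min r (d / 3)"
  have r': "r' > 0" "r' \<le> r" "r' \<le> d / 3" using r d by (auto simp: r'_def)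
  have "(p, q) \<in> O\<mu> \<and> \<mu> (p, q) \<in> cball e0 r" if "p \<in> cball e0 r'" "q \<in> cball e0 r'" for p q
  proof -
    have "dist (p, q) (e0, e0) \<le> dist p e0 + dist q e0"
      by (simp add: dist_Pair_Pair sqrt_sum_squares_le_sum)
    also have "\<dots> < d" using that r' d by (simp add: dist_commute)
    finally show ?thesis using d(2) by fastforce
  qed
  moreover have "Picard F e0 r' L C"
    using r' L C lin bd lip by (intro Picard.intro) auto
  moreover have "cball e0 r' \<subseteq> cball e0 r" using r' by auto
  ultimately show ?thesis using P rD by blast
qed

text \<open>For fixed \<open>s\<close>, both \<open>\<mu> (?u X s, ?u X t)\<close> and
  \<open>?u X (s + t)\<close> solve the equation in \<open>t\<close>; by uniqueness the solution is
  a local homomorphism, and it extends to a one-parameter subgroup. The map \<open>u\<close> of the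
  statement records the value at time 1, for the regularity of the exponential map.\<close>

lemma local_one_param:
  "\<exists>\<delta>>0. \<exists>u. (\<forall>X. norm X \<le> \<delta> \<longrightarrow> (\<exists>\<gamma>. one_param_subgroup G X \<gamma> \<and> \<gamma> 1 = coord_inv G (u X))) \<and>
    u ` cball 0 \<delta> \<subseteq> D \<and> continuous_on (cball 0 \<delta>) u \<and> (u has_derivative (\<lambda>X. X)) (at 0) \<and> u 0 = e0"
proof -
  obtain r r' L C where P: "Picard F e0 r L C" and Q: "Picard F e0 r' L C"
    and sub: "cball e0 r' \<subseteq> cball e0 r" "cball e0 r \<subseteq> D"
    and mul: "\<And>p q. p \<in> cball e0 r' \<Longrightarrow> q \<in> cball e0 r' \<Longrightarrow> (p, q) \<in> O\<mu> \<and> \<mu> (p, q) \<in> cball e0 r"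
    using ex_Picard_mult by blast
  interpret P: Picard F e0 r L C by (rule P)
  interpret Q: Picard F e0 r' L C by (rule Q)
  let ?u = "\<lambda>X t. apply_bcontfun (Q.sol X) t"
  have uD: "?u X t \<in> D" if "norm X \<le> Q.\<delta>" "t \<in> {-1..1}" for X t
    using Q.sol_in[OF that] sub by blast
  have "\<exists>\<gamma>. one_param_subgroup G X \<gamma> \<and> \<gamma> 1 = coord_inv G (?u X 1)" if X: "norm X \<le> Q.\<delta>" for X
  proof -
    let ?v = "\<lambda>t. coord_inv G (?u X t)"
    have hom: "?v (s + t) = ?v s \<otimes> ?v t"
      if s: "s \<in> {-1..1}" and t: "t \<in> {-1..1}" and st: "s + t \<in> {-1..1}" for s t
    proof -
      \<comment> \<open>The times \<open>\<tau>\<close> for which \<open>\<tau>\<close> and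
        \<open>s + \<tau>\<close> both lie in [-1, 1].\<close>
      define J where "J = {max (-1) (-1 - s)..min 1 (1 - s)}"
      have J: "\<tau> \<in> {-1..1}" "s + \<tau> \<in> {-1..1}" if "\<tau> \<in> J" for \<tau> using that by (auto simp: J_def)
      have "\<mu> (?u X s, ?u X t) = ?u X (s + t)"
      proof (rule P.ode_unique[where J = J and X = X and t = t and
            v = "\<lambda>t. \<mu> (?u X s, ?u X t)" and w = "\<lambda>t. ?u X (s + t)"])
        fix \<tau> assume \<tau>: "\<tau> \<in> J"
        note m = mul[OF Q.sol_in[OF X s] Q.sol_in[OF X J(1)[OF \<tau>]]]
        have "((\<lambda>t. (?u X s, ?u X t)) has_derivative (\<lambda>h. (0, h *\<^sub>R F (?u X \<tau>) X))) (at \<tau> within J)"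
          using Q.sol_deriv[OF X J(1)[OF \<tau>]] J(1)
          by (intro has_derivative_Pair has_derivative_const)
            (auto simp: has_vector_derivative_def intro: has_derivative_subset)
        from has_derivative_compose[OF this \<mu>_deriv] m
        have "((\<lambda>t. \<mu> (?u X s, ?u X t)) has_derivative (\<lambda>h. D\<mu> (?u X s, ?u X \<tau>) (0, h *\<^sub>R F (?u X \<tau>) X)))
            (at \<tau> within J)" by blast
        moreover have "D\<mu> (?u X s, ?u X \<tau>) (0, h *\<^sub>R F (?u X \<tau>) X) = h *\<^sub>R F (\<mu> (?u X s, ?u X \<tau>)) X" for h
          using linear_scale[OF linear_D\<mu>, of _ h "(0, F (?u X \<tau>) X)"] m by (simp add: F_assoc)
        ultimately show "((\<lambda>t. \<mu> (?u X s, ?u X t)) has_vector_derivative F (\<mu> (?u X s, ?u X \<tau>)) X) (at \<tau> within J)"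
          by (simp add: has_vector_derivative_def)
        show "\<mu> (?u X s, ?u X \<tau>) \<in> cball e0 r" using m by simp
        show "?u X (s + \<tau>) \<in> cball e0 r" using Q.sol_in[OF X J(2)[OF \<tau>]] sub by blast
        have "(\<lambda>t. s + t) ` J \<subseteq> {-1..1}" using J by auto
        then have "(?u X has_derivative (\<lambda>h. h *\<^sub>R F (?u X (s + \<tau>)) X)) (at (s + \<tau>) within (\<lambda>t. s + t) ` J)"
          using Q.sol_deriv[OF X J(2)[OF \<tau>]] by (auto simp: has_vector_derivative_def intro: has_derivative_subset)
        moreover have "((\<lambda>t. s + t) has_derivative (\<lambda>h. h)) (at \<tau> within J)"
          by (auto intro!: derivative_eq_intros)
        ultimately show "((\<lambda>t. ?u X (s + t)) has_vector_derivative F (?u X (s + \<tau>)) X) (at \<tau> within J)"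
          unfolding has_vector_derivative_def using has_derivative_in_compose by blast
      next
        show "convex J" by (simp add: J_def)
        show "0 \<in> J" "J \<subseteq> {-1..1}" "t \<in> J" using s t st by (auto simp: J_def)
        show "L * norm X \<le> 1/2" using Q.\<delta>D[OF X] by simp
        show "\<mu> (?u X s, ?u X 0) = ?u X (s + 0)"
          using \<mu>_e0(1)[OF uD[OF X s]] Q.sol_0[OF X] by simp
      qed
      moreover have "coord_inv G (?u X s) \<otimes> coord_inv G (?u X t) \<in> U"
        using mul[OF Q.sol_in[OF X s] Q.sol_in[OF X t]] by (simp add: O\<mu>_def)
      ultimately show ?thesis
        by (metis (no_types, lifting) \<mu>_def coord_simps(1) case_prod_conv)
    qed
    have c: "((\<lambda>t. ?u X t) \<longlongrightarrow> e0) (nhds 0)"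
      using continuous_on_apply_bcontfun[of UNIV "Q.sol X"] Q.sol_0[OF X]
      by (metis UNIV_I continuous_on_eq_continuous_at isCont_def open_UNIV tendsto_at_iff_tendsto_nhds)
    have lim: "limitin (gtop G) ?v \<one> (nhds 0)"
      using lim_coord_inv[OF c] by simp
    obtain \<gamma> where g: "\<And>s t. \<gamma> (s + t) = \<gamma> s \<otimes> \<gamma> t" "continuous_map euclideanreal (gtop G) \<gamma>"
      "\<And>t. \<bar>t\<bar> < 1 \<Longrightarrow> \<gamma> t = ?v t" "\<gamma> 1 = ?v 1"
    proof (rule extend_local_hom[of ?v])
      show "?v (s + t) = ?v s \<otimes> ?v t" if "s \<in> {-1..1}" "t \<in> {-1..1}" "s + t \<in> {-1..1}" for s t
        using hom that .
      show "?v t \<in> carrier G" if "t \<in> {-1..1}" for t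
        using uD[OF X that] by simp
    qed (use lim in auto)
    have "(?u X has_vector_derivative X) (at 0 within {-1<..<1})"
      using has_vector_derivative_within_subset[OF Q.sol_deriv[OF X, of 0], of "{-1<..<1}"]
      by (simp add: Q.sol_0[OF X] F_e0 greaterThanLessThan_subseteq_atLeastAtMost_iff)
    then have "(?u X has_derivative (\<lambda>h. h *\<^sub>R X)) (at 0)"
      by (simp add: has_vector_derivative_def at_within_open[of 0 "{-1<..<1::real}"])
    then have "((\<lambda>t. coord G (\<gamma> t)) has_derivative (\<lambda>h. h *\<^sub>R X)) (at 0)"
      by (rule has_derivative_transform_within_open[of _ _ _ _ "{-1<..<1}"])
        (use g(3) uD[OF X] in auto)
    then have "one_param_subgroup G X \<gamma>"
      using g by (simp add: one_param_subgroup_def has_vector_derivative_def)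
    with g(4) show ?thesis by blast
  qed
  moreover have "(\<lambda>X. ?u X 1) ` cball 0 Q.\<delta> \<subseteq> D" using uD[of _ 1] by auto
  moreover have "?u 0 1 = e0" using Q.sol_bound[of 0 1] Q.\<delta>_pos by simp
  ultimately show ?thesis
    using Q.\<delta>_pos Q.continuous_sol Q.sol_deriv_0[OF F_e0]
    by (intro exI[of _ Q.\<delta>] conjI exI[of _ "\<lambda>X. ?u X 1"]) auto
qed

lemma ex_one_param: "\<exists>\<gamma>. one_param_subgroup G X \<gamma>"
proof -
  obtain \<delta> u where d: "\<delta> > 0" and u: "\<And>X. norm X \<le> \<delta> \<Longrightarrow> (\<exists>\<gamma>. one_param_subgroup G X \<gamma> \<and> \<gamma> 1 = coord_inv G (u X))"
    using local_one_param by blast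
  define c where "c = \<delta> / (norm X + 1)"
  have c: "c > 0" using d by (simp add: c_def add_nonneg_pos)
  have "norm (c *\<^sub>R X) = \<delta> * (norm X / (norm X + 1))" using c d by (simp add: c_def)
  also have "\<dots> \<le> \<delta> * 1" using d by (intro mult_left_mono) (auto simp: divide_le_eq_1 add_nonneg_pos)
  finally have "norm (c *\<^sub>R X) \<le> \<delta>" by simp
  then obtain \<gamma> where "one_param_subgroup G (c *\<^sub>R X) \<gamma>" using u by blast
  from one_param_scale[OF this, of "1/c"] c show ?thesis by auto
qed

section \<open>The exponential map\<close>

lemma lie_exp_eq:
  assumes "one_param_subgroup G X \<gamma>"
  shows "lie_exp G X = \<gamma> 1"
  unfolding lie_exp_def using assms one_param_unique by (intro the_equality) auto

lemma one_param_lie_exp: "one_param_subgroup G X (\<lambda>t. lie_exp G (t *\<^sub>R X))"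
proof -
  obtain \<gamma> where g: "one_param_subgroup G X \<gamma>" using ex_one_param by blast
  have "lie_exp G (t *\<^sub>R X) = \<gamma> t" for t
    using lie_exp_eq[OF one_param_scale[OF g, of t]] by simp
  then show ?thesis using g by simp
qed

lemma lie_exp_closed [simp]: "lie_exp G X \<in> carrier G"
  using one_param_carrier[OF one_param_lie_exp[of X], of 1] by simp

lemma lie_exp_0 [simp]: "lie_exp G 0 = \<one>"
  using one_param_0[OF one_param_lie_exp[of 0]] by simp

lemma lie_exp_add_scale: "lie_exp G ((s + t) *\<^sub>R X) = lie_exp G (s *\<^sub>R X) \<otimes> lie_exp G (t *\<^sub>R X)"
  using one_param_lie_exp[of X] unfolding one_param_subgroup_def by blast

lemma lie_exp_minus: "lie_exp G (- X) = inv (lie_exp G X)"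
proof -
  have "lie_exp G (-X) \<otimes> lie_exp G X = \<one>"
    using lie_exp_add_scale[of "-1" 1 X] by simp
  then show ?thesis by (intro inv_equality[symmetric]) auto
qed

lemma lie_exp_unique:
  assumes "\<And>t. lie_exp G (t *\<^sub>R X) = lie_exp G (t *\<^sub>R Y)"
  shows "X = Y"
proof -
  have "(\<lambda>t. lie_exp G (t *\<^sub>R X)) = (\<lambda>t. lie_exp G (t *\<^sub>R Y))"
    using assms by (rule ext)
  then have "(\<lambda>h. h *\<^sub>R X) = (\<lambda>h. h *\<^sub>R Y)"
    using has_cder_unique one_param_has_cder[OF one_param_lie_exp[of X]] one_param_has_cder[OF one_param_lie_exp[of Y]]
    by simp
  from fun_cong[OF this, of 1] show ?thesis by simp
qed

text \<open>Regularity in the vector argument is inherited from the solutions for small parameters: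
  continuity near 0, differentiability at 0 itself. Limits are brought to 0 before the exponential
  is applied.\<close>

lemma lie_exp_local:
  obtains \<delta> where "\<delta> > 0" "\<And>X. norm X < \<delta> \<Longrightarrow> limitin (gtop G) (lie_exp G) (lie_exp G X) (nhds X)"
    "has_cder (lie_exp G) (\<lambda>v. v) 0"
proof -
  obtain \<delta> u where d: "\<delta> > 0" and u: "\<And>X. norm X \<le> \<delta> \<Longrightarrow> (\<exists>\<gamma>. one_param_subgroup G X \<gamma> \<and> \<gamma> 1 = coord_inv G (u X))"
    and uD: "u ` cball 0 \<delta> \<subseteq> D" and c: "continuous_on (cball 0 \<delta>) u" and der: "(u has_derivative (\<lambda>X. X)) (at 0)"
    and u0: "u 0 = e0"
    using local_one_param by blast
  have e: "lie_exp G X = coord_inv G (u X)" if "norm X \<le> \<delta>" for X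
    using u[OF that] lie_exp_eq by auto
  have ev: "\<forall>\<^sub>F Y in nhds X. coord_inv G (u Y) = lie_exp G Y" if "norm X < \<delta>" for X
    using eventually_nhds_in_open[of "ball 0 \<delta>" X] that e by (auto elim!: eventually_mono)
  have lim: "limitin (gtop G) (lie_exp G) (lie_exp G X) (nhds X)" if X: "norm X < \<delta>" for X
  proof -
    have "isCont u X"
      using continuous_on_subset[OF c ball_subset_cball] X
      by (simp add: continuous_on_eq_continuous_at)
    then have "(u \<longlongrightarrow> u X) (nhds X)" by (simp add: isCont_def tendsto_at_iff_tendsto_nhds)
    from lim_coord_inv[OF this] have "limitin (gtop G) (\<lambda>Y. coord_inv G (u Y)) (lie_exp G X) (nhds X)"
      using subsetD[OF uD, of "u X"] X e[of X] by simp
    then show ?thesis by (rule limitin_transform_eventually[OF ev[OF X]])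
  qed
  have "has_cder (lie_exp G) (\<lambda>v. v) 0"
  proof (rule has_cderI)
    show "((\<lambda>y. coord G (lie_exp G y)) has_derivative (\<lambda>v. v)) (at 0)"
      by (rule has_derivative_transform_within_open[OF der, of "ball 0 \<delta>"]) (use d e subsetD[OF uD] in auto)
  qed (use lim[of 0] d in auto)
  with that d lim show thesis by blast
qed

end

section \<open>The adjoint representation\<close>

context lie_group
begin

lemma conj_lie_exp:
  assumes g: "g \<in> carrier G"
  shows "g \<otimes> lie_exp G X \<otimes> inv g = lie_exp G (Ad G g X)"
proof -
  let ?\<gamma> = "\<lambda>t. g \<otimes> lie_exp G (t *\<^sub>R X) \<otimes> inv g"
  note op = one_param_lie_exp[of X]
  have "limitin (gtop G) ?\<gamma> (?\<gamma> t) (nhds t)" for t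
    using g by (intro lim_mult lim_const one_param_lim[OF op]) auto
  then have "continuous_map euclideanreal (gtop G) ?\<gamma>"
    using continuous_map_of_lim[of UNIV ?\<gamma>] by simp
  moreover have "?\<gamma> (s + t) = ?\<gamma> s \<otimes> ?\<gamma> t" for s t
    using g by (simp add: lie_exp_add_scale m_assoc)
  moreover have "((\<lambda>t. coord G (?\<gamma> t)) has_vector_derivative Ad G g X) (at 0)"
    using has_cder_conj[OF g one_param_has_cder[OF op]] linear_scale[OF linear_Ad[OF g]]
    by (simp add: has_cder_def has_vector_derivative_def)
  ultimately have "one_param_subgroup G (Ad G g X) ?\<gamma>"
    unfolding one_param_subgroup_def by blast
  from lie_exp_eq[OF this] show ?thesis by simp
qed

lemma Ad_eqI:
  assumes "g \<in> carrier G" "\<And>t. g \<otimes> lie_exp G (t *\<^sub>R X) \<otimes> inv g = lie_exp G (t *\<^sub>R Y)"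
  shows "Ad G g X = Y"
  using assms conj_lie_exp[OF assms(1)] linear_scale[OF linear_Ad[OF assms(1)]]
  by (intro lie_exp_unique) metis

lemma Ad_inv_left: "g \<in> carrier G \<Longrightarrow> Ad G (inv g) (Ad G g X) = X"
  and Ad_inv_right: "g \<in> carrier G \<Longrightarrow> Ad G g (Ad G (inv g) X) = X"
  using Ad_mult[of "inv g" g X] Ad_mult[of g "inv g" X] Ad_one by simp_all

text \<open>\<open>bracket\<close> is a chosen derivative, so \<open>Ad\<close> must be shown
  differentiable at the identity. The chart formula
  \<open>Ad G (coord_inv G p) v = D\<mu> (p, i p) (F p v, 0)\<close>, with \<open>i\<close> the
  inversion, reduces this to the smoothness of \<open>\<mu>\<close> and of \<open>i\<close>.\<close>

lemma bracket_deriv: "((\<lambda>p. Ad G (coord_inv G p) Y) has_derivative (\<lambda>X. bracket G X Y)) (at e0)"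
proof -
  define i where "i p = coord G (inv (coord_inv G p))" for p
  have "\<forall>\<^sub>F p in nhds e0. inv (coord_inv G p) \<in> U"
    using lim_coord(1)[OF lim_inv[OF has_cder_lim[OF has_cder_coord_inv]]] by simp
  with eventually_nhds_in_open[OF open_D coord_simps(6)]
  have ev: "\<forall>\<^sub>F p in nhds e0. p \<in> D \<and> inv (coord_inv G p) \<in> U"
    by eventually_elim simp
  have "i differentiable (at e0)"
    using inv_smooth[OF one_chart(1) one_chart(1)]
    unfolding smooth_on_def i_def by (auto dest!: spec[of _ "Suc 0"])
  then have pi: "(\<lambda>p. (p, i p)) differentiable (at e0)"
    unfolding differentiable_def by (elim exE) (rule exI, rule has_derivative_Pair[OF has_derivative_ident])
  have ie0: "i e0 = e0" by (simp add: i_def)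
  have formula: "Ad G (coord_inv G p) v = D\<mu> (p, i p) (F p v, 0)"
    if p: "p \<in> D" "inv (coord_inv G p) \<in> U" for p v
  proof -
    have O: "(p, i p) \<in> O\<mu>" using p by (simp add: O\<mu>_def i_def)
    have "((\<lambda>h. (\<mu> (p, h), i p)) has_derivative (\<lambda>v. (F p v, 0))) (at e0)"
      using F_deriv[OF p(1)] by (intro has_derivative_Pair has_derivative_const)
    from has_derivative_compose[OF this, of \<mu> "D\<mu> (p, i p)"] \<mu>_deriv[OF O]
    have 1: "((\<lambda>h. \<mu> (\<mu> (p, h), i p)) has_derivative (\<lambda>v. D\<mu> (p, i p) (F p v, 0))) (at e0)"
      by (simp add: \<mu>_e0(1)[OF p(1)])
    define S where "S = {h. (p, h) \<in> O\<mu>}"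
    have S: "open S" "e0 \<in> S"
      using open_vimage[OF open_O\<mu>, of "Pair p"] O\<mu>_e0(1)[OF p(1)]
      by (simp_all add: S_def vimage_def continuous_on_Pair)
    have "((\<lambda>h. coord G (coord_inv G p \<otimes> coord_inv G h \<otimes> inv (coord_inv G p)))
        has_derivative (\<lambda>v. D\<mu> (p, i p) (F p v, 0))) (at e0)"
    proof (rule has_derivative_transform_within_open[OF 1 S])
      fix h assume "h \<in> S"
      then have "h \<in> D" "coord_inv G p \<otimes> coord_inv G h \<in> U" by (auto simp: S_def O\<mu>_def)
      then show "\<mu> (\<mu> (p, h), i p) = coord G (coord_inv G p \<otimes> coord_inv G h \<otimes> inv (coord_inv G p))"
        using p by (simp add: \<mu>_def i_def)
    qed
    with Ad_deriv[of "coord_inv G p"] p show ?thesis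
      using has_derivative_unique by (metis coord_simps(4))
  qed
  have d1: "(\<lambda>p. D\<mu> (p, i p) (b, 0)) differentiable (at e0)" for b
    by (rule differentiable_compose[where f = "\<lambda>x. D\<mu> x (b, 0)", OF _ pi]) (auto simp: ie0 intro!: D\<mu>_diff O\<mu>_e0)
  have "(\<lambda>p. (p, e0)) differentiable (at e0)"
    unfolding differentiable_def by (rule exI, rule has_derivative_Pair[OF has_derivative_ident has_derivative_const])
  then have d2: "(\<lambda>p. F p Y) differentiable (at e0)"
    unfolding F_def by (rule differentiable_compose[where f = "\<lambda>x. D\<mu> x (0, Y)", rotated]) (auto intro!: D\<mu>_diff O\<mu>_e0)
  \<comment> \<open>\<open>D\<mu> x w\<close> is known to be differentiable in \<open>x\<close> for
    a fixed vector \<open>w\<close>, whereas \<open>F p Y\<close> varies with \<open>p\<close>;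
    hence the expansion over the basis.\<close>
  have "(\<lambda>p. \<Sum>b\<in>Basis. (F p Y \<bullet> b) *\<^sub>R D\<mu> (p, i p) (b, 0)) differentiable (at e0)"
  proof (intro differentiable_sum ballI)
    fix b :: 'e
    have "(\<lambda>p. F p Y \<bullet> b) differentiable (at e0)"
      using d2 unfolding differentiable_def by (elim exE) (rule exI, rule has_derivative_inner_left)
    then show "(\<lambda>p. (F p Y \<bullet> b) *\<^sub>R D\<mu> (p, i p) (b, 0)) differentiable (at e0)"
      using d1[of b] by (rule differentiable_scaleR)
  qed simp
  moreover have "\<forall>\<^sub>F p in nhds e0. (\<Sum>b\<in>Basis. (F p Y \<bullet> b) *\<^sub>R D\<mu> (p, i p) (b, 0)) = Ad G (coord_inv G p) Y"
    using ev
  proof eventually_elim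
    case (elim p)
    then have "(p, i p) \<in> O\<mu>" by (simp add: O\<mu>_def i_def)
    then interpret linear "D\<mu> (p, i p)" by (rule linear_D\<mu>)
    have "(F p Y, 0) = (\<Sum>b\<in>Basis. (F p Y \<bullet> b) *\<^sub>R (b, 0::'e))"
      by (simp add: sum_prod euclidean_representation scaleR_prod_def)
    then have "D\<mu> (p, i p) (F p Y, 0) = (\<Sum>b\<in>Basis. (F p Y \<bullet> b) *\<^sub>R D\<mu> (p, i p) (b, 0))"
      by (metis (no_types, lifting) scale sum sum.cong)
    then show ?case using formula elim by simp
  qed
  ultimately have "(\<lambda>p. Ad G (coord_inv G p) Y) differentiable (at e0)"
    unfolding differentiable_def eventually_nhds
    using has_derivative_transform_within_open by (metis (no_types, lifting))
  then show ?thesis by (simp add: bracket_def frechet_derivative_works)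
qed

lemma linear_bracket_left: "linear (\<lambda>X. bracket G X Y)"
  using bracket_deriv has_derivative_linear by blast

lemma linear_bracket_right: "linear (bracket G X)"
proof (rule linearI)
  have near: "\<And>p. p \<in> D \<Longrightarrow> linear (Ad G (coord_inv G p))" by (simp add: linear_Ad)
  fix Y Z c
  have "((\<lambda>p. Ad G (coord_inv G p) (Y + Z)) has_derivative (\<lambda>X. bracket G X Y + bracket G X Z)) (at e0)"
    by (rule has_derivative_transform_within_open[OF has_derivative_add[OF bracket_deriv[of Y] bracket_deriv[of Z]] open_D])
      (use near in \<open>auto simp: linear_add\<close>)
  then show "bracket G X (Y + Z) = bracket G X Y + bracket G X Z"
    using has_derivative_unique[OF bracket_deriv[of "Y + Z"]] by metis
  have "((\<lambda>p. Ad G (coord_inv G p) (c *\<^sub>R Y)) has_derivative (\<lambda>X. c *\<^sub>R bracket G X Y)) (at e0)"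
    by (rule has_derivative_transform_within_open[OF has_derivative_scaleR_right[OF bracket_deriv[of Y]] open_D])
      (use near in \<open>auto simp: linear_scale\<close>)
  then show "bracket G X (c *\<^sub>R Y) = c *\<^sub>R bracket G X Y"
    using has_derivative_unique[OF bracket_deriv[of "c *\<^sub>R Y"]] by metis
qed

lemma bracket_bilinear: "bounded_bilinear (bracket G)"
  using linear_bracket_left linear_bracket_right
  by (simp add: bilinear_conv_bounded_bilinear[symmetric] bilinear_def)

lemmas bracket_simps [simp] =
  bounded_bilinear.add_left[OF bracket_bilinear] bounded_bilinear.add_right[OF bracket_bilinear]
  bounded_bilinear.diff_left[OF bracket_bilinear] bounded_bilinear.diff_right[OF bracket_bilinear]
  bounded_bilinear.minus_left[OF bracket_bilinear] bounded_bilinear.minus_right[OF bracket_bilinear]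
  bounded_bilinear.scaleR_left[OF bracket_bilinear] bounded_bilinear.scaleR_right[OF bracket_bilinear]
  bounded_bilinear.zero_left[OF bracket_bilinear] bounded_bilinear.zero_right[OF bracket_bilinear]

lemma Ad_curve_deriv:
  assumes "has_cder c (\<lambda>h. h *\<^sub>R X) (0::real)"
  shows "((\<lambda>t. Ad G (c t) Y) has_vector_derivative bracket G X Y) (at 0)"
proof -
  have c: "c 0 = \<one>" "\<forall>\<^sub>F t in nhds 0. c t \<in> U" "((\<lambda>t. coord G (c t)) has_derivative (\<lambda>h. h *\<^sub>R X)) (at 0)"
    using assms by (auto simp: has_cder_def)
  from has_derivative_compose[OF c(3), of "\<lambda>p. Ad G (coord_inv G p) Y" "\<lambda>X. bracket G X Y"] bracket_deriv[of Y] c(1)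
  have "((\<lambda>t. Ad G (coord_inv G (coord G (c t))) Y) has_derivative (\<lambda>h. bracket G (h *\<^sub>R X) Y)) (at 0)"
    by simp
  moreover have "\<forall>\<^sub>F t in at 0. Ad G (coord_inv G (coord G (c t))) Y = Ad G (c t) Y"
    using c(2) by (auto simp: eventually_at_filter elim: eventually_mono)
  ultimately have "((\<lambda>t. Ad G (c t) Y) has_derivative (\<lambda>h. bracket G (h *\<^sub>R X) Y)) (at 0)"
    by (rule has_derivative_transform_eventually) (auto simp: c(1))
  then show ?thesis by (simp add: has_vector_derivative_def)
qed

lemma Ad_exp_deriv_0: "((\<lambda>t. Ad G (lie_exp G (t *\<^sub>R X)) Y) has_vector_derivative bracket G X Y) (at 0)"
  by (intro Ad_curve_deriv one_param_has_cder one_param_lie_exp)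

lemma Ad_exp_deriv:
  "((\<lambda>t. Ad G (lie_exp G (t *\<^sub>R X)) Y) has_vector_derivative Ad G (lie_exp G (t *\<^sub>R X)) (bracket G X Y)) (at t)"
proof -
  let ?A = "Ad G (lie_exp G (t *\<^sub>R X))"
  have "bounded_linear ?A" using linear_Ad linear_conv_bounded_linear lie_exp_closed by blast
  from bounded_linear.has_vector_derivative[OF this Ad_exp_deriv_0]
  have "((\<lambda>h. ?A (Ad G (lie_exp G (h *\<^sub>R X)) Y)) has_vector_derivative ?A (bracket G X Y)) (at (t - t))" by simp
  then have "((\<lambda>h. Ad G (lie_exp G ((t + h) *\<^sub>R X)) Y) has_derivative (\<lambda>h. h *\<^sub>R ?A (bracket G X Y))) (at (t - t))"
    by (simp only: lie_exp_add_scale Ad_mult lie_exp_closed has_vector_derivative_def)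
  moreover have "((\<lambda>s. s - t) has_derivative (\<lambda>h. h)) (at t)"
    by (auto intro!: derivative_eq_intros)
  ultimately have "((\<lambda>s. Ad G (lie_exp G ((t + (s - t)) *\<^sub>R X)) Y) has_derivative (\<lambda>h. h *\<^sub>R ?A (bracket G X Y))) (at t)"
    using has_derivative_compose[of "\<lambda>s. s - t"] by blast
  then show ?thesis by (simp add: has_vector_derivative_def)
qed

text \<open>Both sides are the derivative at \<open>t = 0\<close> of
  \<open>Ad G g (Ad G (lie_exp G (t *\<^sub>R X)) Y)\<close>, rewritten once through the conjugated
  one-parameter subgroup.\<close>

lemma Ad_bracket:
  assumes g: "g \<in> carrier G"
  shows "Ad G g (bracket G X Y) = bracket G (Ad G g X) (Ad G g Y)"
proof -
  have "bounded_linear (Ad G g)" using linear_Ad[OF g] linear_conv_bounded_linear by blast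
  from bounded_linear.has_vector_derivative[OF this Ad_exp_deriv_0]
  have 1: "((\<lambda>t. Ad G g (Ad G (lie_exp G (t *\<^sub>R X)) Y)) has_vector_derivative Ad G g (bracket G X Y)) (at 0)" .
  have 2: "((\<lambda>t. Ad G (lie_exp G (t *\<^sub>R Ad G g X)) (Ad G g Y)) has_vector_derivative
      bracket G (Ad G g X) (Ad G g Y)) (at 0)" by (rule Ad_exp_deriv_0)
  have "Ad G (lie_exp G (t *\<^sub>R Ad G g X)) (Ad G g Y) = Ad G g (Ad G (lie_exp G (t *\<^sub>R X)) Y)" for t
  proof -
    have "lie_exp G (t *\<^sub>R Ad G g X) = g \<otimes> lie_exp G (t *\<^sub>R X) \<otimes> inv g"
      using conj_lie_exp[OF g, of "t *\<^sub>R X"] linear_scale[OF linear_Ad[OF g], of t X] by simp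
    then show ?thesis using g by (simp add: Ad_mult Ad_inv_left)
  qed
  then show ?thesis using vector_derivative_unique_at[OF 1] 2 by simp
qed

text \<open>The product rule, applied to \<open>Ad_bracket\<close> along the curve
  \<open>lie_exp G (t *\<^sub>R Z)\<close>.\<close>

lemma bracket_Jacobi: "bracket G Z (bracket G X Y) = bracket G (bracket G Z X) Y + bracket G X (bracket G Z Y)"
proof -
  let ?A = "\<lambda>t. Ad G (lie_exp G (t *\<^sub>R Z))"
  have 1: "((\<lambda>t. ?A t (bracket G X Y)) has_vector_derivative bracket G Z (bracket G X Y)) (at 0)"
    by (rule Ad_exp_deriv_0)
  have "((\<lambda>t. bracket G (?A t X) (?A t Y)) has_vector_derivative
      bracket G (?A 0 X) (bracket G Z Y) + bracket G (bracket G Z X) (?A 0 Y)) (at 0)"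
    by (intro bounded_bilinear.has_vector_derivative[OF bracket_bilinear] Ad_exp_deriv_0)
  then have "((\<lambda>t. ?A t (bracket G X Y)) has_vector_derivative
      bracket G X (bracket G Z Y) + bracket G (bracket G Z X) Y) (at 0)"
    by (simp only: Ad_bracket lie_exp_closed scaleR_zero_left lie_exp_0 Ad_one)
  from trans[OF vector_derivative_unique_at[OF 1 this] add.commute] show ?thesis .
qed

lemma Ad_exp_self: "Ad G (lie_exp G (t *\<^sub>R X)) X = X"
proof (rule Ad_eqI)
  fix s
  have "lie_exp G (t *\<^sub>R X) \<otimes> lie_exp G (s *\<^sub>R X) = lie_exp G (s *\<^sub>R X) \<otimes> lie_exp G (t *\<^sub>R X)"
    by (metis lie_exp_add_scale add.commute)
  then show "lie_exp G (t *\<^sub>R X) \<otimes> lie_exp G (s *\<^sub>R X) \<otimes> inv lie_exp G (t *\<^sub>R X) = lie_exp G (s *\<^sub>R X)"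
    by (simp add: m_assoc)
qed simp

lemma bracket_self [simp]: "bracket G X X = 0"
proof -
  have "((\<lambda>t. X) has_vector_derivative bracket G X X) (at (0::real))"
    using Ad_exp_deriv_0[of X X] by (simp add: Ad_exp_self)
  then show ?thesis using vector_derivative_unique_at has_vector_derivative_const by blast
qed

lemma bracket_zeroI:
  assumes "\<And>t. Ad G (lie_exp G (t *\<^sub>R X)) Y = Y"
  shows "bracket G X Y = 0"
proof -
  have "((\<lambda>t. Y) has_vector_derivative bracket G X Y) (at (0::real))"
    using Ad_exp_deriv_0[of X Y] assms by simp
  then show ?thesis using vector_derivative_unique_at has_vector_derivative_const by blast
qed

lemma bracket_antisym: "bracket G X Y = - bracket G Y X"
proof -
  have "0 = bracket G (X + Y) (X + Y)" by simp
  also have "\<dots> = bracket G X Y + bracket G Y X"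
    by (simp only: bracket_simps) simp
  finally show ?thesis by (simp add: eq_neg_iff_add_eq_0)
qed

text \<open>The identity \<open>Ad (exp X) = exp (ad X)\<close> on an eigenvector:
  \<open>exp (- c * t) *\<^sub>R Ad G (lie_exp G (t *\<^sub>R X)) Y\<close> has zero
  derivative.\<close>

lemma Ad_exp_eigen:
  assumes "bracket G X Y = c *\<^sub>R Y"
  shows "Ad G (lie_exp G (t *\<^sub>R X)) Y = exp (c * t) *\<^sub>R Y"
proof -
  let ?f = "\<lambda>t. exp (- c * t) *\<^sub>R Ad G (lie_exp G (t *\<^sub>R X)) Y"
  have "(?f has_vector_derivative 0) (at s)" for s
  proof -
    have "((\<lambda>t. exp (- c * t)) has_real_derivative exp (- c * s) * (- c)) (at s)"
      by (auto intro!: derivative_eq_intros)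
    from has_vector_derivative_scaleR[OF this Ad_exp_deriv[of X Y s]]
    have "(?f has_vector_derivative exp (- c * s) *\<^sub>R Ad G (lie_exp G (s *\<^sub>R X)) (bracket G X Y) +
        (exp (- c * s) * (- c)) *\<^sub>R Ad G (lie_exp G (s *\<^sub>R X)) Y) (at s)" .
    then show ?thesis by (simp add: assms linear_scale[OF linear_Ad[OF lie_exp_closed]])
  qed
  then obtain k where k: "\<And>s. ?f s = k"
    using has_vector_derivative_zero_constant[of UNIV ?f] by auto
  have "?f t = Y" using k[of t] k[of 0] by (simp add: Ad_one)
  then have "exp (c * t) *\<^sub>R Y = exp (c * t) *\<^sub>R ?f t" by simp
  then show ?thesis by (simp add: exp_minus)
qed

lemma lie_exp_commute:
  assumes "bracket G X Y = 0"
  shows "lie_exp G X \<otimes> lie_exp G Y = lie_exp G Y \<otimes> lie_exp G X"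
proof -
  have "Ad G (lie_exp G X) Y = Y" using Ad_exp_eigen[of X Y 0 1] assms by simp
  then have "lie_exp G X \<otimes> lie_exp G Y \<otimes> inv lie_exp G X = lie_exp G Y"
    by (simp add: conj_lie_exp)
  then show ?thesis by (simp add: inv_solve_right')
qed

lemma lie_exp_add:
  assumes "bracket G X Y = 0"
  shows "lie_exp G (X + Y) = lie_exp G X \<otimes> lie_exp G Y"
proof -
  let ?\<gamma> = "\<lambda>t. lie_exp G (t *\<^sub>R X) \<otimes> lie_exp G (t *\<^sub>R Y)"
  note opX = one_param_lie_exp[of X] and opY = one_param_lie_exp[of Y]
  have "limitin (gtop G) ?\<gamma> (?\<gamma> t) (nhds t)" for t
    by (intro lim_mult one_param_lim[OF opX] one_param_lim[OF opY])
  then have "continuous_map euclideanreal (gtop G) ?\<gamma>"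
    using continuous_map_of_lim[of UNIV ?\<gamma>] by simp
  moreover have "?\<gamma> (s + t) = ?\<gamma> s \<otimes> ?\<gamma> t" for s t
  proof -
    have "lie_exp G (t *\<^sub>R X) \<otimes> lie_exp G (s *\<^sub>R Y) = lie_exp G (s *\<^sub>R Y) \<otimes> lie_exp G (t *\<^sub>R X)"
      using assms by (intro lie_exp_commute) simp
    then show ?thesis by (simp add: lie_exp_add_scale) (metis (no_types, lifting) lie_exp_closed m_assoc m_closed)
  qed
  moreover have "((\<lambda>t. coord G (?\<gamma> t)) has_vector_derivative X + Y) (at 0)"
    using has_cder_mult[OF one_param_has_cder[OF opX] one_param_has_cder[OF opY]]
    by (simp add: has_cder_def has_vector_derivative_def scaleR_add_right)
  ultimately have "one_param_subgroup G (X + Y) ?\<gamma>"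
    unfolding one_param_subgroup_def by blast
  from lie_exp_eq[OF this] show ?thesis by simp
qed

lemma Ad_fixed:
  assumes "g \<in> carrier G" "\<And>t. g \<otimes> lie_exp G (t *\<^sub>R X) = lie_exp G (t *\<^sub>R X) \<otimes> g"
  shows "Ad G g X = X"
  using assms by (intro Ad_eqI) (simp_all add: m_assoc)

text \<open>\<open>bracket_deriv\<close> gives continuity at \<open>\<one>\<close>; left translation
  by \<open>inv l\<close> moves the limit there.\<close>

lemma lim_Ad:
  assumes "limitin (gtop G) f l \<F>"
  shows "((\<lambda>x. Ad G (f x) Y) \<longlongrightarrow> Ad G l Y) \<F>"
proof -
  have l: "l \<in> carrier G" using lim_carrier[OF assms] .
  let ?h = "\<lambda>x. inv l \<otimes> f x"
  have h: "limitin (gtop G) ?h \<one> \<F>"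
    using lim_mult[OF lim_const[of "inv l"] assms] l by simp
  have "((\<lambda>p. Ad G (coord_inv G p) Y) \<longlongrightarrow> Ad G (coord_inv G e0) Y) (nhds e0)"
    using has_derivative_continuous[OF bracket_deriv[of Y]] unfolding isCont_def
    by (rule tendsto_at_iff_tendsto_nhds[THEN iffD1])
  then have c: "((\<lambda>p. Ad G (coord_inv G p) Y) \<longlongrightarrow> Y) (nhds e0)" by (simp add: Ad_one)
  have "((\<lambda>x. Ad G (coord_inv G (coord G (?h x))) Y) \<longlongrightarrow> Y) \<F>"
    using filterlim_compose[OF c lim_coord(2)[OF h]] by simp
  moreover have "\<forall>\<^sub>F x in \<F>. Ad G (coord_inv G (coord G (?h x))) Y = Ad G (?h x) Y"
    using lim_coord(1)[OF h] by (auto elim: eventually_mono)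
  ultimately have "((\<lambda>x. Ad G (?h x) Y) \<longlongrightarrow> Y) \<F>"
    by (rule Lim_transform_eventually)
  moreover have "(Ad G l \<longlongrightarrow> Ad G l Y) (nhds Y)"
    using linear_continuous_at[of "Ad G l" Y] linear_Ad[OF l]
    by (simp add: linear_conv_bounded_linear isCont_def tendsto_at_iff_tendsto_nhds)
  ultimately have "((\<lambda>x. Ad G l (Ad G (?h x) Y)) \<longlongrightarrow> Ad G l Y) \<F>"
    by (rule filterlim_compose[rotated])
  moreover have "\<forall>\<^sub>F x in \<F>. Ad G l (Ad G (?h x) Y) = Ad G (f x) Y"
  proof -
    have "\<forall>\<^sub>F x in \<F>. f x \<in> carrier G"
      using limitinD[OF assms openin_topspace] l topspace_gtop by simp
    then show ?thesis by eventually_elim (simp add: l Ad_mult Ad_inv_right)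
  qed
  ultimately show ?thesis by (rule Lim_transform_eventually)
qed

end

section \<open>Symmetric operators and the Killing form\<close>

lemma lin_trace_commute:
  fixes f g :: "'e::euclidean_space \<Rightarrow> 'e"
  assumes f: "linear f" and g: "linear g"
  shows "lin_trace (\<lambda>x. f (g x)) = lin_trace (\<lambda>x. g (f x))"
proof -
  have e: "f (g b) \<bullet> b = (\<Sum>c\<in>Basis. (g b \<bullet> c) * (f c \<bullet> b))" if "linear f" for f g :: "'e \<Rightarrow> 'e" and b
  proof -
    interpret linear f by (rule that)
    show ?thesis
      by (subst (1) euclidean_representation[of "g b", symmetric]) (simp add: sum scale inner_sum_left)
  qed
  have "lin_trace (\<lambda>x. f (g x)) = (\<Sum>b\<in>Basis. \<Sum>c\<in>Basis. (g b \<bullet> c) * (f c \<bullet> b))"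
    unfolding lin_trace_def by (simp only: e[OF f])
  also have "\<dots> = (\<Sum>b\<in>Basis. \<Sum>c\<in>Basis. (f b \<bullet> c) * (g c \<bullet> b))"
    by (subst sum.swap) (simp add: mult.commute)
  also have "\<dots> = lin_trace (\<lambda>x. g (f x))"
    unfolding lin_trace_def by (simp only: e[OF g])
  finally show ?thesis .
qed

lemma lin_trace_diff: "lin_trace (\<lambda>x. f x - g x) = lin_trace f - lin_trace g"
  by (simp add: lin_trace_def inner_diff_left sum_subtractf)

section \<open>Simultaneous diagonalization of commuting symmetric operators\<close>

locale inner_form =
  fixes B :: "'e::euclidean_space \<Rightarrow> 'e \<Rightarrow> real"
  assumes bil: "bilinear B" and sym: "B X Y = B Y X" and pos: "X \<noteq> 0 \<Longrightarrow> B X X > 0"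
begin

lemma bounded: "bounded_bilinear B"
  using bil by (simp add: bilinear_conv_bounded_bilinear)

lemmas form_simps =
  bounded_bilinear.add_left[OF bounded] bounded_bilinear.add_right[OF bounded]
  bounded_bilinear.diff_left[OF bounded] bounded_bilinear.diff_right[OF bounded]
  bounded_bilinear.minus_left[OF bounded] bounded_bilinear.minus_right[OF bounded]
  bounded_bilinear.scaleR_left[OF bounded] bounded_bilinear.scaleR_right[OF bounded]
  bounded_bilinear.zero_left[OF bounded] bounded_bilinear.zero_right[OF bounded]

lemma zeroI: "B X X = 0 \<Longrightarrow> X = 0"
  using pos by force

text \<open>An eigenvector is found as a maximizer of the Rayleigh quotient.\<close>

lemma ex_eigenvector:
  assumes T: "linear T" and symT: "\<And>X Y. B (T X) Y = B X (T Y)"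
    and S: "subspace S" "S \<noteq> {0}" "\<And>X. X \<in> S \<Longrightarrow> T X \<in> S"
  obtains X c where "X \<in> S" "X \<noteq> 0" "T X = c *\<^sub>R X"
proof -
  let ?C = "S \<inter> sphere 0 1"
  have cT: "continuous_on UNIV T" using T linear_continuous_on linear_conv_bounded_linear by blast
  have "compact ?C" using S(1) by (intro closed_Int_compact closed_subspace) auto
  moreover have "?C \<noteq> {}"
  proof -
    obtain X where "X \<in> S" "X \<noteq> 0" using S subspace_0 by blast
    then have "(1 / norm X) *\<^sub>R X \<in> ?C" using S(1) by (auto simp: subspace_scale)
    then show ?thesis by blast
  qed
  moreover have "continuous_on ?C (\<lambda>X. B (T X) X / B X X)"
  proof (intro continuous_on_divide bounded_bilinear.continuous_on[OF bounded] continuous_on_id)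
    show "continuous_on ?C T" using cT continuous_on_subset by blast
    show "\<forall>X\<in>?C. B X X \<noteq> 0"
    proof
      fix X assume "X \<in> ?C"
      then have "X \<noteq> 0" by auto
      then show "B X X \<noteq> 0" using pos[of X] by simp
    qed
  qed
  ultimately have "\<exists>X\<in>?C. \<forall>Y\<in>?C. B (T Y) Y / B Y Y \<le> B (T X) X / B X X"
    by (rule continuous_attains_sup)
  then obtain X where X: "X \<in> ?C" and max: "\<And>Y. Y \<in> ?C \<Longrightarrow> B (T Y) Y / B Y Y \<le> B (T X) X / B X X"
    by blast
  define c where "c = B (T X) X / B X X"
  have X0: "X \<in> S" "X \<noteq> 0" using X by auto
  define q where "q Y = B (T Y) Y - c * B Y Y" for Y
  have q: "q Y \<le> 0" if Y: "Y \<in> S" for Y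
  proof (cases "Y = 0")
    case False
    let ?Y = "(1 / norm Y) *\<^sub>R Y"
    have "?Y \<in> ?C" using Y False S(1) by (auto simp: subspace_scale)
    from max[OF this] have "B (T Y) Y / B Y Y \<le> c"
      using False by (simp add: c_def linear_scale[OF T] form_simps)
    then show ?thesis using pos[OF False] by (simp add: q_def divide_le_eq)
  qed (simp add: q_def form_simps)
  have qX: "q X = 0" using pos[OF X0(2)] by (simp add: q_def c_def)
  \<comment> \<open>The residual is the direction in which the quotient would grow: along
    \<open>X + t Y\<close> the function \<open>q\<close> has slope \<open>2 * B Y Y\<close> at
    0.\<close>
  define Y where "Y = T X - c *\<^sub>R X"
  have Y: "Y \<in> S" using S X0 by (simp add: Y_def subspace_diff subspace_scale)
  have "B Y Y = 0"
  proof (rule ccontr)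
    assume "B Y Y \<noteq> 0"
    then have b: "B Y Y > 0" using pos form_simps(9) by metis
    have e: "q (X + t *\<^sub>R Y) = 2 * t * B Y Y + t\<^sup>2 * q Y" for t
    proof -
      have "B Y Y = B (T X) Y - c * B X Y" by (subst (1) Y_def) (simp add: form_simps)
      then have 1: "B (T X) Y = B Y Y + c * B X Y" by simp
      have "B (T Y) X = B (T X) Y" using symT[of Y X] sym by simp
      then show ?thesis using qX 1 sym[of Y X]
        by (simp add: q_def linear_add[OF T] linear_scale[OF T] form_simps power2_eq_square algebra_simps)
    qed
    have le: "2 * t * B Y Y + t\<^sup>2 * q Y \<le> 0" for t
      using q[of "X + t *\<^sub>R Y"] X0 Y S(1) e by (simp add: subspace_add subspace_scale)
    \<comment> \<open>Small enough for the linear term to dominate the quadratic one, which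
      contradicts \<open>q \<le> 0\<close>.\<close>
    define t where "t = B Y Y / (1 + \<bar>q Y\<bar>)"
    have t: "t > 0" using b by (simp add: t_def)
    have "t * (2 * B Y Y + t * q Y) \<le> 0" using le[of t] by (simp add: power2_eq_square algebra_simps)
    then have "2 * B Y Y + t * q Y \<le> 0" using t by (simp add: mult_le_0_iff)
    moreover have "t * \<bar>q Y\<bar> \<le> B Y Y"
      using b by (simp add: t_def divide_le_eq add_pos_nonneg mult_left_mono)
    moreover have "- (t * \<bar>q Y\<bar>) \<le> t * q Y"
      using t by (metis abs_ge_minus_self minus_le_iff mult_left_mono mult_minus_right less_imp_le)
    ultimately show False using b by linarith
  qed
  then have "Y = 0" by (rule zeroI)
  then have "T X = c *\<^sub>R X" by (simp add: Y_def)
  with X0 that show thesis by blast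
qed

text \<open>A nonzero invariant subspace of least dimension works: by commutation, an eigenspace of
  one operator inside it is again invariant, hence all of it. The family may be infinite.\<close>

lemma ex_common_eigenvector:
  assumes T: "\<And>T. T \<in> \<T> \<Longrightarrow> linear T" and symT: "\<And>T X Y. T \<in> \<T> \<Longrightarrow> B (T X) Y = B X (T Y)"
    and comm: "\<And>T T' X. T \<in> \<T> \<Longrightarrow> T' \<in> \<T> \<Longrightarrow> T (T' X) = T' (T X)"
    and S: "subspace S" "S \<noteq> {0}" "\<And>T X. T \<in> \<T> \<Longrightarrow> X \<in> S \<Longrightarrow> T X \<in> S"
  obtains X where "X \<in> S" "X \<noteq> 0" "\<And>T. T \<in> \<T> \<Longrightarrow> \<exists>c. T X = c *\<^sub>R X"
proof -
  define P where "P R \<longleftrightarrow> subspace R \<and> R \<noteq> {0} \<and> R \<subseteq> S \<and> (\<forall>T\<in>\<T>. \<forall>X\<in>R. T X \<in> R)" for R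
  have "P S" using S by (simp add: P_def)
  from ex_has_least_nat[where P = P and m = dim, OF this]
  obtain R where PR: "P R" and min: "\<And>R'. P R' \<Longrightarrow> dim R \<le> dim R'"
    by blast
  note R = PR[unfolded P_def]
  obtain X where X: "X \<in> R" "X \<noteq> 0" using R subspace_0 by blast
  have "\<exists>c. T X = c *\<^sub>R X" if t: "T \<in> \<T>" for T
  proof -
    obtain Y c where Y: "Y \<in> R" "Y \<noteq> 0" "T Y = c *\<^sub>R Y"
      by (rule ex_eigenvector[OF T[OF t] symT[OF t], of R]) (use R t in auto)
    let ?E = "{Z \<in> R. T Z = c *\<^sub>R Z}"
    have sE: "subspace ?E"
      using R T[OF t] by (auto simp: subspace_def linear_0 linear_add linear_scale scaleR_add_right)
    have "P ?E"
      unfolding P_def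
    proof (intro conjI ballI sE)
      show "?E \<noteq> {0}" using Y by blast
      show "?E \<subseteq> S" using R by blast
      fix T' Z assume T': "T' \<in> \<T>" and Z: "Z \<in> ?E"
      then show "T' Z \<in> ?E"
        using R comm[OF t T', of Z] linear_scale[OF T[OF T']] by auto
    qed
    then have "dim R \<le> dim ?E" by (rule min)
    then have "?E = R" using R sE by (intro subspace_dim_equal) auto
    then show ?thesis using X by blast
  qed
  then show thesis using that X R by blast
qed

text \<open>Otherwise the \<open>B\<close>-orthogonal complement of the common eigenvectors is
  nonzero and invariant, so it contains a common eigenvector, which is then orthogonal to
  itself.\<close>

lemma common_eigenvectors_span:
  assumes T: "\<And>T. T \<in> \<T> \<Longrightarrow> linear T" and symT: "\<And>T X Y. T \<in> \<T> \<Longrightarrow> B (T X) Y = B X (T Y)"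
    and comm: "\<And>T T' X. T \<in> \<T> \<Longrightarrow> T' \<in> \<T> \<Longrightarrow> T (T' X) = T' (T X)"
  shows "span {X. \<forall>T\<in>\<T>. \<exists>c. T X = c *\<^sub>R X} = UNIV"
proof (rule ccontr)
  let ?C = "{X. \<forall>T\<in>\<T>. \<exists>c. T X = c *\<^sub>R X}"
  assume "span ?C \<noteq> UNIV"
  then obtain w where w: "w \<noteq> 0" "\<And>x. x \<in> span ?C \<Longrightarrow> w \<bullet> x = 0"
    using span_not_UNIV_orthogonal by blast
  \<comment> \<open>\<open>\<phi>\<close> represents \<open>B\<close> by the Euclidean inner
    product. It is surjective, so the Euclidean normal \<open>w\<close> comes from a
    \<open>B\<close>-normal vector \<open>X\<close>.\<close>
  define \<phi> :: "'e \<Rightarrow> 'e" where "\<phi> X = (\<Sum>b\<in>Basis. B X b *\<^sub>R b)" for X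
  have \<phi>: "\<phi> X \<bullet> v = B X v" for X v
  proof -
    have "B X v = B X (\<Sum>b\<in>Basis. (v \<bullet> b) *\<^sub>R b)" by (simp add: euclidean_representation)
    also have "\<dots> = (\<Sum>b\<in>Basis. (v \<bullet> b) * B X b)"
      by (simp add: bounded_bilinear.sum_right[OF bounded] form_simps)
    finally show ?thesis by (simp add: \<phi>_def inner_sum_left mult.commute inner_commute[of v])
  qed
  have lin: "linear \<phi>"
    by (rule linearI) (simp_all add: \<phi>_def form_simps scaleR_add_left sum.distrib scaleR_sum_right)
  moreover have "inj \<phi>"
    unfolding linear_injective_0[OF lin]
  proof (intro allI impI)
    fix X assume "\<phi> X = 0"
    then show "X = 0" using \<phi>[of X X] by (intro zeroI) simp
  qed
  ultimately have "surj \<phi>" by (rule linear_injective_imp_surjective) simp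
  then obtain X where X: "\<phi> X = w" by (metis surjD)
  define S where "S = {X. \<forall>Y\<in>?C. B X Y = 0}"
  have S1: "subspace S" by (auto simp: S_def subspace_def form_simps)
  have S2: "S \<noteq> {0}"
  proof -
    have "X \<in> S" using w(2) \<phi>[of X] X by (auto simp: S_def intro: span_base)
    moreover have "X \<noteq> 0" using X w(1) linear_0[OF lin] by blast
    ultimately show ?thesis by blast
  qed
  have S3: "T X \<in> S" if T: "T \<in> \<T>" and X: "X \<in> S" for T X
    unfolding S_def
  proof safe
    fix Y assume Y: "\<forall>T\<in>\<T>. \<exists>c. T Y = c *\<^sub>R Y"
    then obtain c where "T Y = c *\<^sub>R Y" using T by blast
    then show "B (T X) Y = 0" using symT[OF T, of X Y] X Y by (simp add: S_def form_simps)
  qed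
  obtain X where "X \<in> S" "X \<noteq> 0" "\<And>T. T \<in> \<T> \<Longrightarrow> \<exists>c. T X = c *\<^sub>R X"
    by (rule ex_common_eigenvector[of \<T> S]) (use T symT comm S1 S2 S3 in blast)+
  then have "B X X = 0" by (simp add: S_def)
  with zeroI \<open>X \<noteq> 0\<close> show False by blast
qed

end

section \<open>Invariance of the Killing form\<close>

context lie_group
begin

lemma linear_ad: "linear (\<lambda>Z. bracket G X (bracket G Y Z))"
  using linear_compose[OF linear_bracket_right linear_bracket_right] by (simp add: o_def)

lemma killing_sym: "killing G X Y = killing G Y X"
  unfolding killing_def by (rule lin_trace_commute[OF linear_bracket_right linear_bracket_right])

lemma bilinear_killing: "bilinear (killing G)"
proof -
  have "linear (killing G X)" for X
    by (rule linearI)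
      (simp_all add: killing_def lin_trace_def sum.distrib inner_add_left sum_distrib_left)
  moreover from this have "linear (\<lambda>X. killing G X Y)" for Y
    by (subst killing_sym)
  ultimately show ?thesis by (simp add: bilinear_def)
qed

text \<open>The Jacobi identity expands both sides into traces of triple products, which cancel by
  cyclicity.\<close>

lemma killing_ad: "killing G (bracket G H X) Y = - killing G X (bracket G H Y)"
proof -
  let ?h = "bracket G H" and ?x = "bracket G X" and ?y = "bracket G Y"
  have b: "bracket G (bracket G H Z) W = ?h (bracket G Z W) - bracket G Z (?h W)" for Z W
    using bracket_Jacobi[of H Z W] by simp
  have 1: "killing G (bracket G H X) Y = lin_trace (\<lambda>Z. ?h (?x (?y Z))) - lin_trace (\<lambda>Z. ?x (?h (?y Z)))"
    by (simp add: killing_def b lin_trace_diff)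
  have 2: "killing G X (bracket G H Y) = lin_trace (\<lambda>Z. ?x (?h (?y Z))) - lin_trace (\<lambda>Z. ?x (?y (?h Z)))"
    by (simp add: killing_def b lin_trace_diff)
  show ?thesis
    using 1 2 lin_trace_commute[OF linear_bracket_right[of H] linear_ad[of X Y]] by simp
qed

text \<open>\<open>\<theta>\<close> is an automorphism, so it conjugates the operators, and
  conjugation preserves traces.\<close>

lemma killing_involution:
  assumes \<theta>: "cartan_involution G \<theta>"
  shows "killing G (\<theta> X) (\<theta> Y) = killing G X Y"
proof -
  have lin: "linear \<theta>" and inv: "\<And>X. \<theta> (\<theta> X) = X" and hom: "\<And>X Y. \<theta> (bracket G X Y) = bracket G (\<theta> X) (\<theta> Y)"
    using \<theta> by (auto simp: cartan_involution_def)
  have "bracket G (\<theta> X) (bracket G (\<theta> Y) Z) = \<theta> (bracket G X (bracket G Y (\<theta> Z)))" for Z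
    by (simp add: hom inv)
  then have "killing G (\<theta> X) (\<theta> Y) = lin_trace (\<lambda>Z. \<theta> (bracket G X (bracket G Y (\<theta> Z))))"
    by (simp add: killing_def)
  also have "\<dots> = lin_trace (\<lambda>Z. bracket G X (bracket G Y (\<theta> (\<theta> Z))))"
    using lin_trace_commute[OF lin linear_compose[OF lin linear_ad[of X Y]]] by (simp add: o_def)
  finally show ?thesis by (simp add: inv killing_def)
qed

end

section \<open>Contracted subgroups and restricted roots\<close>

context lie_group
begin

text \<open>For a regular \<open>H\<^sub>0\<close> in the positive chamber, \<open>horo H\<^sub>0\<close> will be \<open>N\<close>, and \<open>horo (- H\<^sub>0)\<close> its opposite \<open>N\<^sup>-\<close>.\<close>

definition eig :: "'e \<Rightarrow> real \<Rightarrow> 'e set" where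
  "eig H c = {X. bracket G H X = c *\<^sub>R X}"

definition nilp :: "'e \<Rightarrow> 'e set" where
  "nilp H = span (\<Union>c\<in>{0<..}. eig H c)"

text \<open>Contracted directions are defined by a limit, so that membership can be read off from
  limits of group elements, as for \<open>Ad G n H - H\<close> with \<open>n\<close> in
  \<open>horo H\<close>.\<close>

definition contr :: "'e \<Rightarrow> 'e set" where
  "contr H = {X. ((\<lambda>t. Ad G (lie_exp G (- (t *\<^sub>R H))) X) \<longlongrightarrow> 0) at_top}"

definition horo :: "'e \<Rightarrow> 'a set" where
  "horo H = analytic_subgroup G (nilp H)"

lemma bounded_linear_Ad: "g \<in> carrier G \<Longrightarrow> bounded_linear (Ad G g)"
  using linear_Ad linear_conv_bounded_linear by blast

lemma subspace_contr: "subspace (contr H)"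
proof (unfold subspace_def, intro conjI ballI allI)
  note lin = linear_Ad[OF lie_exp_closed]
  show "0 \<in> contr H" by (simp add: contr_def linear_0[OF lin])
  show "X + Y \<in> contr H" if "X \<in> contr H" "Y \<in> contr H" for X Y
    using tendsto_add[of _ 0 at_top _ 0] that by (fastforce simp: contr_def linear_add[OF lin])
  show "c *\<^sub>R X \<in> contr H" if "X \<in> contr H" for c X
    using tendsto_scaleR[OF tendsto_const[of c], of _ 0 at_top] that by (simp add: contr_def linear_scale[OF lin])
qed

lemma eig_contr:
  assumes "X \<in> eig H c" "c > 0"
  shows "X \<in> contr H"
proof -
  have "((\<lambda>t. exp (c * (- t)) *\<^sub>R X) \<longlongrightarrow> 0 *\<^sub>R X) at_top"
  proof (intro tendsto_scaleR tendsto_const)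
    have "filterlim (\<lambda>t. c * t) at_top at_top"
      by (rule filterlim_tendsto_pos_mult_at_top[OF tendsto_const assms(2) filterlim_ident])
    then have "filterlim (\<lambda>t. c * (- t)) at_bot at_top"
      by (simp add: filterlim_uminus_at_bot)
    then show "((\<lambda>t. exp (c * (- t))) \<longlongrightarrow> 0) at_top"
      by (rule filterlim_compose[OF exp_at_bot])
  qed
  moreover have "Ad G (lie_exp G (- (t *\<^sub>R H))) X = exp (c * (- t)) *\<^sub>R X" for t
    using assms(1) Ad_exp_eigen[of H X c "- t"] by (simp add: eig_def)
  ultimately show ?thesis by (simp add: contr_def)
qed

lemma nilp_contr: "nilp H \<subseteq> contr H"
  unfolding nilp_def by (intro span_minimal subspace_contr) (auto intro: eig_contr)

lemma contr_zero:
  assumes "bracket G H X = 0" "X \<in> contr H"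
  shows "X = 0"
proof -
  have "Ad G (lie_exp G (- (t *\<^sub>R H))) X = X" for t
    using Ad_exp_eigen[of H X 0 "- t"] assms(1) by simp
  then have "((\<lambda>t::real. X) \<longlongrightarrow> 0) at_top" using assms(2) unfolding contr_def by simp
  then show ?thesis by (simp add: tendsto_const_iff)
qed

lemma Ad_eig:
  assumes "g \<in> carrier G" "X \<in> eig H c"
  shows "Ad G g X \<in> eig (Ad G g H) c"
  using assms by (simp add: eig_def Ad_bracket[symmetric] linear_scale[OF linear_Ad])

lemma Ad_nilp:
  assumes g: "g \<in> carrier G" and X: "X \<in> nilp H"
  shows "Ad G g X \<in> nilp (Ad G g H)"
  using X unfolding nilp_def
proof (induction rule: span_induct)
  case base
  show "subspace {X. Ad G g X \<in> span (\<Union>c\<in>{0<..}. eig (Ad G g H) c)}"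
    by (auto simp: subspace_def linear_0[OF linear_Ad[OF g]] linear_add[OF linear_Ad[OF g]]
        linear_scale[OF linear_Ad[OF g]] span_zero span_add span_scale)
next
  case (step X)
  then obtain c where c: "c \<in> {0<..}" "X \<in> eig H c" by blast
  show ?case by (rule span_base) (rule UN_I[OF c(1)], rule Ad_eig[OF g c(2)])
qed

lemma lie_exp_image_carrier: "lie_exp G ` S \<subseteq> carrier G"
  by auto

lemma subgroup_horo: "subgroup (horo H) G"
  unfolding horo_def analytic_subgroup_def by (intro generate_is_subgroup lie_exp_image_carrier)

lemma horo_closed: "n \<in> horo H \<Longrightarrow> n \<in> carrier G"
  using subgroup_horo subgroup.mem_carrier by metis

lemma lie_exp_horo: "X \<in> nilp H \<Longrightarrow> lie_exp G X \<in> horo H"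
  unfolding horo_def analytic_subgroup_def by (auto intro: generate.incl)

text \<open>The generators are closed under inversion, since
  \<open>inv (lie_exp G X) = lie_exp G (- X)\<close>; this removes the case for inverses.\<close>

lemma horo_induct [consumes 1, case_names one exp mult]:
  assumes n: "n \<in> horo H" and 1: "P \<one>" and e: "\<And>X. X \<in> nilp H \<Longrightarrow> P (lie_exp G X)"
    and m: "\<And>x y. x \<in> horo H \<Longrightarrow> y \<in> horo H \<Longrightarrow> P x \<Longrightarrow> P y \<Longrightarrow> P (x \<otimes> y)"
  shows "P n"
  using n unfolding horo_def analytic_subgroup_def
proof (induction rule: generate.induct)
  case one then show ?case by (rule 1)
next
  case (incl h) then show ?case using e by auto
next
  case (inv h)
  then obtain X where X: "X \<in> nilp H" "h = lie_exp G X" by auto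
  then have "- X \<in> nilp H" by (simp add: nilp_def span_neg)
  then show ?case using e X by (simp add: lie_exp_minus[symmetric])
next
  case (eng h1 h2) then show ?case using m by (simp add: horo_def analytic_subgroup_def)
qed

lemma conj_horo:
  assumes g: "g \<in> carrier G" and n: "n \<in> horo H"
  shows "g \<otimes> n \<otimes> inv g \<in> horo (Ad G g H)"
  using n
proof (induction rule: horo_induct)
  case one
  then show ?case using g subgroup.one_closed[OF subgroup_horo] by simp
next
  case (exp X)
  then show ?case using g Ad_nilp lie_exp_horo by (simp add: conj_lie_exp)
next
  case (mult x y)
  then show ?case using g horo_closed subgroup.m_closed[OF subgroup_horo] by (simp add: conj_mult)
qed

text \<open>Conjugation by the flow turns \<open>lie_exp G X\<close> into the exponential of a
  vector tending to 0, and limits multiply, so the contraction passes to words in the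
  generators.\<close>

lemma horo_lim:
  assumes "n \<in> horo H"
  shows "limitin (gtop G) (\<lambda>t. lie_exp G (- (t *\<^sub>R H)) \<otimes> n \<otimes> inv (lie_exp G (- (t *\<^sub>R H)))) \<one> at_top"
  using assms
proof (induction rule: horo_induct)
  case one
  show ?case by (simp add: topspace_gtop)
next
  case (exp X)
  obtain \<delta> where "\<delta> > 0" "\<And>X. norm X < \<delta> \<Longrightarrow> limitin (gtop G) (lie_exp G) (lie_exp G X) (nhds X)"
    using lie_exp_local by blast
  then have "limitin (gtop G) (lie_exp G) \<one> (nhds 0)" by (metis lie_exp_0 norm_zero)
  moreover have "((\<lambda>t. Ad G (lie_exp G (- (t *\<^sub>R H))) X) \<longlongrightarrow> 0) at_top"
    using exp nilp_contr by (auto simp: contr_def)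
  ultimately show ?case unfolding conj_lie_exp[OF lie_exp_closed] by (rule lim_compose)
next
  case (mult x y)
  have "limitin (gtop G) (\<lambda>t. (lie_exp G (- (t *\<^sub>R H)) \<otimes> x \<otimes> inv (lie_exp G (- (t *\<^sub>R H)))) \<otimes>
      (lie_exp G (- (t *\<^sub>R H)) \<otimes> y \<otimes> inv (lie_exp G (- (t *\<^sub>R H))))) (\<one> \<otimes> \<one>) at_top"
    using mult by (intro lim_mult)
  then show ?case using mult(1,2) by (simp add: conj_mult horo_closed)
qed

text \<open>An element fixing \<open>H\<close> commutes with the flow of \<open>H\<close>, hence
  equals its own contraction limit \<open>\<one>\<close>.\<close>

lemma horo_fix:
  assumes n: "n \<in> horo H" and fx: "Ad G n H = H"
  shows "n = \<one>"
proof -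
  note c = horo_closed[OF n]
  have "lie_exp G (- (t *\<^sub>R H)) \<otimes> n \<otimes> inv (lie_exp G (- (t *\<^sub>R H))) = n" for t
  proof -
    let ?e = "lie_exp G (- (t *\<^sub>R H))"
    have "n \<otimes> ?e \<otimes> inv n = ?e"
      using fx by (simp only: conj_lie_exp[OF c] linear_neg[OF linear_Ad[OF c]] linear_scale[OF linear_Ad[OF c]])
    then have "?e \<otimes> n = n \<otimes> ?e" using c by (metis inv_solve_right' lie_exp_closed m_closed)
    then show ?thesis using c by (simp add: m_assoc)
  qed
  then have "limitin (gtop G) (\<lambda>t::real. n) \<one> at_top" using horo_lim[OF n] by simp
  from lim_unique[OF lim_const[OF c] this] show ?thesis by simp
qed

text \<open>The flow fixes \<open>H\<close>, so it acts on \<open>Ad G n H - H\<close> by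
  conjugating \<open>n\<close>, and the conjugates of \<open>n\<close> tend to
  \<open>\<one>\<close>.\<close>

lemma Ad_horo:
  assumes n: "n \<in> horo H"
  shows "Ad G n H - H \<in> contr H"
proof -
  note c = horo_closed[OF n]
  let ?e = "\<lambda>t. lie_exp G (- (t *\<^sub>R H))"
  have "Ad G (?e t) (Ad G n H - H) = Ad G (?e t \<otimes> n \<otimes> inv ?e t) H - H" for t
  proof -
    have "Ad G (inv ?e t) H = H"
      using Ad_inv_left[OF lie_exp_closed, of "- (t *\<^sub>R H)" H] Ad_exp_self[of "- t" H] by simp
    then show ?thesis
      using c Ad_exp_self[of "- t" H] by (simp add: Ad_mult linear_diff[OF linear_Ad[OF lie_exp_closed]])
  qed
  moreover have "((\<lambda>t. Ad G (?e t \<otimes> n \<otimes> inv ?e t) H - H) \<longlongrightarrow> Ad G \<one> H - H) at_top"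
    by (intro tendsto_diff tendsto_const lim_Ad horo_lim n)
  ultimately show ?thesis by (simp add: contr_def Ad_one)
qed

lemma Ad_contr:
  assumes g: "g \<in> carrier G" and fx: "Ad G g H = H" and X: "X \<in> contr H"
  shows "Ad G g X \<in> contr H"
proof -
  have "Ad G (lie_exp G (- (t *\<^sub>R H))) (Ad G g X) = Ad G g (Ad G (lie_exp G (- (t *\<^sub>R H))) X)" for t
  proof -
    have "g \<otimes> lie_exp G (- (t *\<^sub>R H)) \<otimes> inv g = lie_exp G (- (t *\<^sub>R H))"
      using fx by (simp only: conj_lie_exp[OF g] linear_neg[OF linear_Ad[OF g]] linear_scale[OF linear_Ad[OF g]])
    then have "lie_exp G (- (t *\<^sub>R H)) \<otimes> g = g \<otimes> lie_exp G (- (t *\<^sub>R H))"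
      using g by (metis inv_solve_right' lie_exp_closed m_closed)
    then show ?thesis using g Ad_mult lie_exp_closed by metis
  qed
  moreover have "((\<lambda>t. Ad G g (Ad G (lie_exp G (- (t *\<^sub>R H))) X)) \<longlongrightarrow> Ad G g 0) at_top"
    using X by (intro bounded_linear.tendsto[OF bounded_linear_Ad[OF g]]) (simp add: contr_def)
  ultimately show ?thesis by (simp add: contr_def linear_0[OF linear_Ad[OF g]])
qed

end

text \<open>The positive chamber enters through one regular vector \<open>H0\<close>, so that
  \<open>N\<close> and its opposite become the groups contracted by a single flow in its two
  directions.\<close>

locale flag_setup = lie_group G for G :: "('a, 'e::euclidean_space) lie_group" (structure) +
  fixes K :: "'a set" and \<theta> :: "'e \<Rightarrow> 'e" and \<a> :: "'e set" and H0 :: 'e and w0 :: 'a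
  assumes K_sub: "subgroup K G" and K_compact: "compactin (gtop G) K"
    and \<theta>: "cartan_involution G \<theta>"
    and lieK: "lie_of G K = {X. \<theta> X = X}"
    and max_ab: "maximal_abelian_in G {X. \<theta> X = - X} \<a>"
    and H0: "H0 \<in> \<a>" and reg: "\<And>\<alpha>. \<alpha> \<in> restricted_roots G \<a> \<Longrightarrow> \<alpha> H0 \<noteq> 0"
    and w0_norm: "w0 \<in> normalizer_in G K (lie_exp G ` \<a>)" and w0_a: "\<And>X. X \<in> \<a> \<Longrightarrow> Ad G w0 X = - X"
begin

lemma linear_\<theta>: "linear \<theta>" and \<theta>_inv [simp]: "\<theta> (\<theta> X) = X"
  and \<theta>_bracket: "\<theta> (bracket G X Y) = bracket G (\<theta> X) (\<theta> Y)"
  and \<theta>_pos: "X \<noteq> 0 \<Longrightarrow> - killing G X (\<theta> X) > 0"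
  using \<theta> by (auto simp: cartan_involution_def)

lemma subspace_a: "subspace \<a>" and bracket_a: "H \<in> \<a> \<Longrightarrow> H' \<in> \<a> \<Longrightarrow> bracket G H H' = 0"
  and \<theta>_a: "H \<in> \<a> \<Longrightarrow> \<theta> H = - H"
  using max_ab by (auto simp: maximal_abelian_in_def abelian_subspace_def)

text \<open>The inner product attached to a Cartan involution; it makes \<open>ad\<close> of
  elements of \<open>\<a>\<close> symmetric.\<close>

definition B :: "'e \<Rightarrow> 'e \<Rightarrow> real" where "B X Y = - killing G X (\<theta> Y)"

sublocale inner_form B
proof
  have "linear (\<lambda>X. killing G X Y)" "linear (killing G X)" for X Y
    using bilinear_killing by (auto simp: bilinear_def)
  then have "linear (\<lambda>X. B X Y)" "linear (B X)" for X Y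
    unfolding B_def using linear_compose[OF linear_\<theta>, of "killing G X"]
    by (auto intro!: linear_compose_neg simp: o_def)
  then show "bilinear B" by (simp add: bilinear_def)
  show "B X Y = B Y X" for X Y
    using killing_involution[OF \<theta>, of X "\<theta> Y"] killing_sym[of "\<theta> X" Y] by (simp add: B_def)
  show "0 < B X X" if "X \<noteq> 0" for X using \<theta>_pos[OF that] by (simp add: B_def)
qed

lemma form_ad:
  assumes "H \<in> \<a>"
  shows "B (bracket G H X) Y = B X (bracket G H Y)"
  using killing_ad[of H X "\<theta> Y"] \<theta>_bracket[of H Y] \<theta>_a[OF assms] 
  by (simp add: B_def bounded_bilinear.minus_right[OF bilinear_killing[unfolded bilinear_conv_bounded_bilinear]])

definition C :: "'e set" where "C = {X. \<forall>H\<in>\<a>. \<exists>c. bracket G H X = c *\<^sub>R X}"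

definition Z :: "'e set" where "Z = {X. \<forall>H\<in>\<a>. bracket G H X = 0}"

lemma subspace_Z: "subspace Z"
  by (auto simp: Z_def subspace_def)

text \<open>The restricted root space decomposition: \<open>ad\<close> of the abelian space
  \<open>\<a>\<close> is a commuting family of \<open>B\<close>-symmetric operators.\<close>

lemma span_C: "span C = UNIV"
proof -
  have "span {X. \<forall>T\<in>bracket G ` \<a>. \<exists>c. T X = c *\<^sub>R X} = UNIV"
  proof (rule common_eigenvectors_span)
    fix T T' X Y assume "T \<in> bracket G ` \<a>"
    then obtain H where H: "H \<in> \<a>" "T = bracket G H" by auto
    show "linear T" using H linear_bracket_right by simp
    show "B (T X) Y = B X (T Y)" using H form_ad by simp
    assume "T' \<in> bracket G ` \<a>"
    then obtain H' where H': "H' \<in> \<a>" "T' = bracket G H'" by auto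
    show "T (T' X) = T' (T X)" using H H' bracket_Jacobi[of H H' X] bracket_a by simp
  qed
  then show ?thesis by (simp add: C_def)
qed

lemma C_eig: "X \<in> C \<Longrightarrow> H \<in> \<a> \<Longrightarrow> \<exists>c. X \<in> eig H c"
  by (auto simp: C_def eig_def)

lemma C_cases:
  assumes X: "X \<in> C"
  obtains "X \<in> Z" | \<alpha> where "\<alpha> \<in> restricted_roots G \<a>" "X \<in> root_space G \<a> \<alpha>"
proof (cases "X \<in> Z")
  case False
  have "\<forall>H\<in>\<a>. \<exists>c. bracket G H X = c *\<^sub>R X" using X by (simp add: C_def)
  then obtain f where f: "\<And>H. H \<in> \<a> \<Longrightarrow> bracket G H X = f H *\<^sub>R X" by metis
  let ?\<alpha> = "restrict f \<a>"
  have r: "X \<in> root_space G \<a> ?\<alpha>" using f by (simp add: root_space_def)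
  have X0: "X \<noteq> 0" using False by (auto simp: Z_def)
  moreover obtain H where "H \<in> \<a>" "bracket G H X \<noteq> 0" using False by (auto simp: Z_def)
  ultimately have "\<exists>H\<in>\<a>. ?\<alpha> H \<noteq> 0" using f by (metis restrict_apply' scaleR_eq_0_iff)
  then have "?\<alpha> \<in> restricted_roots G \<a>" using r X0 by (auto simp: restricted_roots_def)
  with r that(2) show thesis by blast
qed (use that in blast)

lemma eig_orth: "H \<in> \<a> \<Longrightarrow> X \<in> eig H c \<Longrightarrow> Y \<in> eig H d \<Longrightarrow> c \<noteq> d \<Longrightarrow> B X Y = 0"
  using form_ad[of H X Y] by (auto simp: eig_def form_simps)

lemma form_zeroI:
  assumes "\<And>Y. Y \<in> C \<Longrightarrow> B X Y = 0"
  shows "X = 0"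
proof -
  have "B X Y = 0" if "Y \<in> span C" for Y
    using that by (induction rule: span_induct) (auto simp: subspace_def form_simps assms)
  then show ?thesis using span_C zeroI by auto
qed

lemma root_space_eig: "H \<in> \<a> \<Longrightarrow> root_space G \<a> \<alpha> \<subseteq> eig H (\<alpha> H)"
  by (auto simp: root_space_def eig_def)

abbreviation "roots \<equiv> restricted_roots G \<a>"
abbreviation "psum \<equiv> positive_root_sum G \<a> {\<alpha> \<in> roots. \<alpha> H0 > 0}"

lemma psum_nilp: "psum \<subseteq> nilp H0"
  unfolding positive_root_sum_def nilp_def
proof (rule span_mono)
  show "(\<Union>\<alpha>\<in>{\<alpha> \<in> roots. 0 < \<alpha> H0}. root_space G \<a> \<alpha>) \<subseteq> (\<Union>c\<in>{0<..}. eig H0 c)"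
    using root_space_eig[OF H0] by fastforce
qed

lemma eig_minus: "X \<in> eig H c \<Longrightarrow> X \<in> eig (- H) (- c)"
  by (simp add: eig_def)

text \<open>The common eigenvectors span, and regularity of \<open>H0\<close> puts every root vector
  on the positive or the negative side.\<close>

lemma decomp_psum: "\<exists>X1\<in>psum. \<exists>X2\<in>Z. \<exists>X3\<in>nilp (- H0). X = X1 + X2 + X3"
proof -
  let ?S = "{X. \<exists>X1\<in>psum. \<exists>X2\<in>Z. \<exists>X3\<in>nilp (- H0). X = X1 + X2 + X3}"
  have sub: "subspace psum" "subspace (nilp (- H0))"
    by (simp_all add: positive_root_sum_def nilp_def)
  have "?S = {x + y |x y. x \<in> {x + y |x y. x \<in> psum \<and> y \<in> Z} \<and> y \<in> nilp (- H0)}" by blast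
  then have sS: "subspace ?S" using subspace_sums[OF subspace_sums[OF sub(1) subspace_Z] sub(2)] by simp
  note zeros = subspace_0[OF sub(1)] subspace_0[OF sub(2)] subspace_0[OF subspace_Z]
  have "C \<subseteq> ?S"
  proof
    fix X assume "X \<in> C"
    then show "X \<in> ?S"
    proof (cases rule: C_cases)
      case 1
      then show ?thesis using zeros by force
    next
      case (2 \<alpha>)
      show ?thesis
      proof (cases "\<alpha> H0 > 0")
        case True
        then have "X \<in> psum" using 2 unfolding positive_root_sum_def by (intro span_base) auto
        then show ?thesis using zeros by force
      next
        case False
        then have "- \<alpha> H0 > 0" using reg[OF 2(1)] by simp
        moreover have "X \<in> eig (- H0) (- \<alpha> H0)" using root_space_eig[OF H0] 2(2) eig_minus by blast
        ultimately have "X \<in> nilp (- H0)" unfolding nilp_def by (intro span_base) auto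
        then show ?thesis using zeros by force
      qed
    qed
  qed
  then have "span C \<subseteq> ?S" using sS by (rule span_minimal)
  then have "X \<in> ?S" unfolding span_C by (rule subsetD) simp
  then show ?thesis by simp
qed

lemma nilp_orth:
  assumes X: "X \<in> nilp H0" and Y: "Y \<in> Z \<or> Y \<in> nilp (- H0)"
  shows "B X Y = 0"
proof -
  have e: "B X Y = 0" if X: "X \<in> nilp H0" and Y: "Y \<in> eig H0 d" "d \<le> 0" for X Y d
    using X unfolding nilp_def
    by (induction rule: span_induct) (use eig_orth[OF H0] Y in \<open>force simp: subspace_def form_simps\<close>)+
  from Y show ?thesis
  proof
    assume "Y \<in> Z"
    then have "Y \<in> eig H0 0" using H0 by (simp add: Z_def eig_def)
    then show ?thesis using e[OF X] by blast
  next
    assume "Y \<in> nilp (- H0)"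
    then show ?thesis unfolding nilp_def
    proof (induction rule: span_induct)
      case base
      show ?case by (auto simp: subspace_def form_simps)
    next
      case (step Y)
      then obtain c where "c > 0" "Y \<in> eig (- H0) c" by auto
      then show ?case using e[OF X, of Y "- c"] eig_minus[of Y "- H0" c] by simp
    qed
  qed
qed

text \<open>An eigenvector of \<open>ad H0\<close> alone might mix root spaces. The remainder
  \<open>X - X1\<close> left by \<open>decomp_psum\<close> lies in \<open>nilp H0\<close> and equals
  \<open>X2 + X3\<close>, to which it is \<open>B\<close>-orthogonal, so it vanishes. This
  identifies the \<open>N\<close> of the theorem with \<open>horo H0\<close>.\<close>

lemma nilp_eq_psum: "nilp H0 = psum"
proof
  show "nilp H0 \<subseteq> psum"
  proof
    fix X assume X: "X \<in> nilp H0"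
    obtain X1 X2 X3 where d: "X1 \<in> psum" "X2 \<in> Z" "X3 \<in> nilp (- H0)" "X = X1 + X2 + X3"
      using decomp_psum[of X] by blast
    have W: "X - X1 \<in> nilp H0"
      using X d(1) psum_nilp by (auto simp: nilp_def intro: span_diff)
    have "B (X - X1) (X - X1) = B (X - X1) X2 + B (X - X1) X3"
      using d(4) by (simp add: form_simps)
    then have "B (X - X1) (X - X1) = 0" using nilp_orth[OF W] d by simp
    then show "X \<in> psum" using zeroI[of "X - X1"] d(1) by simp
  qed
qed (rule psum_nilp)

lemma decomp: "\<exists>X1\<in>nilp H0. \<exists>X2\<in>Z. \<exists>X3\<in>nilp (- H0). X = X1 + X2 + X3"
  using decomp_psum nilp_eq_psum by simp

text \<open>Pairing with an eigenvector isolates one component of \<open>X\<close>, whose growth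
  under the flow is known exactly.\<close>

lemma form_exp:
  assumes H: "H \<in> \<a>" and Y: "Y \<in> eig H c"
  shows "B (Ad G (lie_exp G (t *\<^sub>R H)) X) Y = exp (c * t) * B X Y"
proof -
  note lin = linear_Ad[OF lie_exp_closed]
  have "X \<in> span C" by (simp add: span_C)
  then show ?thesis
  proof (induction rule: span_induct)
    case base
    show ?case
      by (auto simp: subspace_def form_simps linear_0[OF lin] linear_add[OF lin] linear_scale[OF lin] algebra_simps)
  next
    case (step X)
    then obtain d where d: "X \<in> eig H d" using C_eig H by blast
    then have "Ad G (lie_exp G (t *\<^sub>R H)) X = exp (d * t) *\<^sub>R X" by (intro Ad_exp_eigen) (simp add: eig_def)
    then show ?case using eig_orth[OF H d Y] by (cases "d = c") (auto simp: form_simps)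
  qed
qed

text \<open>A component with eigenvalue \<open>c \<le> 0\<close> does not decay under the flow
  contracting \<open>contr H\<close>, and one with \<open>c \<ge> 0\<close> does not decay under the
  reverse flow; so \<open>X\<close> is orthogonal to all common eigenvectors.\<close>

lemma contr_inter:
  assumes H: "H \<in> \<a>" and X: "X \<in> contr H" "X \<in> contr (- H)"
  shows "X = 0"
proof (rule form_zeroI)
  fix Y assume "Y \<in> C"
  then obtain c where Y: "Y \<in> eig H c" using C_eig H by blast
  have aux: "B X Y = 0" if X: "X \<in> contr H'" and H': "H' \<in> \<a>" and Y: "Y \<in> eig H' c" and c: "c \<le> 0" for H' c
  proof -
    have "((\<lambda>t. B (Ad G (lie_exp G (- (t *\<^sub>R H'))) X) Y) \<longlongrightarrow> B 0 Y) at_top"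
      using X by (intro bounded_bilinear.tendsto[OF bounded] tendsto_const) (simp add: contr_def)
    then have "((\<lambda>t. exp (c * - t) * B X Y) \<longlongrightarrow> 0) at_top"
      using form_exp[OF H' Y, of "- t" X for t] by (simp add: form_simps)
    then have "((\<lambda>t. \<bar>exp (c * - t) * B X Y\<bar>) \<longlongrightarrow> 0) at_top" by (rule tendsto_rabs_zero)
    moreover have "\<forall>\<^sub>F t in at_top. \<bar>B X Y\<bar> \<le> \<bar>exp (c * - t) * B X Y\<bar>"
      using eventually_ge_at_top[of "0::real"]
    proof eventually_elim
      case (elim t)
      then have "1 \<le> exp (c * - t)" using c by (simp add: mult_nonpos_nonneg)
      then have "1 * \<bar>B X Y\<bar> \<le> exp (c * - t) * \<bar>B X Y\<bar>" by (intro mult_right_mono) auto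
      then show ?case by (simp add: abs_mult)
    qed
    ultimately have "\<bar>B X Y\<bar> \<le> 0" by (intro tendsto_lowerbound) auto
    then show ?thesis by simp
  qed
  show "B X Y = 0"
  proof (cases "c \<le> 0")
    case True
    then show ?thesis using aux X(1) H Y by blast
  next
    case False
    then show ?thesis using aux[OF X(2) _ eig_minus[OF Y]] H subspace_a by (simp add: subspace_neg)
  qed
qed

text \<open>\<open>ad H\<close> vanishes on the spanning set \<open>C\<close>, so
  \<open>killing G H H = 0\<close>, and \<open>B\<close> is positive definite.\<close>

lemma form_ad_zero:
  assumes H: "H \<in> \<a>" and "\<And>X c. X \<in> C \<Longrightarrow> X \<noteq> 0 \<Longrightarrow> X \<in> eig H c \<Longrightarrow> c = 0"
  shows "H = 0"
proof -
  have "bracket G H X = 0" for X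
  proof -
    have "X \<in> span C" by (simp add: span_C)
    then show ?thesis
    proof (induction rule: span_induct)
      case base then show ?case by (auto simp: subspace_def)
    next
      case (step X)
      then obtain c where "X \<in> eig H c" using C_eig H by blast
      then show ?case using assms(2)[OF step] by (cases "X = 0") (auto simp: eig_def)
    qed
  qed
  then have "killing G H H = 0" by (simp add: killing_def lin_trace_def)
  then have "B H H = 0"
    using \<theta>_a[OF H] by (simp add: B_def bounded_bilinear.minus_right[OF bilinear_killing[unfolded bilinear_conv_bounded_bilinear]])
  then show ?thesis by (rule zeroI)
qed

text \<open>A nonzero eigenvalue of \<open>ad H\<close> would make \<open>Ad\<close> unbounded along
  the powers of \<open>lie_exp G H\<close> or of its inverse, against the compactness of
  \<open>K\<close>.\<close>

lemma lie_exp_K: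
  assumes H: "H \<in> \<a>" and K: "lie_exp G H \<in> K"
  shows "H = 0"
proof (rule form_ad_zero[OF H], rule ccontr)
  fix X c assume X: "X \<in> C" "X \<noteq> 0" "X \<in> eig H c" and c: "c \<noteq> 0"
  have "continuous_map (gtop G) euclidean (\<lambda>g. Ad G g X)"
    unfolding continuous_map_atin
  proof
    fix g assume "g \<in> topspace (gtop G)"
    then have "limitin (gtop G) id g (atin (gtop G) g)"
      by (intro limitin_continuous_map) auto
    from lim_Ad[OF this] show "limitin euclidean (\<lambda>g. Ad G g X) (Ad G g X) (atin (gtop G) g)" by simp
  qed
  from image_compactin[OF K_compact this] have "bounded ((\<lambda>g. Ad G g X) ` K)"
    by (simp add: compact_imp_bounded)
  then obtain b where b: "\<And>g. g \<in> K \<Longrightarrow> norm (Ad G g X) \<le> b" unfolding bounded_iff by blast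
  have nat: "lie_exp G (real n *\<^sub>R H') \<in> K" if "lie_exp G H' \<in> K" for n H'
  proof (induction n)
    case 0 show ?case using subgroup.one_closed[OF K_sub] by simp
  next
    case (Suc n)
    have "lie_exp G (real (Suc n) *\<^sub>R H') = lie_exp G (real n *\<^sub>R H') \<otimes> lie_exp G H'"
      using lie_exp_add_scale[of "real n" 1 H'] by (simp add: add.commute)
    then show ?case using Suc that subgroup.m_closed[OF K_sub] by simp
  qed
  have contra: False if D: "lie_exp G H' \<in> K" "X \<in> eig H' d" "d > 0" for H' d
  proof -
    have le: "n * (d * norm X) \<le> b" for n :: nat
    proof -
      have "d * n \<le> exp (d * n)" using exp_ge_add_one_self[of "d * n"] by linarith
      then have "d * n * norm X \<le> exp (d * n) * norm X"
        by (rule mult_right_mono) simp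
      moreover have "n * (d * norm X) = d * n * norm X" by simp
      ultimately have "n * (d * norm X) \<le> exp (d * n) * norm X" by (simp only:)
      also have "\<dots> \<le> b"
        using b[OF nat[OF D(1)], of n] Ad_exp_eigen[of H' X d "real n"] D(2) by (simp add: eig_def)
      finally show ?thesis .
    qed
    obtain n :: nat where "n * (d * norm X) > b"
      using reals_Archimedean3[of "d * norm X"] D(3) X(2) by auto
    with le[of n] show False by simp
  qed
  have "lie_exp G (- H) \<in> K" using K subgroup.m_inv_closed[OF K_sub] by (simp add: lie_exp_minus)
  then show False
    using contra[OF K X(3)] contra[OF _ eig_minus[OF X(3)]] c by fastforce
qed

lemma lie_exp_in_K:
  assumes "\<theta> Y = Y"
  shows "lie_exp G Y \<in> K"
proof -
  have "Y \<in> lie_of G K" using assms lieK by simp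
  then have "lie_exp G (1 *\<^sub>R Y) \<in> K" unfolding lie_of_def by blast
  then show ?thesis by simp
qed

text \<open>\<open>Z\<close> is stable under \<open>\<theta>\<close>, so it splits into eigenspaces
  of \<open>\<theta>\<close>. Adjoining the antisymmetric part \<open>H\<close> to
  \<open>\<a>\<close> gives an abelian subspace on which \<open>\<theta>\<close> is still -1, and
  maximality puts \<open>H\<close> into \<open>\<a>\<close>.\<close>

lemma Z_decomp:
  assumes X: "X \<in> Z"
  obtains Y H where "Y \<in> Z" "\<theta> Y = Y" "H \<in> \<a>" "X = Y + H"
proof -
  define Y where "Y = (1/2) *\<^sub>R (X + \<theta> X)"
  define H where "H = (1/2) *\<^sub>R (X - \<theta> X)"
  have tX: "\<theta> X \<in> Z"
  proof -
    have "bracket G H (\<theta> X) = 0" if "H \<in> \<a>" for H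
    proof -
      have "bracket G (\<theta> (- H)) (\<theta> X) = \<theta> (bracket G (- H) X)" by (simp only: \<theta>_bracket)
      then show ?thesis
        using X that by (simp add: Z_def linear_0[OF linear_\<theta>] linear_neg[OF linear_\<theta>] \<theta>_a)
    qed
    then show ?thesis by (simp add: Z_def)
  qed
  have YZ: "Y \<in> Z" and HZ: "H \<in> Z"
    using X tX subspace_Z by (auto simp: Y_def H_def intro!: subspace_scale subspace_add subspace_diff)
  note lin = linear_add[OF linear_\<theta>] linear_diff[OF linear_\<theta>] linear_scale[OF linear_\<theta>]
  have "\<theta> Y = Y" by (simp add: Y_def lin add.commute)
  moreover have "\<theta> H = - H" by (simp add: H_def lin scaleR_diff_right)
  then have "H \<in> \<a>"
  proof -
    let ?b = "span (insert H \<a>)"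
    have rep: "\<exists>k. \<exists>H'\<in>\<a>. Y = k *\<^sub>R H + H'" if Yb: "Y \<in> ?b" for Y
    proof -
      obtain k where "Y - k *\<^sub>R H \<in> span \<a>" using Yb unfolding span_breakdown_eq by blast
      then have "Y - k *\<^sub>R H \<in> \<a>" using subspace_a span_eq_iff by metis
      then show ?thesis by (intro exI[of _ k] bexI[of _ "Y - k *\<^sub>R H"]) auto
    qed
    have HH: "bracket G H' H = 0" "bracket G H H' = 0" if "H' \<in> \<a>" for H'
      using HZ that bracket_antisym[of H H'] by (auto simp: Z_def)
    have "?b \<subseteq> {X. \<theta> X = - X}"
      using rep \<open>\<theta> H = - H\<close> \<theta>_a by (fastforce simp: lin)
    moreover have "abelian_subspace G ?b"
      unfolding abelian_subspace_def
    proof (intro conjI ballI subspace_span)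
      fix X Y assume "X \<in> ?b" "Y \<in> ?b"
      then obtain k H1 l H2 where "H1 \<in> \<a>" "H2 \<in> \<a>" "X = k *\<^sub>R H + H1" "Y = l *\<^sub>R H + H2"
        using rep by metis
      then show "bracket G X Y = 0" using HH bracket_a by simp
    qed
    moreover have "\<a> \<subseteq> ?b" by (auto intro: span_base)
    ultimately have "?b = \<a>" using max_ab unfolding maximal_abelian_in_def by blast
    then show ?thesis by (metis insertI1 span_base)
  qed
  moreover have "X = Y + H" by (simp add: Y_def H_def scaleR_add_right[symmetric] scaleR_2[symmetric])
  ultimately show thesis using that YZ by simp
qed

end

section \<open>The big cell\<close>

context flag_setup
begin

section \<open>The subgroups M, A, L = MA and P\<close>

definition "A = lie_exp G ` \<a>"
definition "M = centralizer_in G K A"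
abbreviation "Np \<equiv> horo H0"
abbreviation "Nm \<equiv> horo (- H0)"
definition "P = M <#> A <#> Np"

lemma A_closed: "a \<in> A \<Longrightarrow> a \<in> carrier G" and M_K: "m \<in> M \<Longrightarrow> m \<in> K"
  by (auto simp: A_def M_def centralizer_in_def)

lemma K_closed: "k \<in> K \<Longrightarrow> k \<in> carrier G"
  using K_sub subgroup.mem_carrier by metis

lemma M_closed: "m \<in> M \<Longrightarrow> m \<in> carrier G"
  using M_K K_closed by blast

lemma N_closed: "n \<in> Np \<Longrightarrow> n \<in> carrier G" "n \<in> Nm \<Longrightarrow> n \<in> carrier G"
  by (blast intro: horo_closed)+

lemma MI: "k \<in> K \<Longrightarrow> (\<And>a. a \<in> A \<Longrightarrow> k \<otimes> a = a \<otimes> k) \<Longrightarrow> k \<in> M"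
  unfolding M_def centralizer_in_def by blast

lemma M_A_commute: "m \<in> M \<Longrightarrow> a \<in> A \<Longrightarrow> m \<otimes> a = a \<otimes> m"
  by (auto simp: M_def centralizer_in_def)

lemma lie_exp_a_add: "H \<in> \<a> \<Longrightarrow> H' \<in> \<a> \<Longrightarrow> lie_exp G (H + H') = lie_exp G H \<otimes> lie_exp G H'"
  using bracket_a by (intro lie_exp_add)

lemma A_mult: "a \<in> A \<Longrightarrow> b \<in> A \<Longrightarrow> a \<otimes> b \<in> A"
  by (auto simp: A_def lie_exp_a_add[symmetric] subspace_add[OF subspace_a])

lemma A_commute: "a \<in> A \<Longrightarrow> b \<in> A \<Longrightarrow> a \<otimes> b = b \<otimes> a"
  by (auto simp: A_def intro!: lie_exp_commute bracket_a)

lemma A_inv: "a \<in> A \<Longrightarrow> inv a \<in> A"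
  by (auto simp: A_def lie_exp_minus[symmetric] subspace_neg[OF subspace_a])

lemma one_A: "\<one> \<in> A"
  unfolding A_def by (rule image_eqI[OF _ subspace_0[OF subspace_a]]) simp

lemma subgroup_M: "subgroup M G"
proof
  show "M \<subseteq> carrier G" using M_closed by blast
  show "\<one> \<in> M" using A_closed subgroup.one_closed[OF K_sub] by (auto simp: M_def centralizer_in_def)
  fix x y assume xy: "x \<in> M" "y \<in> M"
  have "x \<otimes> y \<otimes> a = a \<otimes> (x \<otimes> y)" if "a \<in> A" for a
  proof -
    have "x \<otimes> y \<otimes> a = x \<otimes> (a \<otimes> y)" using xy that by (simp add: M_closed A_closed m_assoc M_A_commute)
    also have "\<dots> = a \<otimes> x \<otimes> y" using xy that by (simp add: M_closed A_closed m_assoc[symmetric] M_A_commute)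
    finally show ?thesis using xy that by (simp add: M_closed A_closed m_assoc)
  qed
  with subgroup.m_closed[OF K_sub M_K[OF xy(1)] M_K[OF xy(2)]] show "x \<otimes> y \<in> M" by (rule MI)
next
  fix x assume x: "x \<in> M"
  have "inv x \<otimes> a = a \<otimes> inv x" if "a \<in> A" for a
  proof -
    have "inv x \<otimes> a = inv x \<otimes> (a \<otimes> x) \<otimes> inv x" using x that by (simp add: M_closed A_closed m_assoc)
    also have "a \<otimes> x = x \<otimes> a" using x that by (simp add: M_A_commute)
    finally show ?thesis using x that by (simp add: M_closed A_closed m_assoc)
  qed
  with subgroup.m_inv_closed[OF K_sub M_K[OF x]] show "inv x \<in> M" by (rule MI)
qed

lemma A_inter_K: "a \<in> A \<Longrightarrow> a \<in> K \<Longrightarrow> a = \<one>"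
  unfolding A_def by (elim imageE) (use lie_exp_K lie_exp_0 in blast)

lemma lie_exp_a_inj:
  assumes "H \<in> \<a>" "H' \<in> \<a>" "lie_exp G H = lie_exp G H'"
  shows "H = H'"
proof -
  have "lie_exp G (H + - H') = lie_exp G H \<otimes> lie_exp G (- H')"
    using assms subspace_neg[OF subspace_a] by (intro lie_exp_a_add)
  also have "\<dots> = \<one>" using assms by (simp add: lie_exp_minus)
  finally have "lie_exp G (H + - H') \<in> K" using subgroup.one_closed[OF K_sub] by simp
  moreover have "H + - H' \<in> \<a>" using assms subspace_neg[OF subspace_a] subspace_add[OF subspace_a] by blast
  ultimately have "H + - H' = 0" by (rule lie_exp_K[rotated])
  then show ?thesis by simp
qed

text \<open>Well defined on \<open>A\<close> because \<open>lie_exp G\<close> is injective on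
  \<open>\<a>\<close>; elsewhere the value is arbitrary.\<close>

definition sqrtA :: "'a \<Rightarrow> 'a" where "sqrtA a = lie_exp G ((1/2) *\<^sub>R (THE H. H \<in> \<a> \<and> lie_exp G H = a))"

lemma sqrtA_exp: "H \<in> \<a> \<Longrightarrow> sqrtA (lie_exp G H) = lie_exp G ((1/2) *\<^sub>R H)"
proof -
  assume H: "H \<in> \<a>"
  then have "(THE H'. H' \<in> \<a> \<and> lie_exp G H' = lie_exp G H) = H"
    using lie_exp_a_inj by (intro the_equality) auto
  then show ?thesis by (simp add: sqrtA_def)
qed

lemma sqrtA_closed: "a \<in> A \<Longrightarrow> sqrtA a \<in> A"
  by (auto simp: A_def sqrtA_exp subspace_scale[OF subspace_a])

lemma sqrtA_mult:
  assumes "a \<in> A" "b \<in> A"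
  shows "sqrtA (a \<otimes> b) = sqrtA a \<otimes> sqrtA b"
proof -
  obtain H H' where H: "H \<in> \<a>" "H' \<in> \<a>" "a = lie_exp G H" "b = lie_exp G H'"
    using assms unfolding A_def by blast
  have "sqrtA (a \<otimes> b) = lie_exp G ((1/2) *\<^sub>R (H + H'))"
    using H sqrtA_exp[of "H + H'"] subspace_add[OF subspace_a] by (simp add: lie_exp_a_add)
  also have "\<dots> = lie_exp G ((1/2) *\<^sub>R H) \<otimes> lie_exp G ((1/2) *\<^sub>R H')"
    using H subspace_scale[OF subspace_a] by (simp only: scaleR_add_right lie_exp_a_add)
  finally show ?thesis using H sqrtA_exp by simp
qed

lemma sqrtA_square: "a \<in> A \<Longrightarrow> sqrtA (a \<otimes> a) = a"
proof -
  assume "a \<in> A"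
  then obtain H where H: "H \<in> \<a>" "a = lie_exp G H" unfolding A_def by blast
  have "sqrtA (a \<otimes> a) = lie_exp G ((1/2) *\<^sub>R (H + H))"
    using H sqrtA_exp[of "H + H"] subspace_add[OF subspace_a] by (simp add: lie_exp_a_add)
  then show ?thesis using H by (simp flip: scaleR_2)
qed

lemma lie_exp_A: "H \<in> \<a> \<Longrightarrow> lie_exp G (t *\<^sub>R H) \<in> A"
  using subspace_scale[OF subspace_a] by (simp add: A_def)

lemma Ad_M: "m \<in> M \<Longrightarrow> H \<in> \<a> \<Longrightarrow> Ad G m H = H"
  by (intro Ad_fixed M_closed M_A_commute lie_exp_A)

lemma Ad_A: "a \<in> A \<Longrightarrow> H \<in> \<a> \<Longrightarrow> Ad G a H = H"
  by (intro Ad_fixed A_closed A_commute lie_exp_A)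

definition L :: "'a set" where "L = {m \<otimes> a |m a. m \<in> M \<and> a \<in> A}"

lemma LI: "m \<in> M \<Longrightarrow> a \<in> A \<Longrightarrow> m \<otimes> a \<in> L"
  unfolding L_def by blast

lemma L_closed: "l \<in> L \<Longrightarrow> l \<in> carrier G"
  using M_closed A_closed by (auto simp: L_def)

lemma L_mult: assumes "l \<in> L" "l' \<in> L" shows "l \<otimes> l' \<in> L"
proof -
  obtain m a m' a' where l: "m \<in> M" "a \<in> A" "l = m \<otimes> a" "m' \<in> M" "a' \<in> A" "l' = m' \<otimes> a'"
    using assms by (auto simp: L_def)
  have "l \<otimes> l' = m \<otimes> (a \<otimes> m') \<otimes> a'" using l M_closed A_closed by (simp add: m_assoc)
  also have "a \<otimes> m' = m' \<otimes> a" using l M_A_commute by simp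
  finally have "l \<otimes> l' = (m \<otimes> m') \<otimes> (a \<otimes> a')" using l M_closed A_closed by (simp add: m_assoc)
  then show ?thesis using l A_mult subgroup.m_closed[OF subgroup_M] unfolding L_def by blast
qed

lemma L_inv: assumes "l \<in> L" shows "inv l \<in> L"
proof -
  obtain m a where l: "m \<in> M" "a \<in> A" "l = m \<otimes> a" using assms by (auto simp: L_def)
  have "inv l = inv m \<otimes> inv a" using l M_closed A_closed by (simp add: M_A_commute inv_mult_group)
  then show ?thesis using l A_inv subgroup.m_inv_closed[OF subgroup_M] unfolding L_def by blast
qed

lemma M_L: "m \<in> M \<Longrightarrow> m \<in> L" and A_L: "a \<in> A \<Longrightarrow> a \<in> L"
proof -
  show "m \<in> L" if "m \<in> M"
    unfolding L_def using that one_A M_closed[OF that] by (intro CollectI exI[of _ m] exI[of _ \<one>]) auto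
  show "a \<in> L" if "a \<in> A"
    unfolding L_def using that subgroup.one_closed[OF subgroup_M] A_closed[OF that]
    by (intro CollectI exI[of _ \<one>] exI[of _ a]) auto
qed

lemma Ad_L: "l \<in> L \<Longrightarrow> H \<in> \<a> \<Longrightarrow> Ad G l H = H"
  using M_closed A_closed by (auto simp: L_def Ad_mult Ad_M Ad_A)

lemma conj_L_horo: "l \<in> L \<Longrightarrow> H \<in> \<a> \<Longrightarrow> n \<in> horo H \<Longrightarrow> l \<otimes> n \<otimes> inv l \<in> horo H"
  using conj_horo[OF L_closed, of l n H] Ad_L by simp

lemma conj_L_horo': "l \<in> L \<Longrightarrow> H \<in> \<a> \<Longrightarrow> n \<in> horo H \<Longrightarrow> inv l \<otimes> n \<otimes> l \<in> horo H"
  using conj_L_horo[OF L_inv, of l H n] L_closed by simp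

lemma mH0: "- H0 \<in> \<a>" using H0 subspace_neg[OF subspace_a] by blast

lemma P_iff: "p \<in> P \<longleftrightarrow> (\<exists>l\<in>L. \<exists>n\<in>Np. p = l \<otimes> n)"
  unfolding P_def set_mult_def L_def by blast

lemma PI: "l \<in> L \<Longrightarrow> n \<in> Np \<Longrightarrow> l \<otimes> n \<in> P"
  using P_iff by blast

lemma P_closed: "p \<in> P \<Longrightarrow> p \<in> carrier G"
  using P_iff L_closed N_closed by auto

lemma L_P: "l \<in> L \<Longrightarrow> l \<in> P"
  using PI[of l \<one>] subgroup.one_closed[OF subgroup_horo] L_closed by simp

lemma Np_P: "n \<in> Np \<Longrightarrow> n \<in> P"
  using PI[of \<one> n] A_L[OF one_A] N_closed by simp

lemma subgroup_P: "subgroup P G"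
proof
  show "P \<subseteq> carrier G" using P_closed by blast
  show "\<one> \<in> P" by (rule L_P[OF A_L[OF one_A]])
  fix p q assume "p \<in> P" "q \<in> P"
  then obtain l n l' n' where p: "l \<in> L" "n \<in> Np" "p = l \<otimes> n" "l' \<in> L" "n' \<in> Np" "q = l' \<otimes> n'"
    using P_iff by metis
  have "p \<otimes> q = (l \<otimes> l') \<otimes> ((inv l' \<otimes> n \<otimes> l') \<otimes> n')"
    using p L_closed N_closed by (simp add: m_assoc)
  then show "p \<otimes> q \<in> P"
    using p L_mult conj_L_horo'[OF _ H0] subgroup.m_closed[OF subgroup_horo] PI by simp
next
  fix p assume "p \<in> P"
  then obtain l n where p: "l \<in> L" "n \<in> Np" "p = l \<otimes> n" using P_iff by metis
  have "inv p = inv l \<otimes> (l \<otimes> inv n \<otimes> inv l)"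
    using p L_closed N_closed by (simp add: m_assoc inv_mult_group)
  then show "inv p \<in> P"
    using p L_inv conj_L_horo[OF _ H0] subgroup.m_inv_closed[OF subgroup_horo] PI by simp
qed

lemmas P_mult = subgroup.m_closed[OF subgroup_P] and P_inv = subgroup.m_inv_closed[OF subgroup_P]
lemmas horo_mult = subgroup.m_closed[OF subgroup_horo] and horo_inv = subgroup.m_inv_closed[OF subgroup_horo]

lemma P_decomp':
  assumes "p \<in> P"
  obtains n l where "n \<in> Np" "l \<in> L" "p = n \<otimes> l"
proof -
  obtain l n where p: "l \<in> L" "n \<in> Np" "p = l \<otimes> n" using assms P_iff by metis
  have "p = (l \<otimes> n \<otimes> inv l) \<otimes> l" using p L_closed N_closed by (simp add: m_assoc)
  then show thesis using that p conj_L_horo[OF _ H0] by blast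
qed

lemma Ad_P: "p \<in> P \<Longrightarrow> Ad G p H0 - H0 \<in> contr H0"
proof -
  assume "p \<in> P"
  then obtain l n where p: "l \<in> L" "n \<in> Np" "p = l \<otimes> n" using P_iff by metis
  have "Ad G p H0 - H0 = Ad G l (Ad G n H0 - H0)"
    using p L_closed N_closed Ad_L H0 by (simp add: Ad_mult linear_diff[OF linear_Ad[OF L_closed]])
  then show ?thesis using Ad_contr[OF L_closed] Ad_horo p Ad_L H0 by metis
qed

text \<open>An element of \<open>Nm\<close> moves \<open>H0\<close> by a vector of
  \<open>contr (- H0)\<close>. If that vector is also in \<open>contr H0\<close> it is 0, and
  \<open>horo_fix\<close> applies.\<close>

lemma Nm_trivial:
  assumes n: "n \<in> Nm" and c: "Ad G n H0 - H0 \<in> contr H0"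
  shows "n = \<one>"
proof (rule horo_fix[OF n])
  note lin = linear_Ad[OF horo_closed[OF n]]
  have "Ad G n (- H0) - - H0 \<in> contr (- H0)" using Ad_horo[OF n] .
  then have "- (Ad G n H0 - H0) \<in> contr (- H0)" by (simp add: linear_neg[OF lin])
  then have "Ad G n H0 - H0 \<in> contr (- H0)" using subspace_neg[OF subspace_contr] by fastforce
  then have "Ad G n H0 - H0 = 0" using contr_inter[OF H0 c] by blast
  then show "Ad G n (- H0) = - H0" by (simp add: linear_neg[OF lin])
qed

lemma Nm_P: "n \<in> Nm \<Longrightarrow> n \<in> P \<Longrightarrow> n = \<one>"
  using Nm_trivial Ad_P by blast

lemma Np_L: "n \<in> Np \<Longrightarrow> n \<in> L \<Longrightarrow> n = \<one>"
  using horo_fix Ad_L H0 by blast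

lemma big_cell_unique:
  assumes n: "n \<in> Nm" "n' \<in> Nm" and p: "p \<in> P" "p' \<in> P" and eq: "n \<otimes> p = n' \<otimes> p'"
  shows "n = n'" "p = p'"
proof -
  have c: "n \<in> carrier G" "n' \<in> carrier G" "p \<in> carrier G" "p' \<in> carrier G"
    using n p N_closed P_closed by auto
  have "inv n' \<otimes> n = inv n' \<otimes> (n \<otimes> p) \<otimes> inv p" using c by (simp add: m_assoc)
  also have "\<dots> = p' \<otimes> inv p" using c unfolding eq by (simp add: m_assoc)
  finally have e: "inv n' \<otimes> n = p' \<otimes> inv p" .
  have "inv n' \<otimes> n \<in> Nm" using n horo_mult horo_inv by blast
  moreover have "inv n' \<otimes> n \<in> P" unfolding e using p P_mult P_inv by blast
  ultimately have "inv n' \<otimes> n = \<one>" by (rule Nm_P)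
  then show "n = n'" using c by (metis inv_equality inv_inv inv_closed)
  then show "p = p'" using eq c by simp
qed

text \<open>The quotient of the two factors in \<open>L\<close> lies in \<open>Np\<close> as well,
  hence is trivial; then \<open>M \<subseteq> K\<close> and the trivial intersection of
  \<open>A\<close> and \<open>K\<close> separate the \<open>A\<close>-parts.\<close>

lemma Langlands_unique:
  assumes n: "n \<in> Np" "n' \<in> Np" and m: "m \<in> M" "m' \<in> M" and a: "a \<in> A" "a' \<in> A"
    and eq: "m \<otimes> a \<otimes> n = m' \<otimes> a' \<otimes> n'"
  shows "a = a'"
proof -
  note closed = N_closed M_closed A_closed
  let ?l = "m \<otimes> a" and ?l' = "m' \<otimes> a'"
  have l: "?l \<in> L" "?l' \<in> L" using m a by (auto simp: L_def)
  have c: "?l \<in> carrier G" "?l' \<in> carrier G" using l L_closed by auto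
  have cn: "n \<in> carrier G" "n' \<in> carrier G" using n closed by auto
  have "inv ?l' \<otimes> ?l = inv ?l' \<otimes> (?l \<otimes> n) \<otimes> inv n" using c cn by (simp add: m_assoc)
  also have "\<dots> = n' \<otimes> inv n" unfolding eq using c cn by (simp only: cancel_left)
  finally have e: "inv ?l' \<otimes> ?l = n' \<otimes> inv n" .
  have "inv ?l' \<otimes> ?l \<in> L" using l L_mult L_inv by blast
  moreover have "inv ?l' \<otimes> ?l \<in> Np" unfolding e using n horo_mult horo_inv by blast
  ultimately have "inv ?l' \<otimes> ?l = \<one>" using Np_L by blast
  then have "?l = ?l'" using c by (metis inv_equality inv_inv inv_closed)
  then have "inv m' \<otimes> (m \<otimes> a) \<otimes> inv a = inv m' \<otimes> (m' \<otimes> a') \<otimes> inv a" by simp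
  then have e2: "inv m' \<otimes> m = a' \<otimes> inv a" using m a closed by (simp add: m_assoc)
  have "inv m' \<otimes> m \<in> K" using m M_K subgroup.m_closed[OF K_sub] subgroup.m_inv_closed[OF K_sub] by blast
  moreover have "a' \<otimes> inv a \<in> A" using a A_mult A_inv by blast
  ultimately have "a' \<otimes> inv a = \<one>" using A_inter_K e2 by simp
  then show ?thesis using a closed by (metis inv_equality inv_inv inv_closed)
qed

section \<open>The factorization of the big cell\<close>

definition cell :: "'a set" where "cell = {n \<otimes> p |n p. n \<in> Nm \<and> p \<in> P}"

text \<open>The components \<open>\<nu>\<close> in \<open>N\<^sup>-\<close> and \<open>\<alpha>\<close> in \<open>A\<close> are meaningful on the big cell only.\<close>

definition \<nu> :: "'a \<Rightarrow> 'a" where "\<nu> g = (THE n. n \<in> Nm \<and> (\<exists>p\<in>P. g = n \<otimes> p))"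

definition \<alpha> :: "'a \<Rightarrow> 'a" where
  "\<alpha> g = (THE a. a \<in> A \<and> (\<exists>n\<in>Nm. \<exists>m\<in>M. \<exists>n'\<in>Np. g = n \<otimes> (m \<otimes> a \<otimes> n')))"

lemma \<nu>_eq: "n \<in> Nm \<Longrightarrow> p \<in> P \<Longrightarrow> \<nu> (n \<otimes> p) = n"
  unfolding \<nu>_def using big_cell_unique(1) by (intro the_equality) blast+

lemma \<alpha>_eq: "n \<in> Nm \<Longrightarrow> m \<in> M \<Longrightarrow> a \<in> A \<Longrightarrow> n' \<in> Np \<Longrightarrow> \<alpha> (n \<otimes> (m \<otimes> a \<otimes> n')) = a"
proof -
  assume h: "n \<in> Nm" "m \<in> M" "a \<in> A" "n' \<in> Np"
  have inP: "m \<otimes> a \<otimes> n' \<in> P" if "m \<in> M" "a \<in> A" "n' \<in> Np" for m a n'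
    using that by (intro PI) (auto simp: L_def)
  show ?thesis unfolding \<alpha>_def
  proof (rule the_equality)
    show "a \<in> A \<and> (\<exists>k\<in>Nm. \<exists>m'\<in>M. \<exists>n''\<in>Np. n \<otimes> (m \<otimes> a \<otimes> n') = k \<otimes> (m' \<otimes> a \<otimes> n''))"
      using h by blast
    fix b assume "b \<in> A \<and> (\<exists>k\<in>Nm. \<exists>m'\<in>M. \<exists>n''\<in>Np. n \<otimes> (m \<otimes> a \<otimes> n') = k \<otimes> (m' \<otimes> b \<otimes> n''))"
    then obtain k m' n'' where b: "b \<in> A" "k \<in> Nm" "m' \<in> M" "n'' \<in> Np"
      and eq: "n \<otimes> (m \<otimes> a \<otimes> n') = k \<otimes> (m' \<otimes> b \<otimes> n'')" by blast
    have "m \<otimes> a \<otimes> n' = m' \<otimes> b \<otimes> n''"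
      using big_cell_unique(2)[OF h(1) b(2) inP inP eq] h b by blast
    then show "b = a" using Langlands_unique h b by metis
  qed
qed

lemma cellI: "n \<in> Nm \<Longrightarrow> p \<in> P \<Longrightarrow> n \<otimes> p \<in> cell"
  by (auto simp: cell_def)

lemma P_obtain:
  assumes "p \<in> P"
  obtains m a n where "m \<in> M" "a \<in> A" "n \<in> Np" "p = m \<otimes> a \<otimes> n"
  using assms P_iff by (auto simp: L_def)

lemma cell_right:
  assumes "g \<in> cell" "p \<in> P"
  shows "g \<otimes> p \<in> cell" "\<nu> (g \<otimes> p) = \<nu> g"
proof -
  obtain n q where g: "n \<in> Nm" "q \<in> P" "g = n \<otimes> q" using assms by (auto simp: cell_def)
  have e: "g \<otimes> p = n \<otimes> (q \<otimes> p)" using g assms N_closed P_closed by (simp add: m_assoc)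
  show "g \<otimes> p \<in> cell" "\<nu> (g \<otimes> p) = \<nu> g"
    unfolding e using g assms P_mult \<nu>_eq cellI by auto
qed

text \<open>\<open>L\<close> normalizes \<open>Np\<close> and \<open>M\<close> commutes with
  \<open>A\<close>, so the factors of a right translation by \<open>P\<close> can be sorted into
  place.\<close>

lemma \<alpha>_mult:
  assumes g: "g \<in> cell" and n: "n \<in> Nm" and q: "m \<in> M" "a \<in> A" "n' \<in> Np"
  shows "n \<otimes> g \<otimes> (m \<otimes> a \<otimes> n') \<in> cell" "\<alpha> (n \<otimes> g \<otimes> (m \<otimes> a \<otimes> n')) = \<alpha> g \<otimes> a" "\<alpha> g \<in> A"
    "\<nu> (n \<otimes> g \<otimes> (m \<otimes> a \<otimes> n')) = n \<otimes> \<nu> g"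
proof -
  obtain n0 p0 where "n0 \<in> Nm" "p0 \<in> P" "g = n0 \<otimes> p0" using g by (auto simp: cell_def)
  then obtain m0 a0 n1 where h: "n0 \<in> Nm" "m0 \<in> M" "a0 \<in> A" "n1 \<in> Np" "g = n0 \<otimes> (m0 \<otimes> a0 \<otimes> n1)"
    using P_obtain by metis
  let ?l = "m \<otimes> a"
  have l: "?l \<in> L" using q by (auto simp: L_def)
  note cl = N_closed M_closed A_closed L_closed
  define n2 where "n2 = inv ?l \<otimes> n1 \<otimes> ?l"
  have n2: "n2 \<in> Np" unfolding n2_def using l h by (intro conj_L_horo' H0)
  have "n1 \<otimes> ?l = ?l \<otimes> n2"
    using l L_closed[OF l] h cl by (simp add: n2_def m_assoc)
  then have "m0 \<otimes> a0 \<otimes> n1 \<otimes> (?l \<otimes> n') = m0 \<otimes> a0 \<otimes> (?l \<otimes> n2) \<otimes> n'"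
    using l h q cl n2 by (metis (no_types, lifting) m_assoc m_closed)
  also have "\<dots> = m0 \<otimes> (a0 \<otimes> m) \<otimes> a \<otimes> (n2 \<otimes> n')"
    using l h q cl n2 by (simp add: m_assoc)
  also have "a0 \<otimes> m = m \<otimes> a0" using h q M_A_commute by simp
  finally have e1: "m0 \<otimes> a0 \<otimes> n1 \<otimes> (?l \<otimes> n') = (m0 \<otimes> m) \<otimes> (a0 \<otimes> a) \<otimes> (n2 \<otimes> n')"
    using l h q cl n2 by (simp add: m_assoc)
  have "n \<otimes> g \<otimes> (?l \<otimes> n') = (n \<otimes> n0) \<otimes> (m0 \<otimes> a0 \<otimes> n1 \<otimes> (?l \<otimes> n'))"
    using l h q n cl by (simp add: m_assoc)
  then have e: "n \<otimes> g \<otimes> (?l \<otimes> n') = (n \<otimes> n0) \<otimes> ((m0 \<otimes> m) \<otimes> (a0 \<otimes> a) \<otimes> (n2 \<otimes> n'))"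
    unfolding e1 .
  have in': "n \<otimes> n0 \<in> Nm" "m0 \<otimes> m \<in> M" "a0 \<otimes> a \<in> A" "n2 \<otimes> n' \<in> Np"
    using n h q n2 horo_mult A_mult subgroup.m_closed[OF subgroup_M] by auto
  have P1: "(m0 \<otimes> m) \<otimes> (a0 \<otimes> a) \<otimes> (n2 \<otimes> n') \<in> P" "m0 \<otimes> a0 \<otimes> n1 \<in> P"
    using in' h by (auto intro!: PI LI)
  have \<alpha>g: "\<alpha> g = a0" using \<alpha>_eq h by simp
  show "n \<otimes> g \<otimes> (?l \<otimes> n') \<in> cell" unfolding e using in' P1 by (intro cellI)
  show "\<alpha> (n \<otimes> g \<otimes> (?l \<otimes> n')) = \<alpha> g \<otimes> a" unfolding e using \<alpha>_eq[OF in'] \<alpha>g by simp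
  show "\<alpha> g \<in> A" using \<alpha>g h by simp
  have "\<nu> g = n0" using \<nu>_eq[OF h(1) P1(2)] h by simp
  then show "\<nu> (n \<otimes> g \<otimes> (?l \<otimes> n')) = n \<otimes> \<nu> g" unfolding e using \<nu>_eq[OF in'(1) P1(1)] by simp
qed

text \<open>The Lie algebra behind the big cell, with \<open>Z\<close> split into the part fixed by
  \<open>\<theta>\<close> and \<open>\<a>\<close>. Each summand is parametrized by the whole space;
  the redundancy is harmless, since openness asks for a right inverse of the derivative.\<close>

lemma ex_cell_coordinates:
  obtains q1 q2 q3 q4 :: "'e \<Rightarrow> 'e"
  where "linear q1" "linear q2" "linear q3" "linear q4"
    "range q1 \<subseteq> nilp (- H0)" "range q2 \<subseteq> {Y \<in> Z. \<theta> Y = Y}" "range q3 \<subseteq> \<a>" "range q4 \<subseteq> nilp H0"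
    "\<And>W. \<exists>x1 x2 x3 x4. W = q1 x1 + q2 x2 + q3 x3 + q4 x4"
proof -
  have s1: "subspace (nilp H)" for H by (simp add: nilp_def)
  have s2: "subspace {Y \<in> Z. \<theta> Y = Y}"
    using subspace_Z by (auto simp: subspace_def linear_0[OF linear_\<theta>] linear_add[OF linear_\<theta>] linear_scale[OF linear_\<theta>])
  obtain q1 :: "'e \<Rightarrow> 'e" where q1: "linear q1" "range q1 = nilp (- H0)" using ex_linear_onto_subspace[OF s1] .
  obtain q2 :: "'e \<Rightarrow> 'e" where q2: "linear q2" "range q2 = {Y \<in> Z. \<theta> Y = Y}" using ex_linear_onto_subspace[OF s2] .
  obtain q3 :: "'e \<Rightarrow> 'e" where q3: "linear q3" "range q3 = \<a>" using ex_linear_onto_subspace[OF subspace_a] .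
  obtain q4 :: "'e \<Rightarrow> 'e" where q4: "linear q4" "range q4 = nilp H0" using ex_linear_onto_subspace[OF s1] .
  have "\<exists>x1 x2 x3 x4. W = q1 x1 + q2 x2 + q3 x3 + q4 x4" for W
  proof -
    obtain X1 X2 X3 where X: "X1 \<in> nilp H0" "X2 \<in> Z" "X3 \<in> nilp (- H0)" "W = X1 + X2 + X3"
      using decomp[of W] by blast
    obtain Y H where Y: "Y \<in> Z" "\<theta> Y = Y" "H \<in> \<a>" "X2 = Y + H" using Z_decomp[OF X(2)] .
    have "X3 \<in> range q1" "Y \<in> range q2" "H \<in> range q3" "X1 \<in> range q4"
      using X Y q1 q2 q3 q4 by auto
    then obtain x1 x2 x3 x4 where "X3 = q1 x1" "Y = q2 x2" "H = q3 x3" "X1 = q4 x4" by blast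
    then have "W = q1 x1 + q2 x2 + q3 x3 + q4 x4" using X(4) Y(4) by (simp add: algebra_simps)
    then show ?thesis by blast
  qed
  then show thesis using that q1 q2 q3 q4 by blast
qed

lemma lie_exp_Z_M:
  assumes "Y \<in> Z" "\<theta> Y = Y"
  shows "lie_exp G Y \<in> M"
proof (rule MI[OF lie_exp_in_K[OF assms(2)]])
  fix a assume "a \<in> A"
  then obtain H where H: "H \<in> \<a>" "a = lie_exp G H" by (auto simp: A_def)
  then have "bracket G H Y = 0" using assms by (simp add: Z_def)
  from lie_exp_commute[OF this] H show "lie_exp G Y \<otimes> a = a \<otimes> lie_exp G Y" by simp
qed

text \<open>Sussmann's open mapping theorem requires differentiability at a single point only, so that no
  smoothness of the exponential map away from \<open>0\<close> is needed.\<close>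

lemma cell_neighbourhood:
  assumes V: "openin (gtop G) V" "\<one> \<in> V"
  obtains W where "openin (gtop G) W" "\<one> \<in> W"
    "\<And>g. g \<in> W \<Longrightarrow> \<exists>n\<in>Nm. \<exists>m\<in>M. \<exists>a\<in>A. \<exists>n'\<in>Np. g = n \<otimes> (m \<otimes> a \<otimes> n') \<and> n \<in> V \<and> sqrtA a \<in> V"
proof -
  obtain q1 q2 q3 q4 :: "'e \<Rightarrow> 'e"
    where lin: "linear q1" "linear q2" "linear q3" "linear q4"
      and ran: "range q1 \<subseteq> nilp (- H0)" "range q2 \<subseteq> {Y \<in> Z. \<theta> Y = Y}" "range q3 \<subseteq> \<a>" "range q4 \<subseteq> nilp H0"
      and sur: "\<And>W. \<exists>x1 x2 x3 x4. W = q1 x1 + q2 x2 + q3 x3 + q4 x4"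
    by (rule ex_cell_coordinates) (rule that)
  obtain \<delta> where \<delta>: "\<delta> > 0" "\<And>X. norm X < \<delta> \<Longrightarrow> limitin (gtop G) (lie_exp G) (lie_exp G X) (nhds X)"
    and cder: "has_cder (lie_exp G) (\<lambda>v. v) 0"
    using lie_exp_local by blast
  define r1 :: "'e \<times> 'e \<times> 'e \<times> 'e \<Rightarrow> 'e" where "r1 x = q1 (fst x)" for x
  define r2 :: "'e \<times> 'e \<times> 'e \<times> 'e \<Rightarrow> 'e" where "r2 x = q2 (fst (snd x))" for x
  define r3 :: "'e \<times> 'e \<times> 'e \<times> 'e \<Rightarrow> 'e" where "r3 x = q3 (fst (snd (snd x)))" for x
  define r4 :: "'e \<times> 'e \<times> 'e \<times> 'e \<Rightarrow> 'e" where "r4 x = q4 (snd (snd (snd x)))" for x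
  \<comment> \<open>Half of the \<open>A\<close>-coordinate: its exponential is the square root of
    the \<open>A\<close>-factor, and the smallness of the root is read off from it.\<close>
  define r5 :: "'e \<times> 'e \<times> 'e \<times> 'e \<Rightarrow> 'e" where "r5 x = (1/2) *\<^sub>R r3 x" for x
  have bl: "bounded_linear q1" "bounded_linear q2" "bounded_linear q3" "bounded_linear q4"
    using lin linear_conv_bounded_linear by auto
  have blr: "bounded_linear r1" "bounded_linear r2" "bounded_linear r3" "bounded_linear r4"
    unfolding r1_def[abs_def] r2_def[abs_def] r3_def[abs_def] r4_def[abs_def]
    using bounded_linear_compose[OF bl(1) bounded_linear_fst]
      bounded_linear_compose[OF bl(2) bounded_linear_compose[OF bounded_linear_fst bounded_linear_snd]]
      bounded_linear_compose[OF bl(3) bounded_linear_compose[OF bounded_linear_fst bounded_linear_compose[OF bounded_linear_snd bounded_linear_snd]]]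
      bounded_linear_compose[OF bl(4) bounded_linear_compose[OF bounded_linear_snd bounded_linear_compose[OF bounded_linear_snd bounded_linear_snd]]]
    by auto
  have blr5: "bounded_linear r5"
    unfolding r5_def[abs_def] by (rule bounded_linear_compose[OF bounded_linear_scaleR_right blr(3)])
  define E where "E x = lie_exp G (r1 x) \<otimes> (lie_exp G (r2 x) \<otimes> lie_exp G (r3 x) \<otimes> lie_exp G (r4 x))" for x
  define E' where "E' x = r1 x + (r2 x + r3 x + r4 x)" for x
  have cd: "has_cder (\<lambda>x. lie_exp G (r x)) r 0" if "bounded_linear r" for r :: "'e \<times> 'e \<times> 'e \<times> 'e \<Rightarrow> 'e"
    using has_cder_compose[of "lie_exp G" "\<lambda>v. v" r 0 r] cder that bounded_linear_imp_has_derivative[OF that]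
    by (simp add: linear_0[OF bounded_linear.linear[OF that]])
  have E: "has_cder E E' 0"
    unfolding E_def[abs_def] E'_def[abs_def] by (intro has_cder_mult cd blr)
  define S where "S = {x. norm (r1 x) < \<delta> \<and> norm (r2 x) < \<delta> \<and> norm (r3 x) < \<delta> \<and> norm (r4 x) < \<delta>}"
  note cont = linear_continuous_on[OF blr(1)] linear_continuous_on[OF blr(2)]
    linear_continuous_on[OF blr(3)] linear_continuous_on[OF blr(4)]
  have "open S"
    unfolding S_def by (intro open_Collect_conj open_Collect_less continuous_intros cont)
  have lime: "limitin (gtop G) (\<lambda>x. lie_exp G (r x)) (lie_exp G (r x)) (nhds x)"
    if "bounded_linear r" "norm (r x) < \<delta>" for r :: "'e \<times> 'e \<times> 'e \<times> 'e \<Rightarrow> 'e" and x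
    by (rule lim_compose[OF \<delta>(2)[OF that(2)]])
      (use linear_continuous_at[OF that(1), of x] in \<open>simp add: isCont_def tendsto_at_iff_tendsto_nhds\<close>)
  have limE: "limitin (gtop G) E (E x) (nhds x)" if "x \<in> S" for x
    unfolding E_def[abs_def] using that by (intro lim_mult lime blr) (auto simp: S_def)
  define T where "T = {x \<in> S. E x \<in> U}"
  have "continuous_map (top_of_set S) (gtop G) E" using \<open>open S\<close> limE by (rule continuous_map_of_lim)
  then have "openin (top_of_set S) {x \<in> topspace (top_of_set S). E x \<in> U}"
    using openin_U by (rule openin_continuous_map_preimage)
  then have "open T" using \<open>open S\<close> by (simp add: T_def openin_open_eq)
  have r0: "r1 0 = 0" "r2 0 = 0" "r3 0 = 0" "r4 0 = 0" "r5 0 = 0"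
    using blr blr5 by (auto intro: linear_0 bounded_linear.linear)
  have E0: "E 0 = \<one>" by (simp add: E_def r0)
  have T0: "0 \<in> T" using \<delta> by (simp add: T_def S_def r0 E0)
  have contf: "continuous_on T (\<lambda>x. coord G (E x))"
  proof (rule continuous_at_imp_continuous_on, rule ballI)
    fix x assume "x \<in> T"
    then have "((\<lambda>x. coord G (E x)) \<longlongrightarrow> coord G (E x)) (nhds x)"
      using lim_coord(2)[OF limE] by (simp add: T_def)
    then show "isCont (\<lambda>x. coord G (E x)) x"
      unfolding isCont_def by (rule tendsto_at_iff_tendsto_nhds[THEN iffD2])
  qed
  have linE': "linear E'"
    unfolding E'_def[abs_def] using blr by (intro linear_compose_add bounded_linear.linear)
  have "surj E'"
  proof (rule surjI)
    fix W
    have "\<exists>x. E' x = W"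
    proof -
      obtain x1 x2 x3 x4 where "W = q1 x1 + q2 x2 + q3 x3 + q4 x4" using sur by blast
      then have "E' (x1, x2, x3, x4) = W" by (simp add: E'_def r1_def r2_def r3_def r4_def algebra_simps)
      then show ?thesis by blast
    qed
    then show "E' (SOME x. E' x = W) = W" by (rule someI_ex)
  qed
  then obtain g' where g': "linear g'" "E' \<circ> g' = id" using linear_surjective_right_inverse[OF linE'] by blast
  \<comment> \<open>Shrinking the domain makes the factors small along with the product; the open
    mapping theorem applies to any subset of \<open>T\<close> with 0 in its interior.\<close>
  define T' where "T' = {x \<in> T. lie_exp G (r1 x) \<in> V \<and> lie_exp G (r5 x) \<in> V}"
  have int: "0 \<in> interior T'"
  proof -
    have l: "limitin (gtop G) (\<lambda>x. lie_exp G (r1 x)) \<one> (nhds 0)" "limitin (gtop G) (\<lambda>x. lie_exp G (r5 x)) \<one> (nhds 0)"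
      using lime[OF blr(1), of 0] lime[OF blr5, of 0] \<delta>(1) by (simp_all add: r0)
    have "\<forall>\<^sub>F x in nhds 0. x \<in> T'"
      using limitinD[OF l(1) V] limitinD[OF l(2) V] eventually_nhds_in_open[OF \<open>open T\<close> T0]
      by eventually_elim (simp add: T'_def)
    then show ?thesis unfolding eventually_nhds interior_def by blast
  qed
  have "coord G (E 0) \<in> interior ((\<lambda>x. coord G (E x)) ` T')"
  proof (rule sussmann_open_mapping[OF \<open>open T\<close> contf T0 _ _ g'(2)])
    show "((\<lambda>x. coord G (E x)) has_derivative E') (at 0)" using E by (simp add: has_cder_def)
    show "bounded_linear g'" using g'(1) by (simp add: linear_conv_bounded_linear)
    show "T' \<subseteq> T" by (auto simp: T'_def)
  qed (rule int)
  then obtain Q where Q: "open Q" "e0 \<in> Q" "Q \<subseteq> (\<lambda>x. coord G (E x)) ` T'"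
    unfolding interior_def E0 by blast
  define W where "W = {g \<in> U. coord G g \<in> Q}"
  have Utop: "topspace (subtopology (gtop G) U) = U"
    using openin_subset[OF openin_U] by auto
  have "openin (subtopology (gtop G) U) {g \<in> topspace (subtopology (gtop G) U). coord G g \<in> Q}"
    using continuous_chart[OF one_chart(1)] Q(1) by (intro openin_continuous_map_preimage) auto
  then have "openin (gtop G) W"
    unfolding Utop W_def using openin_trans_full openin_U by blast
  moreover have "\<one> \<in> W" using Q by (simp add: W_def)
  moreover have "\<exists>n\<in>Nm. \<exists>m\<in>M. \<exists>a\<in>A. \<exists>n'\<in>Np. g = n \<otimes> (m \<otimes> a \<otimes> n') \<and> n \<in> V \<and> sqrtA a \<in> V" if g: "g \<in> W" for g
  proof -
    obtain x where x: "x \<in> T'" "coord G g = coord G (E x)" using g Q(3) by (auto simp: W_def)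
    then have "coord_inv G (coord G g) = coord_inv G (coord G (E x))" by simp
    then have "g = E x" using g x(1) by (simp add: W_def T'_def T_def)
    moreover have "lie_exp G (r1 x) \<in> Nm" "lie_exp G (r4 x) \<in> Np"
      using ran by (auto intro!: lie_exp_horo simp: r1_def r4_def)
    moreover have "lie_exp G (r2 x) \<in> M" using ran by (intro lie_exp_Z_M) (auto simp: r2_def)
    moreover have r3: "r3 x \<in> \<a>" using ran by (auto simp: r3_def)
    then have "lie_exp G (r3 x) \<in> A" by (simp add: A_def)
    moreover have "sqrtA (lie_exp G (r3 x)) = lie_exp G (r5 x)" using sqrtA_exp[OF r3] by (simp add: r5_def)
    ultimately show ?thesis using x(1) unfolding T'_def E_def by force
  qed
  ultimately show thesis by (rule that)
qed

definition \<sigma> :: "'a \<Rightarrow> 'a" where "\<sigma> g = sqrtA (\<alpha> g)"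

text \<open>Multiplying by \<open>inv n0\<close> on the left and \<open>inv ?p\<close> on the right
  moves \<open>l\<close> to \<open>\<one>\<close>, where \<open>cell_neighbourhood\<close> keeps the
  factors small; \<open>\<alpha>_mult\<close> undoes the move on each component.\<close>

lemma lim_cell:
  assumes f: "limitin (gtop G) f l \<F>" and l: "l \<in> cell"
  shows "limitin (gtop G) (\<lambda>x. \<nu> (f x)) (\<nu> l) \<F>" "limitin (gtop G) (\<lambda>x. \<sigma> (f x)) (\<sigma> l) \<F>"
proof -
  obtain n0 p0 where "n0 \<in> Nm" "p0 \<in> P" "l = n0 \<otimes> p0" using l by (auto simp: cell_def)
  then obtain m0 a0 n1 where h: "n0 \<in> Nm" "m0 \<in> M" "a0 \<in> A" "n1 \<in> Np" "l = n0 \<otimes> (m0 \<otimes> a0 \<otimes> n1)"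
    using P_obtain by metis
  let ?p = "m0 \<otimes> a0 \<otimes> n1"
  have p: "?p \<in> P" using h by (intro PI LI)
  have c: "n0 \<in> carrier G" "?p \<in> carrier G" "sqrtA a0 \<in> carrier G"
    using h p N_closed P_closed A_closed sqrtA_closed by auto
  have \<nu>l: "\<nu> l = n0" and \<sigma>l: "\<sigma> l = sqrtA a0" using \<nu>_eq[OF h(1) p] \<alpha>_eq[OF h(1-4)] h(5) by (simp_all add: \<sigma>_def)
  have lim: "limitin (gtop G) (\<lambda>x. inv n0 \<otimes> f x \<otimes> inv ?p) \<one> \<F>"
  proof -
    have "limitin (gtop G) (\<lambda>x. inv n0 \<otimes> f x \<otimes> inv ?p) (inv n0 \<otimes> l \<otimes> inv ?p) \<F>"
      using c by (intro lim_mult lim_const f inv_closed)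
    moreover have "inv n0 \<otimes> l \<otimes> inv ?p = \<one>" using c unfolding h(5) by (simp add: m_assoc[symmetric])
    ultimately show ?thesis by simp
  qed
  have unshift: "n \<otimes> (inv n \<otimes> y \<otimes> inv p) \<otimes> p = y"
    if "n \<in> carrier G" "p \<in> carrier G" "y \<in> carrier G" for n p y
    using that by (simp add: m_assoc)
  have car: "\<forall>\<^sub>F x in \<F>. f x \<in> carrier G"
    using limitinD[OF f openin_topspace] lim_carrier[OF f] topspace_gtop by simp
  have key: "\<forall>\<^sub>F x in \<F>. \<nu> (f x) \<in> V1 \<and> \<sigma> (f x) \<in> V2"
    if V: "openin (gtop G) V1" "n0 \<in> V1" "openin (gtop G) V2" "sqrtA a0 \<in> V2" for V1 V2
  proof -
    \<comment> \<open>The two targets, pulled back along the translations by \<open>n0\<close> and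
      by \<open>sqrtA a0\<close> through which the components return; the factors
      \<open>\<one>\<close> fit \<open>openin_translate\<close>.\<close>
    define V where "V = {x \<in> carrier G. n0 \<otimes> x \<otimes> \<one> \<in> V1} \<inter> {x \<in> carrier G. \<one> \<otimes> x \<otimes> sqrtA a0 \<in> V2}"
    have "openin (gtop G) V" unfolding V_def using c V by (intro openin_Int openin_translate) auto
    moreover have "\<one> \<in> V" using c V by (simp add: V_def)
    ultimately obtain W where W: "openin (gtop G) W" "\<one> \<in> W"
      "\<And>g. g \<in> W \<Longrightarrow> \<exists>n\<in>Nm. \<exists>m\<in>M. \<exists>a\<in>A. \<exists>n'\<in>Np. g = n \<otimes> (m \<otimes> a \<otimes> n') \<and> n \<in> V \<and> sqrtA a \<in> V"
      using cell_neighbourhood by metis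
    show ?thesis
      using limitinD[OF lim W(1,2)] car
    proof eventually_elim
      case (elim x)
      then obtain n m a n' where k: "n \<in> Nm" "m \<in> M" "a \<in> A" "n' \<in> Np" "n \<in> V" "sqrtA a \<in> V"
        and eq: "inv n0 \<otimes> f x \<otimes> inv ?p = n \<otimes> (m \<otimes> a \<otimes> n')"
        using W(3) by metis
      define w where "w = n \<otimes> (m \<otimes> a \<otimes> n')"
      have wP: "m \<otimes> a \<otimes> n' \<in> P" using k by (intro PI LI)
      have w: "w \<in> cell" "\<nu> w = n" "\<alpha> w = a"
        unfolding w_def using cellI[OF k(1) wP] \<nu>_eq[OF k(1) wP] \<alpha>_eq[OF k(1-4)] by auto
      have wc: "w \<in> carrier G" unfolding w_def using k(1) wP N_closed P_closed by simp
      have "n0 \<otimes> w \<otimes> ?p = n0 \<otimes> (inv n0 \<otimes> f x \<otimes> inv ?p) \<otimes> ?p" unfolding w_def eq ..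
      also have "\<dots> = f x" using unshift c elim(2) by blast
      finally have fx: "f x = n0 \<otimes> w \<otimes> ?p" by simp
      have "\<nu> (f x) = n0 \<otimes> n" "\<alpha> (f x) = a \<otimes> a0"
        using \<alpha>_mult[OF w(1) h(1-4)] w unfolding fx by auto
      moreover have "n0 \<otimes> n \<in> V1" using k(5) c N_closed k(1) by (simp add: V_def)
      moreover have "sqrtA a \<otimes> sqrtA a0 \<in> V2" using k(6) A_closed[OF sqrtA_closed[OF k(3)]] by (simp add: V_def)
      ultimately show ?case using sqrtA_mult[OF k(3) h(3)] by (simp add: \<sigma>_def)
    qed
  qed
  have top: "openin (gtop G) (carrier G)" using openin_topspace[of "gtop G"] topspace_gtop by simp
  show "limitin (gtop G) (\<lambda>x. \<nu> (f x)) (\<nu> l) \<F>"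
    unfolding limitin_def \<nu>l
  proof (intro conjI allI impI)
    show "n0 \<in> topspace (gtop G)" using c topspace_gtop by simp
    fix V assume V: "openin (gtop G) V \<and> n0 \<in> V"
    show "\<forall>\<^sub>F x in \<F>. \<nu> (f x) \<in> V"
      using key[of V "carrier G"] V top c by (auto elim: eventually_mono)
  qed
  show "limitin (gtop G) (\<lambda>x. \<sigma> (f x)) (\<sigma> l) \<F>"
    unfolding limitin_def \<sigma>l
  proof (intro conjI allI impI)
    show "sqrtA a0 \<in> topspace (gtop G)" using c topspace_gtop by simp
    fix V assume V: "openin (gtop G) V \<and> sqrtA a0 \<in> V"
    show "\<forall>\<^sub>F x in \<F>. \<sigma> (f x) \<in> V"
      using key[of "carrier G" V] V top c by (auto elim: eventually_mono)
  qed
qed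

end

section \<open>The equivariant map\<close>

context flag_setup
begin

text \<open>The normalizer of \<open>A\<close> in the whole group, not a product of \<open>N\<close>
  and \<open>A\<close>. Both directions are demanded, which makes closure under inverses
  immediate.\<close>

definition NA :: "'a set" where
  "NA = {v \<in> carrier G. \<forall>a\<in>A. v \<otimes> a \<otimes> inv v \<in> A \<and> inv v \<otimes> a \<otimes> v \<in> A}"

lemma NA_closed: "v \<in> NA \<Longrightarrow> v \<in> carrier G"
  by (simp add: NA_def)

lemma NA_inv: "v \<in> NA \<Longrightarrow> inv v \<in> NA"
  by (simp add: NA_def)

lemma NA_mult:
  assumes "v \<in> NA" "w \<in> NA"
  shows "v \<otimes> w \<in> NA"
proof -
  have c: "v \<in> carrier G" "w \<in> carrier G" using assms NA_closed by auto
  have "v \<otimes> w \<otimes> a \<otimes> inv (v \<otimes> w) \<in> A \<and> inv (v \<otimes> w) \<otimes> a \<otimes> (v \<otimes> w) \<in> A" if a: "a \<in> A" for a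
  proof -
    have "v \<otimes> w \<otimes> a \<otimes> inv (v \<otimes> w) = v \<otimes> (w \<otimes> a \<otimes> inv w) \<otimes> inv v"
      "inv (v \<otimes> w) \<otimes> a \<otimes> (v \<otimes> w) = inv w \<otimes> (inv v \<otimes> a \<otimes> v) \<otimes> w"
      using c A_closed[OF a] by (simp_all add: m_assoc inv_mult_group)
    then show ?thesis using assms a by (simp add: NA_def)
  qed
  then show ?thesis using c by (simp add: NA_def)
qed

lemma L_NA: "l \<in> L \<Longrightarrow> l \<in> NA"
proof -
  have e: "l \<otimes> a \<otimes> inv l = a" if l: "l \<in> L" and a: "a \<in> A" for l a
  proof -
    obtain m b where l: "m \<in> M" "b \<in> A" "l = m \<otimes> b" using l by (auto simp: L_def)
    have "l \<otimes> a = m \<otimes> (a \<otimes> b)" using l a A_closed M_closed A_commute by (simp add: m_assoc)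
    also have "\<dots> = (m \<otimes> a) \<otimes> b" using l a A_closed M_closed by (simp add: m_assoc)
    also have "\<dots> = a \<otimes> l" using l a A_closed M_closed M_A_commute by (simp add: m_assoc)
    finally show ?thesis using l(3) L_closed[OF \<open>l \<in> L\<close>] A_closed[OF a] by (simp add: m_assoc)
  qed
  show "l \<in> NA" if "l \<in> L"
    using e[OF that] e[OF L_inv[OF that]] L_closed[OF that] by (simp add: NA_def)
qed

abbreviation "TT \<equiv> normalizer_in G K A"

lemma T_K: "w \<in> TT \<Longrightarrow> w \<in> K" and T_closed: "w \<in> TT \<Longrightarrow> w \<in> carrier G"
  using K_closed by (auto simp: normalizer_in_def)

lemma T_NA:
  assumes w: "w \<in> TT"
  shows "w \<in> NA"
proof -
  have im: "(\<lambda>a. w \<otimes> a \<otimes> inv w) ` A = A" using w by (simp add: normalizer_in_def)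
  have "w \<otimes> a \<otimes> inv w \<in> A \<and> inv w \<otimes> a \<otimes> w \<in> A" if a: "a \<in> A" for a
  proof
    show "w \<otimes> a \<otimes> inv w \<in> A" using im a by blast
    obtain b where b: "b \<in> A" "a = w \<otimes> b \<otimes> inv w" using im a by blast
    then have "inv w \<otimes> a \<otimes> w = b" using T_closed[OF w] A_closed by (simp add: m_assoc)
    then show "inv w \<otimes> a \<otimes> w \<in> A" using b by simp
  qed
  then show ?thesis using T_closed[OF w] by (simp add: NA_def)
qed

lemma w0_T: "w0 \<in> TT" using w0_norm by (simp add: A_def)

lemmas w0_closed [simp] = T_closed[OF w0_T]

lemma Ad_w0: "H \<in> \<a> \<Longrightarrow> Ad G (inv w0) H = - H"
proof -
  assume H: "H \<in> \<a>"
  then have "Ad G w0 (- H) = H" using w0_a[of "- H"] subspace_neg[OF subspace_a] by simp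
  then show ?thesis using Ad_inv_left[OF w0_closed, of "- H"] by simp
qed

lemma w0_Np: "n \<in> Np \<Longrightarrow> inv w0 \<otimes> n \<otimes> w0 \<in> Nm" "n \<in> Np \<Longrightarrow> w0 \<otimes> n \<otimes> inv w0 \<in> Nm"
  using conj_horo[of "inv w0" n H0] conj_horo[of w0 n H0] Ad_w0 w0_a H0 by auto

lemma w0_Nm: "n \<in> Nm \<Longrightarrow> inv w0 \<otimes> n \<otimes> w0 \<in> Np" "n \<in> Nm \<Longrightarrow> w0 \<otimes> n \<otimes> inv w0 \<in> Np"
  using conj_horo[of "inv w0" n "- H0"] conj_horo[of w0 n "- H0"] Ad_w0 w0_a mH0 by auto

lemma w0_A: "a \<in> A \<Longrightarrow> w0 \<otimes> a \<otimes> inv w0 = inv a" "a \<in> A \<Longrightarrow> inv w0 \<otimes> a \<otimes> w0 = inv a"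
  using conj_lie_exp[of w0] conj_lie_exp[of "inv w0"] w0_a Ad_w0
  by (auto simp: A_def lie_exp_minus)

lemma T_conj_M:
  assumes w: "w \<in> K" "w \<in> NA" and m: "m \<in> M"
  shows "w \<otimes> m \<otimes> inv w \<in> M"
proof (rule MI)
  note c = NA_closed[OF w(2)] M_closed[OF m]
  show "w \<otimes> m \<otimes> inv w \<in> K"
    using w m M_K subgroup.m_closed[OF K_sub] subgroup.m_inv_closed[OF K_sub] by blast
  fix a assume a: "a \<in> A"
  define b where "b = inv w \<otimes> a \<otimes> w"
  have b: "b \<in> A" using w a by (simp add: b_def NA_def)
  have a': "a = w \<otimes> b \<otimes> inv w" using c A_closed[OF a] by (simp add: b_def m_assoc)
  have "w \<otimes> m \<otimes> inv w \<otimes> a = w \<otimes> (m \<otimes> b) \<otimes> inv w"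
    unfolding a' using c A_closed[OF b] by (simp add: m_assoc)
  also have "m \<otimes> b = b \<otimes> m" using M_A_commute m b by simp
  also have "w \<otimes> (b \<otimes> m) \<otimes> inv w = a \<otimes> (w \<otimes> m \<otimes> inv w)"
    unfolding a' using c A_closed[OF b] by (simp add: m_assoc)
  finally show "w \<otimes> m \<otimes> inv w \<otimes> a = a \<otimes> (w \<otimes> m \<otimes> inv w)" .
qed

lemma w0_conj_M: "m \<in> M \<Longrightarrow> inv w0 \<otimes> m \<otimes> w0 \<in> M"
  using T_conj_M[OF subgroup.m_inv_closed[OF K_sub T_K[OF w0_T]] NA_inv[OF T_NA[OF w0_T]]] by simp

text \<open>Inverting \<open>A\<close> twice does nothing. Hence \<open>w0\<close> and
  \<open>inv w0\<close> agree up to \<open>M\<close>, which brings a point opposite to the second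
  point of a pair into the cell.\<close>

lemma w0_square: "w0 \<otimes> w0 \<in> M"
proof (rule MI)
  show "w0 \<otimes> w0 \<in> K" using T_K[OF w0_T] subgroup.m_closed[OF K_sub] by blast
  fix a assume a: "a \<in> A"
  have "w0 \<otimes> a = w0 \<otimes> a \<otimes> inv w0 \<otimes> w0" using A_closed[OF a] by (simp add: m_assoc)
  then have 1: "w0 \<otimes> a = inv a \<otimes> w0" using w0_A(1)[OF a] by simp
  have "w0 \<otimes> inv a = w0 \<otimes> inv a \<otimes> inv w0 \<otimes> w0" using A_closed[OF a] by (simp add: m_assoc)
  then have 2: "w0 \<otimes> inv a = a \<otimes> w0" using w0_A(1)[OF A_inv[OF a]] A_closed[OF a] by simp
  have "w0 \<otimes> w0 \<otimes> a = w0 \<otimes> inv a \<otimes> w0" using A_closed[OF a] 1 by (simp add: m_assoc)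
  then show "w0 \<otimes> w0 \<otimes> a = a \<otimes> (w0 \<otimes> w0)" using A_closed[OF a] 2 by (simp add: m_assoc)
qed

lemma w0_conj_L:
  assumes "m \<in> M" "a \<in> A"
  shows "inv w0 \<otimes> (m \<otimes> a) \<otimes> w0 = (inv w0 \<otimes> m \<otimes> w0) \<otimes> inv a"
proof -
  have "inv w0 \<otimes> (m \<otimes> a) \<otimes> w0 = (inv w0 \<otimes> m \<otimes> w0) \<otimes> (inv w0 \<otimes> a \<otimes> w0)"
    using assms M_closed A_closed by (simp add: m_assoc)
  then show ?thesis by (simp only: w0_A(2)[OF assms(2)])
qed

lemma opposite_iff: "opposite G P w0 x y \<longleftrightarrow> (\<exists>g\<in>carrier G. x = g <# P \<and> y = (g \<otimes> w0) <# P)"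
  unfolding opposite_def by (auto simp: lcos_mult[OF subgroup_P])

lemma cell_left_L:
  assumes "l \<in> L" "g \<in> cell"
  shows "l \<otimes> g \<in> cell" "\<nu> (l \<otimes> g) = l \<otimes> \<nu> g \<otimes> inv l"
proof -
  obtain n p where g: "n \<in> Nm" "p \<in> P" "g = n \<otimes> p" using assms by (auto simp: cell_def)
  have c: "l \<in> carrier G" "n \<in> carrier G" "p \<in> carrier G" using assms g L_closed N_closed P_closed by auto
  have e: "l \<otimes> g = (l \<otimes> n \<otimes> inv l) \<otimes> (l \<otimes> p)" using c g by (simp add: m_assoc)
  have in': "l \<otimes> n \<otimes> inv l \<in> Nm" "l \<otimes> p \<in> P"
    using conj_L_horo[OF assms(1) mH0 g(1)] P_mult[OF L_P[OF assms(1)] g(2)] by auto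
  show "l \<otimes> g \<in> cell" "\<nu> (l \<otimes> g) = l \<otimes> \<nu> g \<otimes> inv l"
    unfolding e using in' g \<nu>_eq cellI by auto
qed

lemma cell_closed: "g \<in> cell \<Longrightarrow> g \<in> carrier G"
  using N_closed P_closed by (auto simp: cell_def)

lemma \<nu>_Nm: "g \<in> cell \<Longrightarrow> \<nu> g \<in> Nm"
  using \<nu>_eq by (auto simp: cell_def)

lemma \<nu>_P: "g \<in> cell \<Longrightarrow> inv (\<nu> g) \<otimes> g \<in> P"
  using \<nu>_eq N_closed P_closed by (auto simp: cell_def)

text \<open>Seen from \<open>g\<close>, the opposite point is represented by \<open>n l w0 q\<close>
  with \<open>n\<close> in \<open>Np\<close> and \<open>l\<close> in \<open>L\<close>; conjugation
  by \<open>inv w0\<close> sends \<open>n\<close> into \<open>Nm\<close> and keeps \<open>l\<close>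
  in \<open>L\<close>.\<close>

lemma opposite_cell:
  assumes g: "g \<in> carrier G" "z \<in> carrier G" and o: "opposite G P w0 (g <# P) (z <# P)"
  shows "inv w0 \<otimes> (inv g \<otimes> z) \<in> cell"
proof -
  obtain h where h: "h \<in> carrier G" "g <# P = h <# P" "z <# P = (h \<otimes> w0) <# P"
    using o opposite_iff by auto
  have "inv g \<otimes> h \<in> P" using h g lcos_eq[OF subgroup_P] by blast
  then obtain n l where n: "n \<in> Np" "l \<in> L" "inv g \<otimes> h = n \<otimes> l" by (rule P_decomp')
  define q where "q = inv (h \<otimes> w0) \<otimes> z"
  have q: "q \<in> P" unfolding q_def using h g lcos_eq[OF subgroup_P] by (metis m_closed w0_closed)
  obtain m a where l: "m \<in> M" "a \<in> A" "l = m \<otimes> a" using n by (auto simp: L_def)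
  have cl: "n \<in> carrier G" "l \<in> carrier G" "q \<in> carrier G" using n L_closed N_closed P_closed q by auto
  have z: "z = h \<otimes> w0 \<otimes> q" using g h by (simp add: q_def inv_mult_group m_assoc)
  have "inv w0 \<otimes> (inv g \<otimes> z) = inv w0 \<otimes> ((inv g \<otimes> h) \<otimes> (w0 \<otimes> q))"
    unfolding z using g h cl by (simp add: m_assoc)
  also have "\<dots> = (inv w0 \<otimes> n \<otimes> w0) \<otimes> ((inv w0 \<otimes> l \<otimes> w0) \<otimes> q)"
    unfolding n(3) using cl by (simp add: m_assoc)
  finally have e: "inv w0 \<otimes> (inv g \<otimes> z) = (inv w0 \<otimes> n \<otimes> w0) \<otimes> ((inv w0 \<otimes> l \<otimes> w0) \<otimes> q)" .
  have "inv w0 \<otimes> l \<otimes> w0 \<in> L"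
    unfolding l(3) w0_conj_L[OF l(1,2)] using w0_conj_M[OF l(1)] A_inv[OF l(2)] by (rule LI)
  then show ?thesis unfolding e using w0_Np(1)[OF n(1)] P_mult[OF L_P q] by (intro cellI)
qed

lemma opposite_cell':
  assumes g: "g \<in> carrier G" "z \<in> carrier G" and o: "opposite G P w0 ((g \<otimes> w0) <# P) (z <# P)"
  shows "inv g \<otimes> z \<in> cell"
proof -
  have "inv w0 \<otimes> (inv (g \<otimes> w0) \<otimes> z) \<in> cell" using g o by (intro opposite_cell) auto
  then have "(w0 \<otimes> w0) \<otimes> (inv w0 \<otimes> (inv (g \<otimes> w0) \<otimes> z)) \<in> cell"
    using cell_left_L(1) M_L[OF w0_square] by blast
  then show ?thesis using g by (simp add: m_assoc inv_mult_group)
qed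

text \<open>\<open>w0 \<otimes> \<nu> (inv w0 \<otimes> \<xi>)\<close> is the representative
  \<open>n w0\<close> of the coset of \<open>\<xi>\<close>, with \<open>n = w0 \<nu> inv w0\<close>
  in \<open>Np\<close>. It ignores right factors from \<open>P\<close>, which would change
  \<open>\<alpha> \<xi>\<close>.\<close>

definition \<beta> :: "'a \<Rightarrow> 'a" where "\<beta> \<xi> = \<sigma> (w0 \<otimes> \<nu> (inv w0 \<otimes> \<xi>))"

text \<open>Membership in the cell expresses opposition of the coset of \<open>\<xi>\<close> to
  \<open>w0 P\<close>, membership of \<open>inv w0 \<otimes> \<xi>\<close> its opposition to
  \<open>P\<close>.\<close>

definition adm :: "'a set" where "adm = {\<xi> \<in> cell. inv w0 \<otimes> \<xi> \<in> cell}"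

lemma adm_closed: "\<xi> \<in> adm \<Longrightarrow> \<xi> \<in> carrier G"
  using cell_closed by (auto simp: adm_def)

lemma adm_cell: 
  assumes "\<xi> \<in> adm"
  shows "w0 \<otimes> \<nu> (inv w0 \<otimes> \<xi>) \<in> cell"
proof -
  let ?n = "\<nu> (inv w0 \<otimes> \<xi>)"
  have c: "inv w0 \<otimes> \<xi> \<in> cell" using assms by (simp add: adm_def)
  define p where "p = inv ?n \<otimes> (inv w0 \<otimes> \<xi>)"
  have p: "p \<in> P" unfolding p_def by (rule \<nu>_P[OF c])
  have n: "?n \<in> carrier G" using N_closed \<nu>_Nm[OF c] by blast
  have "w0 \<otimes> ?n = \<xi> \<otimes> inv p"
    using n adm_closed[OF assms] by (simp add: p_def inv_mult_group m_assoc)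
  then show ?thesis using cell_right(1)[OF _ P_inv[OF p]] assms by (simp add: adm_def)
qed

lemma \<sigma>_A: "g \<in> cell \<Longrightarrow> \<sigma> g \<in> A"
  using \<alpha>_mult(3)[of g \<one> \<one> \<one> \<one>] subgroup.one_closed[OF subgroup_horo] one_A subgroup.one_closed[OF subgroup_M] sqrtA_closed
  by (simp add: \<sigma>_def)

lemma \<beta>_A: "\<xi> \<in> adm \<Longrightarrow> \<beta> \<xi> \<in> A"
  unfolding \<beta>_def by (intro \<sigma>_A adm_cell)

lemma \<beta>_right:
  assumes "\<xi> \<in> adm" "p \<in> P"
  shows "\<beta> (\<xi> \<otimes> p) = \<beta> \<xi>"
proof -
  have "inv w0 \<otimes> (\<xi> \<otimes> p) = inv w0 \<otimes> \<xi> \<otimes> p" using adm_closed[OF assms(1)] P_closed[OF assms(2)] by (simp add: m_assoc)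
  then show ?thesis using cell_right(2)[OF _ assms(2)] assms(1) by (simp add: \<beta>_def adm_def)
qed

text \<open>With \<open>l = m a\<close> and \<open>l' = inv w0 l w0 = m' inv a\<close>, the
  canonical representative \<open>y\<close> becomes \<open>l y inv l'\<close>. One factor
  \<open>a\<close> comes from \<open>l\<close>, a second one from \<open>inv l' = inv m' a\<close>,
  and the square root halves the two.\<close>

lemma \<beta>_left:
  assumes \<xi>: "\<xi> \<in> adm" and ma: "m \<in> M" "a \<in> A"
  shows "\<beta> (m \<otimes> a \<otimes> \<xi>) = a \<otimes> \<beta> \<xi>"
proof -
  let ?l = "m \<otimes> a"
  define m' where "m' = inv w0 \<otimes> m \<otimes> w0"
  define l' where "l' = m' \<otimes> inv a"
  define y where "y = w0 \<otimes> \<nu> (inv w0 \<otimes> \<xi>)"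
  have m': "m' \<in> M" unfolding m'_def by (rule w0_conj_M[OF ma(1)])
  have l: "?l \<in> L" "l' \<in> L" using ma m' A_inv by (auto intro!: LI simp: l'_def)
  have cl: "m \<in> carrier G" "a \<in> carrier G" "m' \<in> carrier G" "l' \<in> carrier G" "\<xi> \<in> carrier G"
    using ma m' l M_closed A_closed L_closed adm_closed[OF \<xi>] by auto
  have c: "inv w0 \<otimes> \<xi> \<in> cell" using \<xi> by (simp add: adm_def)
  have \<nu>c: "\<nu> (inv w0 \<otimes> \<xi>) \<in> carrier G" using \<nu>_Nm[OF c] N_closed by blast
  have y: "y \<in> cell" "y \<in> carrier G" using adm_cell[OF \<xi>] cell_closed by (auto simp: y_def)
  have ll: "inv w0 \<otimes> ?l \<otimes> w0 = l'" unfolding l'_def m'_def by (rule w0_conj_L[OF ma])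
  then have ll2: "w0 \<otimes> l' = ?l \<otimes> w0" using cl by (simp flip: ll add: m_assoc)
  have "inv w0 \<otimes> (?l \<otimes> \<xi>) = l' \<otimes> (inv w0 \<otimes> \<xi>)" using cl by (simp flip: ll add: m_assoc)
  then have "\<nu> (inv w0 \<otimes> (?l \<otimes> \<xi>)) = l' \<otimes> \<nu> (inv w0 \<otimes> \<xi>) \<otimes> inv l'"
    using cell_left_L(2)[OF l(2) c] by simp
  then have "w0 \<otimes> \<nu> (inv w0 \<otimes> (?l \<otimes> \<xi>)) = (w0 \<otimes> l') \<otimes> \<nu> (inv w0 \<otimes> \<xi>) \<otimes> inv l'"
    using cl \<nu>c by (simp add: m_assoc)
  also have "\<dots> = ?l \<otimes> y \<otimes> inv l'" unfolding ll2 using cl \<nu>c by (simp add: y_def m_assoc)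
  also have "inv l' = inv m' \<otimes> a \<otimes> \<one>"
    using cl M_A_commute[OF subgroup.m_inv_closed[OF subgroup_M m'] ma(2)] by (simp add: l'_def inv_mult_group)
  finally have e: "w0 \<otimes> \<nu> (inv w0 \<otimes> (?l \<otimes> \<xi>)) = ?l \<otimes> y \<otimes> (inv m' \<otimes> a \<otimes> \<one>)" .
  have ly: "?l \<otimes> y \<in> cell" by (rule cell_left_L(1)[OF l(1) y(1)])
  note ones = subgroup.one_closed[OF subgroup_horo]
  have a1: "\<alpha> (\<one> \<otimes> (?l \<otimes> y) \<otimes> (inv m' \<otimes> a \<otimes> \<one>)) = \<alpha> (?l \<otimes> y) \<otimes> a"
    by (rule \<alpha>_mult(2)[OF ly ones subgroup.m_inv_closed[OF subgroup_M m'] ma(2) ones])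
  \<comment> \<open>\<open>\<alpha>_mult\<close> covers left factors from \<open>Nm\<close>; a left
    factor from \<open>L\<close> is pushed through \<open>Nm\<close> by conjugation.\<close>
  have a2: "\<alpha> (?l \<otimes> y) = a \<otimes> \<alpha> y" "\<alpha> y \<in> A"
  proof -
    obtain n0 p0 where "n0 \<in> Nm" "p0 \<in> P" "y = n0 \<otimes> p0" using y by (auto simp: cell_def)
    then obtain m0 a0 n1 where h: "n0 \<in> Nm" "m0 \<in> M" "a0 \<in> A" "n1 \<in> Np" "y = n0 \<otimes> (m0 \<otimes> a0 \<otimes> n1)"
      using P_obtain by metis
    have c0: "n0 \<in> carrier G" "m0 \<in> carrier G" "a0 \<in> carrier G" "n1 \<in> carrier G"
      using h N_closed M_closed A_closed by auto
    have "?l \<otimes> y = (?l \<otimes> n0 \<otimes> inv ?l) \<otimes> (m \<otimes> (a \<otimes> m0) \<otimes> a0 \<otimes> n1)"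
      unfolding h(5) using cl c0 by (simp add: m_assoc inv_mult_group)
    also have "a \<otimes> m0 = m0 \<otimes> a" using M_A_commute[OF h(2) ma(2)] by simp
    finally have e: "?l \<otimes> y = (?l \<otimes> n0 \<otimes> inv ?l) \<otimes> ((m \<otimes> m0) \<otimes> (a \<otimes> a0) \<otimes> n1)"
      using cl c0 by (simp add: m_assoc)
    show "\<alpha> (?l \<otimes> y) = a \<otimes> \<alpha> y"
      unfolding e using \<alpha>_eq[OF conj_L_horo[OF l(1) mH0 h(1)] subgroup.m_closed[OF subgroup_M ma(1) h(2)] A_mult[OF ma(2) h(3)] h(4)]
        \<alpha>_eq[OF h(1-4)] h(5) by simp
    show "\<alpha> y \<in> A" using \<alpha>_eq[OF h(1-4)] h by simp
  qed
  have "\<alpha> (w0 \<otimes> \<nu> (inv w0 \<otimes> (?l \<otimes> \<xi>))) = a \<otimes> \<alpha> y \<otimes> a"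
    unfolding e using a1 a2 cl y by (simp add: m_assoc)
  also have "\<dots> = a \<otimes> (\<alpha> y \<otimes> a)" using cl A_closed[OF a2(2)] by (simp add: m_assoc)
  also have "\<alpha> y \<otimes> a = a \<otimes> \<alpha> y" by (rule A_commute[OF a2(2) ma(2)])
  also have "a \<otimes> (a \<otimes> \<alpha> y) = (a \<otimes> a) \<otimes> \<alpha> y" using cl A_closed[OF a2(2)] by (simp add: m_assoc)
  finally show ?thesis
    unfolding \<beta>_def \<sigma>_def using sqrtA_mult[OF A_mult[OF ma(2) ma(2)] a2(2)] sqrtA_square[OF ma(2)] by (simp add: y_def)
qed

end

section \<open>Coset spaces\<close>

context lie_group
begin

lemma topspace_coset_space: "topspace (coset_space G H) = (\<lambda>g. g <# H) ` carrier G"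
proof
  show "topspace (coset_space G H) \<subseteq> (\<lambda>g. g <# H) ` carrier G"
    using openin_topspace[of "coset_space G H"] unfolding coset_space_def openin_quotient_topology
    by (simp add: topspace_gtop)
  have "{x \<in> topspace (gtop G). x <# H \<in> (\<lambda>g. g <# H) ` carrier G} = topspace (gtop G)"
    by (auto simp: topspace_gtop)
  then have "openin (coset_space G H) ((\<lambda>g. g <# H) ` carrier G)"
    unfolding coset_space_def openin_quotient_topology
    using openin_topspace[of "gtop G"] by (simp add: topspace_gtop)
  then show "(\<lambda>g. g <# H) ` carrier G \<subseteq> topspace (coset_space G H)" by (rule openin_subset)
qed

lemma openin_coset_space:
  "openin (coset_space G H) V \<Longrightarrow> openin (gtop G) {g \<in> carrier G. g <# H \<in> V}"
  unfolding coset_space_def openin_quotient_topology by (simp add: topspace_gtop)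

text \<open>The full preimage of the image is the union of the right translates of \<open>Q\<close>
  by \<open>H\<close>. Openness of the projection allows continuity to be checked on
  representatives.\<close>

lemma open_coset_image:
  assumes H: "subgroup H G" and Q: "openin (gtop G) Q"
  shows "openin (coset_space G H) ((\<lambda>g. g <# H) ` Q)"
proof -
  have QG: "Q \<subseteq> carrier G" using openin_subset[OF Q] topspace_gtop by simp
  have "{x \<in> carrier G. x <# H \<in> (\<lambda>g. g <# H) ` Q} = (\<Union>h\<in>H. {x \<in> carrier G. \<one> \<otimes> x \<otimes> h \<in> Q})"
  proof safe
    fix x g assume x: "x \<in> carrier G" and g: "g \<in> Q" and eq: "x <# H = g <# H"
    have "inv x \<otimes> g \<in> H" using lcos_eq[OF H x] eq g QG by blast
    moreover have "\<one> \<otimes> x \<otimes> (inv x \<otimes> g) \<in> Q" using x g QG by auto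
    ultimately show "x \<in> (\<Union>h\<in>H. {x \<in> carrier G. \<one> \<otimes> x \<otimes> h \<in> Q})" using x by blast
  next
    fix x h assume x: "x \<in> carrier G" and h: "h \<in> H" and q: "\<one> \<otimes> x \<otimes> h \<in> Q"
    have hc: "h \<in> carrier G" using h H subgroup.mem_carrier by metis
    have "inv x \<otimes> (\<one> \<otimes> x \<otimes> h) \<in> H" using x h hc by simp
    then have "x <# H = (\<one> \<otimes> x \<otimes> h) <# H" using lcos_eq[OF H x] q QG by blast
    then show "x <# H \<in> (\<lambda>g. g <# H) ` Q" using q by blast
  qed
  moreover have "openin (gtop G) (\<Union>h\<in>H. {x \<in> carrier G. \<one> \<otimes> x \<otimes> h \<in> Q})"
    using Q subgroup.mem_carrier[OF H] by (intro openin_Union) (auto intro!: openin_translate)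
  ultimately show ?thesis
    unfolding coset_space_def openin_quotient_topology using QG by (auto simp: topspace_gtop)
qed

end

section \<open>Uniqueness of the flat through two opposite points\<close>

context flag_setup
begin

lemma NA_bracket:
  assumes v: "v \<in> NA"
  shows "bracket G H0 (Ad G v H0) = 0"
proof (rule bracket_zeroI, rule Ad_fixed)
  fix t s
  have "lie_exp G (s *\<^sub>R Ad G v H0) = v \<otimes> lie_exp G (s *\<^sub>R H0) \<otimes> inv v"
    using conj_lie_exp[OF NA_closed[OF v], of "s *\<^sub>R H0"] linear_scale[OF linear_Ad[OF NA_closed[OF v]]] by simp
  then have "lie_exp G (s *\<^sub>R Ad G v H0) \<in> A"
    using v lie_exp_A[OF H0] by (simp add: NA_def)
  then show "lie_exp G (t *\<^sub>R H0) \<otimes> lie_exp G (s *\<^sub>R Ad G v H0) = lie_exp G (s *\<^sub>R Ad G v H0) \<otimes> lie_exp G (t *\<^sub>R H0)"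
    using A_commute lie_exp_A[OF H0] by blast
qed simp

text \<open>This replaces the Bruhat decomposition: conjugating the equation with \<open>exp(-tH\<^sub>0)\<close> and letting
  \<open>t \<rightarrow> \<infinity>\<close> shows that \<open>v\<^sup>-\<^sup>1w\<^sub>0\<close> fixes \<open>H\<^sub>0\<close>, which is then also true of \<open>w\<^sub>0\<^sup>-\<^sup>1nw\<^sub>0 \<in> N\<^sup>-\<close>.\<close>

lemma normalizer_translate:
  assumes n: "n \<in> Np" and q: "q \<in> P" and v: "v \<in> NA" and eq: "n \<otimes> v = w0 \<otimes> q"
  shows "n = \<one>"
proof -
  have c: "n \<in> carrier G" "q \<in> carrier G" "v \<in> carrier G"
    using n q v N_closed P_closed NA_closed by auto
  define Y where "Y = Ad G (inv v) (- H0)"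
  note linv = linear_Ad[OF inv_closed[OF c(3)]]
  let ?e = "\<lambda>t. lie_exp G (- (t *\<^sub>R H0))"
  let ?n = "\<lambda>t. ?e t \<otimes> inv n \<otimes> inv ?e t"
  \<comment> \<open>Conjugated by the flow, the equation keeps its shape:
    \<open>v = ?n t \<otimes> w0 \<otimes> q'\<close> with \<open>q'\<close> in \<open>P\<close>,
    and elements of \<open>P\<close> move \<open>H0\<close> by contracted vectors.\<close>
  have mem: "Ad G (inv v) (Ad G (?n t) (- H0)) - H0 \<in> contr H0" for t
  proof -
    have eA: "?e t \<in> A" using lie_exp_A[OF H0, of "- t"] by simp
    define b where "b = inv v \<otimes> ?e t \<otimes> v"
    have b: "b \<in> A" using v eA by (simp add: b_def NA_def)
    have bc: "b \<in> carrier G" and ec: "?e t \<in> carrier G" using b A_closed by auto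
    \<comment> \<open>\<open>v\<close> carries the flow element to \<open>b\<close> in
      \<open>A\<close>, and \<open>w0\<close> carries it to its inverse; both are absorbed into
      \<open>q\<close>, which stays in \<open>P\<close>.\<close>
    define q' where "q' = inv (?e t) \<otimes> q \<otimes> inv b"
    have q': "q' \<in> P" unfolding q'_def by (intro P_mult q L_P A_L A_inv eA b)
    have q'c: "q' \<in> carrier G" using P_closed[OF q'] .
    have ew: "?e t \<otimes> w0 = w0 \<otimes> inv (?e t)"
    proof -
      have "?e t \<otimes> w0 = w0 \<otimes> (inv w0 \<otimes> ?e t \<otimes> w0)" by (simp add: m_assoc)
      then show ?thesis using w0_A(2)[OF eA] by simp
    qed
    have "inv n \<otimes> (n \<otimes> v) = v" using c by simp
    then have "v = inv n \<otimes> w0 \<otimes> q" unfolding eq using c by (simp add: m_assoc)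
    then have "?e t \<otimes> v = ?e t \<otimes> inv n \<otimes> w0 \<otimes> q" using c by (simp add: m_assoc)
    also have "\<dots> = ?n t \<otimes> (?e t \<otimes> w0) \<otimes> q" using c by (simp add: m_assoc)
    also have "\<dots> = ?n t \<otimes> w0 \<otimes> q' \<otimes> b" unfolding ew using c bc by (simp add: q'_def m_assoc)
    finally have "v \<otimes> b = ?n t \<otimes> w0 \<otimes> q' \<otimes> b" using c by (simp add: b_def m_assoc)
    then have "v = ?n t \<otimes> w0 \<otimes> q'" using c bc q'c by simp
    then have "inv v \<otimes> ?n t \<otimes> w0 = inv q'" using c q'c by (simp add: inv_mult_group m_assoc)
    then have "Ad G (inv v) (Ad G (?n t) (Ad G w0 H0)) = Ad G (inv q') H0"
      using c by (simp flip: Ad_mult add: m_assoc)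
    then show ?thesis using Ad_P[OF P_inv[OF q']] w0_a[OF H0] by simp
  qed
  have "((\<lambda>t. Ad G (?n t) (- H0)) \<longlongrightarrow> Ad G \<one> (- H0)) at_top"
    by (intro lim_Ad horo_lim horo_inv n)
  then have "((\<lambda>t. Ad G (inv v) (Ad G (?n t) (- H0)) - H0) \<longlongrightarrow> Y - H0) at_top"
    unfolding Y_def using c
    by (intro tendsto_diff tendsto_const bounded_linear.tendsto[OF bounded_linear_Ad]) (auto simp: Ad_one)
  moreover have "closed (contr H0)" by (rule closed_subspace[OF subspace_contr])
  ultimately have Yc: "Y - H0 \<in> contr H0"
    using mem by (intro Lim_in_closed_set[of _ _ at_top]) auto
  \<comment> \<open>\<open>v\<close> normalizes \<open>A\<close>, so \<open>Y\<close> commutes with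
    \<open>H0\<close>; a contracted vector that commutes with \<open>H0\<close> is 0.\<close>
  have "bracket G H0 (Y - H0) = 0"
    using NA_bracket[OF NA_inv[OF v]] by (simp add: Y_def linear_neg[OF linv])
  from contr_zero[OF this Yc] have Y: "Y = H0" by simp
  define u where "u = inv v \<otimes> w0"
  have u: "Ad G u H0 = H0" using c Y w0_a[OF H0] by (simp add: u_def Ad_mult Y_def)
  have "inv w0 \<otimes> n \<otimes> w0 = q \<otimes> u"
  proof -
    have "inv w0 \<otimes> n \<otimes> w0 = inv w0 \<otimes> (n \<otimes> v) \<otimes> inv v \<otimes> w0" using c by (simp add: m_assoc)
    then show ?thesis unfolding eq u_def using c by (simp add: m_assoc)
  qed
  moreover have "Ad G (q \<otimes> u) H0 - H0 \<in> contr H0"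
    using c u Ad_P[OF q] by (simp add: Ad_mult u_def)
  ultimately have "inv w0 \<otimes> n \<otimes> w0 = \<one>" using Nm_trivial[OF w0_Np(1)[OF n]] by simp
  then have "w0 \<otimes> (inv w0 \<otimes> n \<otimes> w0) \<otimes> inv w0 = \<one>" by simp
  then show ?thesis using c by (simp add: m_assoc)
qed

lemma translate_flat: "g \<in> carrier G \<Longrightarrow> translate G g (std_flat G K A) = {(g \<otimes> a) <# K |a. a \<in> A}"
  unfolding translate_def std_flat_def using A_closed by (force simp: lcos_mult[OF K_sub])

text \<open>The \<open>A\<close>-part of \<open>l\<close> shifts the flat along itself; the
  \<open>M\<close>-part commutes past \<open>A\<close> and is absorbed by \<open>K\<close>.\<close>

lemma L_translate_flat:
  assumes g: "g \<in> carrier G" and l: "l \<in> L"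
  shows "translate G (g \<otimes> l) (std_flat G K A) = translate G g (std_flat G K A)"
proof -
  obtain m b where mb: "m \<in> M" "b \<in> A" "l = m \<otimes> b" using l by (auto simp: L_def)
  have c: "m \<in> carrier G" "b \<in> carrier G" "l \<in> carrier G" using mb M_closed A_closed by auto
  have e: "(g \<otimes> l \<otimes> a) <# K = (g \<otimes> (b \<otimes> a)) <# K" if a: "a \<in> A" for a
  proof -
    have ac: "a \<in> carrier G" using A_closed a .
    have ba: "b \<otimes> a \<in> A" using A_mult[OF mb(2) a] .
    have "g \<otimes> l \<otimes> a = g \<otimes> (m \<otimes> (b \<otimes> a))" using g c ac by (simp add: mb(3) m_assoc)
    also have "m \<otimes> (b \<otimes> a) = b \<otimes> a \<otimes> m" by (rule M_A_commute[OF mb(1) ba])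
    finally have e1: "g \<otimes> l \<otimes> a = g \<otimes> (b \<otimes> a) \<otimes> m" using g c ac by (simp add: m_assoc)
    have "inv (g \<otimes> (b \<otimes> a)) \<otimes> (g \<otimes> (b \<otimes> a) \<otimes> m) = m" using g c ac by (simp add: m_assoc inv_mult_group)
    then have "(g \<otimes> (b \<otimes> a)) <# K = (g \<otimes> (b \<otimes> a) \<otimes> m) <# K"
      using lcos_eq[OF K_sub] M_K[OF mb(1)] g c ac by simp
    then show ?thesis unfolding e1 by simp
  qed
  show ?thesis
    unfolding translate_flat[OF g] translate_flat[OF m_closed[OF g c(3)]]
  proof safe
    fix a assume a: "a \<in> A"
    show "\<exists>a'. g \<otimes> l \<otimes> a <# K = g \<otimes> a' <# K \<and> a' \<in> A" using e[OF a] A_mult[OF mb(2) a] by blast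
    have "inv b \<otimes> a \<in> A" using A_mult[OF A_inv[OF mb(2)] a] .
    then show "\<exists>a'. g \<otimes> a <# K = g \<otimes> l \<otimes> a' <# K \<and> a' \<in> A"
      using e[of "inv b \<otimes> a"] c A_closed[OF a] by (intro exI[of _ "inv b \<otimes> a"]) simp
  qed
qed

lemma T_translate_flat:
  assumes g: "g \<in> carrier G" and w: "w \<in> TT"
  shows "translate G (g \<otimes> w) (std_flat G K A) = translate G g (std_flat G K A)"
proof -
  have wc: "w \<in> carrier G" using T_closed[OF w] .
  have e: "(g \<otimes> w \<otimes> a) <# K = (g \<otimes> (w \<otimes> a \<otimes> inv w)) <# K" if a: "a \<in> A" for a
  proof -
    have ac: "a \<in> carrier G" using A_closed a .
    have "inv (g \<otimes> (w \<otimes> a \<otimes> inv w)) \<otimes> (g \<otimes> w \<otimes> a) = w" using g wc ac by (simp add: m_assoc inv_mult_group)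
    then have "(g \<otimes> (w \<otimes> a \<otimes> inv w)) <# K = (g \<otimes> w \<otimes> a) <# K"
      using lcos_eq[OF K_sub] T_K[OF w] g wc ac by simp
    then show ?thesis by simp
  qed
  have NA: "w \<otimes> a \<otimes> inv w \<in> A" "inv w \<otimes> a \<otimes> w \<in> A" if "a \<in> A" for a
    using T_NA[OF w] that by (auto simp: NA_def)
  show ?thesis
    unfolding translate_flat[OF g] translate_flat[OF m_closed[OF g wc]]
  proof safe
    fix a assume a: "a \<in> A"
    show "\<exists>a'. g \<otimes> w \<otimes> a <# K = g \<otimes> a' <# K \<and> a' \<in> A" using e[OF a] NA(1)[OF a] by blast
    have "w \<otimes> (inv w \<otimes> a \<otimes> w) \<otimes> inv w = a" using wc A_closed[OF a] by (simp add: m_assoc)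
    then show "\<exists>a'. g \<otimes> a <# K = g \<otimes> w \<otimes> a' <# K \<and> a' \<in> A"
      using e[OF NA(2)[OF a]] NA(2)[OF a] by (intro exI[of _ "inv w \<otimes> a \<otimes> w"]) simp
  qed
qed

lemma translate_boundary:
  "g \<in> carrier G \<Longrightarrow> translate G g (std_flat_boundary G K A P) = {(g \<otimes> w) <# P |w. w \<in> TT}"
  unfolding translate_def std_flat_boundary_def using T_closed by (force simp: lcos_mult[OF subgroup_P])

text \<open>The two boundary conditions combine into \<open>n \<otimes> v = w0 \<otimes> q\<close>
  with \<open>v\<close> in \<open>NA\<close>. Once \<open>n = \<one>\<close>, they say that
  \<open>g w = g0 l\<close>, and neither \<open>w\<close> nor \<open>l\<close> changes a
  flat.\<close>

lemma flat_unique: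
  assumes g: "g0 \<in> carrier G" "g \<in> carrier G"
    and x: "g0 <# P \<in> translate G g (std_flat_boundary G K A P)"
    and y: "(g0 \<otimes> w0) <# P \<in> translate G g (std_flat_boundary G K A P)"
  shows "translate G g (std_flat G K A) = translate G g0 (std_flat G K A)"
proof -
  obtain w w' where w: "w \<in> TT" "w' \<in> TT" "g0 <# P = (g \<otimes> w) <# P" "(g0 \<otimes> w0) <# P = (g \<otimes> w') <# P"
    using x y translate_boundary[OF g(2)] by auto
  have c: "w \<in> carrier G" "w' \<in> carrier G" using w T_closed by auto
  have "inv g0 \<otimes> (g \<otimes> w) \<in> P" using lcos_eq[OF subgroup_P] w(3) g c by simp
  then obtain n l where n: "n \<in> Np" "l \<in> L" "inv g0 \<otimes> (g \<otimes> w) = n \<otimes> l" by (rule P_decomp')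
  define q where "q = inv (g0 \<otimes> w0) \<otimes> (g \<otimes> w')"
  have q: "q \<in> P" unfolding q_def using lcos_eq[OF subgroup_P] w(4) g c by simp
  define v where "v = l \<otimes> (inv w \<otimes> w')"
  have v: "v \<in> NA" unfolding v_def by (intro NA_mult NA_inv L_NA T_NA n w)
  have cn: "n \<in> carrier G" "l \<in> carrier G" using n N_closed L_closed by auto
  have "n \<otimes> v = (n \<otimes> l) \<otimes> (inv w \<otimes> w')" using c cn by (simp add: v_def m_assoc)
  also have "\<dots> = inv g0 \<otimes> (g \<otimes> w')" unfolding n(3)[symmetric] using g c by (simp add: m_assoc)
  also have "\<dots> = w0 \<otimes> q" using g c by (simp add: q_def m_assoc inv_mult_group)
  finally have "n = \<one>" by (rule normalizer_translate[OF n(1) q v])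
  then have "inv g0 \<otimes> (g \<otimes> w) = l" using n(3) cn by simp
  then have "g \<otimes> w = g0 \<otimes> l" using g c by (metis cancel_left(2) m_closed)
  then show ?thesis
    using T_translate_flat[OF g(2) w(1)] L_translate_flat[OF g(1) n(2)] by simp
qed

lemma flat_through_eq:
  assumes g: "g \<in> carrier G"
  shows "flat_through G K A P (g <# P) ((g \<otimes> w0) <# P) = translate G g (std_flat G K A)"
  unfolding flat_through_def
proof (rule the_equality)
  have "\<one> \<in> TT"
    using A_closed subgroup.one_closed[OF K_sub] by (auto simp: normalizer_in_def image_iff)
  then have "g <# P \<in> translate G g (std_flat_boundary G K A P)"
    "(g \<otimes> w0) <# P \<in> translate G g (std_flat_boundary G K A P)"
    using w0_T g unfolding translate_boundary[OF g] by force+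
  then show "\<exists>B. maximal_flat_with_boundary G K A P (translate G g (std_flat G K A)) B \<and>
      g <# P \<in> B \<and> (g \<otimes> w0) <# P \<in> B"
    using g by (auto simp: maximal_flat_with_boundary_def)
  fix F assume "\<exists>B. maximal_flat_with_boundary G K A P F B \<and> g <# P \<in> B \<and> (g \<otimes> w0) <# P \<in> B"
  then show "F = translate G g (std_flat G K A)"
    unfolding maximal_flat_with_boundary_def using flat_unique[OF g] by blast
qed

section \<open>The map, its equivariance and the flat through its value\<close>

lemma adm_right:
  assumes "\<xi> \<in> adm" "p \<in> P"
  shows "\<xi> \<otimes> p \<in> adm"
proof -
  have "inv w0 \<otimes> (\<xi> \<otimes> p) = (inv w0 \<otimes> \<xi>) \<otimes> p"
    using adm_closed[OF assms(1)] P_closed[OF assms(2)] by (simp add: m_assoc)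
  then show ?thesis using assms cell_right(1) by (simp add: adm_def)
qed

definition Rel :: "'a set \<times> 'a set \<times> 'a set \<Rightarrow> 'a set \<Rightarrow> bool" where
  "Rel t c \<longleftrightarrow> (\<exists>g\<in>carrier G. \<exists>\<zeta>\<in>carrier G.
     t = (g <# P, (g \<otimes> w0) <# P, \<zeta> <# P) \<and> c = (g \<otimes> \<beta> (inv g \<otimes> \<zeta>)) <# K)"

abbreviation "triples \<equiv> opposite_triples G P w0"

definition \<Phi> :: "'a set \<times> 'a set \<times> 'a set \<Rightarrow> 'a set" where "\<Phi> t = (SOME c. Rel t c)"

lemma triple_adm:
  assumes "(g <# P, (g \<otimes> w0) <# P, \<zeta> <# P) \<in> triples" "g \<in> carrier G" "\<zeta> \<in> carrier G"
  shows "inv g \<otimes> \<zeta> \<in> adm"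
  using assms opposite_cell[of g \<zeta>] opposite_cell'[of g \<zeta>] by (simp add: opposite_triples_def adm_def)

lemma triple_rep:
  assumes "t \<in> triples"
  obtains g \<zeta> where "g \<in> carrier G" "\<zeta> \<in> carrier G" "t = (g <# P, (g \<otimes> w0) <# P, \<zeta> <# P)"
proof -
  obtain x y z where t: "t = (x, y, z)" "opposite G P w0 x y" "opposite G P w0 x z"
    using assms by (auto simp: opposite_triples_def)
  obtain g where g: "g \<in> carrier G" "x = g <# P" "y = (g \<otimes> w0) <# P" using t(2) opposite_iff by blast
  obtain h where h: "h \<in> carrier G" "z = (h \<otimes> w0) <# P" using t(3) opposite_iff by blast
  show thesis using that[of g "h \<otimes> w0"] g h t by simp
qed

text \<open>Two frames of one pair differ by \<open>n \<otimes> l\<close> in \<open>P\<close> whose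
  conjugate by \<open>inv w0\<close> is in \<open>P\<close> too; that conjugation sends
  \<open>n\<close> into \<open>Nm\<close>, so \<open>n = \<one>\<close>. The remaining
  \<open>m \<otimes> a\<close> is compensated by \<open>\<beta>_left\<close>, a change of
  \<open>\<zeta>\<close> by \<open>\<beta>_right\<close>.\<close>

lemma Rel_unique:
  assumes t: "t \<in> triples" and "Rel t c" "Rel t c'"
  shows "c = c'"
proof -
  obtain g \<zeta> where r: "g \<in> carrier G" "\<zeta> \<in> carrier G" "t = (g <# P, (g \<otimes> w0) <# P, \<zeta> <# P)"
    "c = (g \<otimes> \<beta> (inv g \<otimes> \<zeta>)) <# K" using assms(2) by (auto simp: Rel_def)
  obtain g' \<zeta>' where r': "g' \<in> carrier G" "\<zeta>' \<in> carrier G" "t = (g' <# P, (g' \<otimes> w0) <# P, \<zeta>' <# P)"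
    "c' = (g' \<otimes> \<beta> (inv g' \<otimes> \<zeta>')) <# K" using assms(3) by (auto simp: Rel_def)
  have "inv g' \<otimes> g \<in> P" using lcos_eq[OF subgroup_P, of g' g] r r' by auto
  then obtain n l where n: "n \<in> Np" "l \<in> L" "inv g' \<otimes> g = n \<otimes> l" by (rule P_decomp')
  obtain m a where ma: "m \<in> M" "a \<in> A" "l = m \<otimes> a" using n by (auto simp: L_def)
  have c: "n \<in> carrier G" "l \<in> carrier G" "m \<in> carrier G" "a \<in> carrier G"
    using n ma N_closed L_closed M_closed A_closed by auto
  have "inv (g' \<otimes> w0) \<otimes> (g \<otimes> w0) \<in> P" using lcos_eq[OF subgroup_P, of "g' \<otimes> w0" "g \<otimes> w0"] r r' by auto
  moreover have "inv (g' \<otimes> w0) \<otimes> (g \<otimes> w0) = inv w0 \<otimes> (inv g' \<otimes> g) \<otimes> w0"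
    using r r' by (simp add: m_assoc inv_mult_group)
  ultimately have p1: "inv w0 \<otimes> (n \<otimes> l) \<otimes> w0 \<in> P" using n(3) by simp
  have e: "inv w0 \<otimes> (n \<otimes> l) \<otimes> w0 = (inv w0 \<otimes> n \<otimes> w0) \<otimes> (inv w0 \<otimes> l \<otimes> w0)"
    using c by (simp add: m_assoc)
  have lP: "inv w0 \<otimes> l \<otimes> w0 \<in> P"
    unfolding ma(3) w0_conj_L[OF ma(1,2)] using w0_conj_M[OF ma(1)] A_inv[OF ma(2)] by (intro L_P LI)
  have "inv w0 \<otimes> n \<otimes> w0 = (inv w0 \<otimes> (n \<otimes> l) \<otimes> w0) \<otimes> inv (inv w0 \<otimes> l \<otimes> w0)"
    using c by (simp add: m_assoc inv_mult_group)
  then have "inv w0 \<otimes> n \<otimes> w0 \<in> P" using P_mult[OF p1 P_inv[OF lP]] by simp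
  then have "inv w0 \<otimes> n \<otimes> w0 = \<one>" using Nm_P w0_Np(1)[OF n(1)] by blast
  then have "w0 \<otimes> (inv w0 \<otimes> n \<otimes> w0) \<otimes> inv w0 = \<one>" by simp
  then have "n = \<one>" using c by (simp add: m_assoc)
  then have gl: "inv g' \<otimes> g = m \<otimes> a" using n(3) c ma(3) by simp
  define p where "p = inv \<zeta> \<otimes> \<zeta>'"
  have p: "p \<in> P" unfolding p_def using lcos_eq[OF subgroup_P, of \<zeta> \<zeta>'] r r' by auto
  let ?\<xi> = "inv g \<otimes> \<zeta>"
  have \<xi>: "?\<xi> \<in> adm" using triple_adm t r by blast
  have "inv g' \<otimes> \<zeta>' = (inv g' \<otimes> g) \<otimes> (inv g \<otimes> \<zeta>) \<otimes> p"
    using r r' by (simp add: p_def m_assoc)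
  also have "\<dots> = m \<otimes> a \<otimes> (?\<xi> \<otimes> p)" unfolding gl using r c P_closed[OF p] by (simp add: m_assoc)
  finally have e': "inv g' \<otimes> \<zeta>' = m \<otimes> a \<otimes> (?\<xi> \<otimes> p)" .
  have \<xi>p: "?\<xi> \<otimes> p \<in> adm" by (rule adm_right[OF \<xi> p])
  have b: "\<beta> (inv g' \<otimes> \<zeta>') = a \<otimes> \<beta> ?\<xi>"
    unfolding e' using \<beta>_left[OF \<xi>p ma(1,2)] \<beta>_right[OF \<xi> p] by simp
  have bA: "\<beta> ?\<xi> \<in> A" by (rule \<beta>_A[OF \<xi>])
  have bc: "\<beta> ?\<xi> \<in> carrier G" using A_closed[OF bA] .
  have g: "g = g' \<otimes> (m \<otimes> a)" unfolding gl[symmetric] using r r' by simp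
  have "g \<otimes> \<beta> ?\<xi> = g' \<otimes> (m \<otimes> (a \<otimes> \<beta> ?\<xi>))"
    by (subst (1) g) (use r' c bc in \<open>simp add: m_assoc\<close>)
  \<comment> \<open>\<open>m\<close> moves to the right past \<open>A\<close>, where it is absorbed
    by \<open>K\<close>.\<close>
  also have "m \<otimes> (a \<otimes> \<beta> ?\<xi>) = a \<otimes> \<beta> ?\<xi> \<otimes> m" by (rule M_A_commute[OF ma(1) A_mult[OF ma(2) bA]])
  finally have "g \<otimes> \<beta> ?\<xi> = g' \<otimes> (a \<otimes> \<beta> ?\<xi>) \<otimes> m" using r' c bc by (simp add: m_assoc)
  then have "inv (g' \<otimes> (a \<otimes> \<beta> ?\<xi>)) \<otimes> (g \<otimes> \<beta> ?\<xi>) = m" using r' c bc by simp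
  then have "(g' \<otimes> (a \<otimes> \<beta> ?\<xi>)) <# K = (g \<otimes> \<beta> ?\<xi>) <# K"
    using lcos_eq[OF K_sub] M_K[OF ma(1)] r r' c bc by simp
  then show ?thesis using r(4) r'(4) b by simp
qed

lemma \<Phi>_eq: "t \<in> triples \<Longrightarrow> Rel t c \<Longrightarrow> \<Phi> t = c"
  unfolding \<Phi>_def using Rel_unique by (intro some_equality) blast+

lemma triples_invariant:
  assumes h: "h \<in> carrier G" and t: "(x, y, z) \<in> triples"
  shows "(h <# x, h <# y, h <# z) \<in> triples"
proof -
  have "opposite G P w0 (h <# x) (h <# y)" if o: "opposite G P w0 x y" for x y
  proof -
    obtain g where "g \<in> carrier G" "x = g <# P" "y = (g \<otimes> w0) <# P" using o opposite_iff by blast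
    then show ?thesis
      unfolding opposite_iff using h by (intro bexI[of _ "h \<otimes> g"]) (simp_all add: lcos_mult[OF subgroup_P] m_assoc)
  qed
  then show ?thesis using t by (simp add: opposite_triples_def)
qed

lemma \<Phi>_equivariant:
  assumes h: "h \<in> carrier G" and t: "(x, y, z) \<in> triples"
  shows "\<Phi> (h <# x, h <# y, h <# z) = h <# \<Phi> (x, y, z)"
proof -
  obtain g \<zeta> where r: "g \<in> carrier G" "\<zeta> \<in> carrier G" "(x, y, z) = (g <# P, (g \<otimes> w0) <# P, \<zeta> <# P)"
    using triple_rep[OF t] .
  let ?b = "\<beta> (inv g \<otimes> \<zeta>)"
  have "inv g \<otimes> \<zeta> \<in> adm" using triple_adm t r by simp
  then have b: "?b \<in> carrier G" using \<beta>_A A_closed by blast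
  have 1: "\<Phi> (x, y, z) = (g \<otimes> ?b) <# K"
    using t r by (intro \<Phi>_eq) (auto simp: Rel_def)
  have e: "inv (h \<otimes> g) \<otimes> (h \<otimes> \<zeta>) = inv g \<otimes> \<zeta>" using h r by (simp add: m_assoc inv_mult_group)
  have "\<Phi> (h <# x, h <# y, h <# z) = ((h \<otimes> g) \<otimes> \<beta> (inv (h \<otimes> g) \<otimes> (h \<otimes> \<zeta>))) <# K"
  proof (rule \<Phi>_eq[OF triples_invariant[OF h t]])
    show "Rel (h <# x, h <# y, h <# z) (((h \<otimes> g) \<otimes> \<beta> (inv (h \<otimes> g) \<otimes> (h \<otimes> \<zeta>))) <# K)"
      unfolding Rel_def using h r
      by (intro bexI[of _ "h \<otimes> g"] bexI[of _ "h \<otimes> \<zeta>"]) (simp_all add: lcos_mult[OF subgroup_P] m_assoc)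
  qed
  also have "\<dots> = h <# ((g \<otimes> ?b) <# K)" unfolding e using h r b by (simp add: lcos_mult[OF K_sub] m_assoc)
  finally show ?thesis using 1 by simp
qed

lemma \<Phi>_flat:
  assumes t: "(x, y, z) \<in> triples"
  shows "\<Phi> (x, y, z) \<in> flat_through G K A P x y"
proof -
  obtain g \<zeta> where r: "g \<in> carrier G" "\<zeta> \<in> carrier G" "(x, y, z) = (g <# P, (g \<otimes> w0) <# P, \<zeta> <# P)"
    using triple_rep[OF t] .
  have "inv g \<otimes> \<zeta> \<in> adm" using triple_adm t r by simp
  then have b: "\<beta> (inv g \<otimes> \<zeta>) \<in> A" by (rule \<beta>_A)
  have "\<Phi> (x, y, z) = (g \<otimes> \<beta> (inv g \<otimes> \<zeta>)) <# K"
    using t r by (intro \<Phi>_eq) (auto simp: Rel_def)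
  moreover have "flat_through G K A P x y = translate G g (std_flat G K A)"
    using flat_through_eq[OF r(1)] r(3) by simp
  ultimately show ?thesis using b translate_flat[OF r(1)] by auto
qed

text \<open>A frame of the pair given by a continuous formula: \<open>g1 n\<close>, where
  \<open>n\<close> is the element of \<open>Np\<close> with \<open>g1 n w0 P = g2 P\<close>.\<close>

definition frame :: "'a \<Rightarrow> 'a \<Rightarrow> 'a" where
  "frame g1 g2 = g1 \<otimes> (w0 \<otimes> \<nu> (inv w0 \<otimes> (inv g1 \<otimes> g2)) \<otimes> inv w0)"

lemma frame:
  assumes g: "g1 \<in> carrier G" "g2 \<in> carrier G" and o: "opposite G P w0 (g1 <# P) (g2 <# P)"
  shows "frame g1 g2 \<in> carrier G" "frame g1 g2 <# P = g1 <# P" "(frame g1 g2 \<otimes> w0) <# P = g2 <# P"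
proof -
  let ?y = "inv w0 \<otimes> (inv g1 \<otimes> g2)"
  have y: "?y \<in> cell" by (rule opposite_cell[OF g o])
  have n: "\<nu> ?y \<in> Nm" by (rule \<nu>_Nm[OF y])
  have nc: "\<nu> ?y \<in> carrier G" using n N_closed by blast
  show fc: "frame g1 g2 \<in> carrier G" using g nc by (simp add: frame_def)
  have "inv g1 \<otimes> frame g1 g2 = w0 \<otimes> \<nu> ?y \<otimes> inv w0" using g nc by (simp add: frame_def)
  then have "inv g1 \<otimes> frame g1 g2 \<in> P" using Np_P w0_Nm(2)[OF n] by simp
  then show "frame g1 g2 <# P = g1 <# P" using lcos_eq[OF subgroup_P g(1) fc] by simp
  have "inv (frame g1 g2 \<otimes> w0) \<otimes> g2 = inv (\<nu> ?y) \<otimes> ?y"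
    using g nc by (simp add: frame_def inv_mult_group m_assoc)
  then have "inv (frame g1 g2 \<otimes> w0) \<otimes> g2 \<in> P" using \<nu>_P[OF y] by simp
  then show "(frame g1 g2 \<otimes> w0) <# P = g2 <# P" using lcos_eq[OF subgroup_P _ g(2)] fc by simp
qed

lemma \<Phi>_frame:
  assumes g: "g1 \<in> carrier G" "g2 \<in> carrier G" "g3 \<in> carrier G" and t: "(g1 <# P, g2 <# P, g3 <# P) \<in> triples"
  shows "\<Phi> (g1 <# P, g2 <# P, g3 <# P) = (frame g1 g2 \<otimes> \<beta> (inv (frame g1 g2) \<otimes> g3)) <# K"
    "inv (frame g1 g2) \<otimes> g3 \<in> adm"
proof -
  have "opposite G P w0 (g1 <# P) (g2 <# P)" using t by (simp add: opposite_triples_def)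
  note f = frame[OF g(1,2) this]
  show "\<Phi> (g1 <# P, g2 <# P, g3 <# P) = (frame g1 g2 \<otimes> \<beta> (inv (frame g1 g2) \<otimes> g3)) <# K"
  proof (rule \<Phi>_eq[OF t])
    show "Rel (g1 <# P, g2 <# P, g3 <# P) ((frame g1 g2 \<otimes> \<beta> (inv (frame g1 g2) \<otimes> g3)) <# K)"
      unfolding Rel_def by (rule bexI[OF _ f(1)], rule bexI[OF _ g(3)]) (simp add: f)
  qed
  show "inv (frame g1 g2) \<otimes> g3 \<in> adm" using triple_adm[of "frame g1 g2" g3] f g t by simp
qed

section \<open>Continuity of the map\<close>

lemma lim_frame:
  assumes l: "limitin (gtop G) f1 g1 \<F>" "limitin (gtop G) f2 g2 \<F>" "limitin (gtop G) f3 g3 \<F>"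
    and t: "(g1 <# P, g2 <# P, g3 <# P) \<in> triples"
  shows "limitin (gtop G) (\<lambda>x. frame (f1 x) (f2 x) \<otimes> \<beta> (inv (frame (f1 x) (f2 x)) \<otimes> f3 x))
    (frame g1 g2 \<otimes> \<beta> (inv (frame g1 g2) \<otimes> g3)) \<F>"
proof -
  have g: "g1 \<in> carrier G" "g2 \<in> carrier G" "g3 \<in> carrier G" using l lim_carrier by auto
  have "opposite G P w0 (g1 <# P) (g2 <# P)" using t by (simp add: opposite_triples_def)
  note cell1 = opposite_cell[OF g(1,2) this]
  note adm = \<Phi>_frame(2)[OF g t]
  have lf: "limitin (gtop G) (\<lambda>x. frame (f1 x) (f2 x)) (frame g1 g2) \<F>"
    unfolding frame_def by (intro lim_mult lim_const lim_cell(1)[OF _ cell1] lim_inv l inv_closed w0_closed)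
  have cell2: "inv w0 \<otimes> (inv (frame g1 g2) \<otimes> g3) \<in> cell" using adm by (simp add: adm_def)
  have "limitin (gtop G) (\<lambda>x. \<nu> (inv w0 \<otimes> (inv (frame (f1 x) (f2 x)) \<otimes> f3 x)))
      (\<nu> (inv w0 \<otimes> (inv (frame g1 g2) \<otimes> g3))) \<F>"
    by (rule lim_cell(1)[OF _ cell2]) (intro lim_mult lim_const lim_inv l lf inv_closed w0_closed)
  then have "limitin (gtop G) (\<lambda>x. \<beta> (inv (frame (f1 x) (f2 x)) \<otimes> f3 x)) (\<beta> (inv (frame g1 g2) \<otimes> g3)) \<F>"
    unfolding \<beta>_def by (intro lim_cell(2)[OF _ adm_cell[OF adm]] lim_mult lim_const w0_closed)
  with lf show ?thesis by (rule lim_mult)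
qed

lemma triples_carrier:
  assumes "t \<in> triples"
  obtains g1 g2 g3 where "g1 \<in> carrier G" "g2 \<in> carrier G" "g3 \<in> carrier G" "t = (g1 <# P, g2 <# P, g3 <# P)"
  using triple_rep[OF assms] by (metis m_closed w0_closed)

lemma topspace_triples: "topspace (opposite_triples_topology G P w0) = triples"
proof -
  have "triples \<subseteq> topspace (coset_space G P) \<times> topspace (coset_space G P) \<times> topspace (coset_space G P)"
  proof
    fix t assume "t \<in> triples"
    then obtain g1 g2 g3 where "g1 \<in> carrier G" "g2 \<in> carrier G" "g3 \<in> carrier G" "t = (g1 <# P, g2 <# P, g3 <# P)"
      by (rule triples_carrier)
    then show "t \<in> topspace (coset_space G P) \<times> topspace (coset_space G P) \<times> topspace (coset_space G P)"
      by (auto simp: topspace_coset_space)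
  qed
  then show ?thesis by (auto simp: opposite_triples_topology_def)
qed

text \<open>On representatives in \<open>G\<close> the map is given by the explicit frame formula. A
  box of neighbourhoods around one representing triple projects to an open box of cosets, and every
  opposite triple in that box has representatives in the original one.\<close>

lemma \<Phi>_continuous: "continuous_map (opposite_triples_topology G P w0) (coset_space G K) \<Phi>"
  unfolding continuous_map_def
proof (intro conjI allI impI)
  show "\<Phi> \<in> topspace (opposite_triples_topology G P w0) \<rightarrow> topspace (coset_space G K)"
  proof (rule Pi_I)
    fix t assume "t \<in> topspace (opposite_triples_topology G P w0)"
    then have t: "t \<in> triples" by (simp add: topspace_triples)
    then obtain g1 g2 g3 where g: "g1 \<in> carrier G" "g2 \<in> carrier G" "g3 \<in> carrier G" "t = (g1 <# P, g2 <# P, g3 <# P)"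
      by (rule triples_carrier)
    have o: "opposite G P w0 (g1 <# P) (g2 <# P)" using t g(4) by (simp add: opposite_triples_def)
    have "frame g1 g2 \<in> carrier G" by (rule frame(1)[OF g(1,2) o])
    moreover have "\<beta> (inv (frame g1 g2) \<otimes> g3) \<in> carrier G"
      using \<Phi>_frame(2)[OF g(1-3)] t g(4) \<beta>_A A_closed by blast
    ultimately show "\<Phi> t \<in> topspace (coset_space G K)"
      using \<Phi>_frame(1)[OF g(1-3)] t g(4) by (simp add: topspace_coset_space)
  qed
next
  fix V assume V: "openin (coset_space G K) V"
  let ?X = "prod_topology (gtop G) (prod_topology (gtop G) (gtop G))"
  let ?Y = "prod_topology (coset_space G P) (prod_topology (coset_space G P) (coset_space G P))"
  show "openin (opposite_triples_topology G P w0) {t \<in> topspace (opposite_triples_topology G P w0). \<Phi> t \<in> V}"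
  proof (subst openin_subopen, intro ballI)
    fix t assume "t \<in> {t \<in> topspace (opposite_triples_topology G P w0). \<Phi> t \<in> V}"
    then have t: "t \<in> triples" "\<Phi> t \<in> V" by (auto simp: topspace_triples)
    obtain g1 g2 g3 where g: "g1 \<in> carrier G" "g2 \<in> carrier G" "g3 \<in> carrier G" and tg: "t = (g1 <# P, g2 <# P, g3 <# P)"
      using t(1) by (rule triples_carrier)
    have tt: "(g1 <# P, g2 <# P, g3 <# P) \<in> triples" using t(1) tg by simp
    \<comment> \<open>Away from opposite triples the values of \<open>?f\<close> are arbitrary; what
      is used is its limit at \<open>(g1, g2, g3)\<close>.\<close>
    let ?f = "\<lambda>(h1, h2, h3). frame h1 h2 \<otimes> \<beta> (inv (frame h1 h2) \<otimes> h3)"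
    let ?F = "nhdsin ?X (g1, g2, g3)"
    have top: "(g1, g2, g3) \<in> topspace ?X" using g by (simp add: topspace_gtop)
    note lim0 = limitin_nhdsin[OF top]
    have l1: "limitin (gtop G) (\<lambda>x. fst x) g1 ?F" and l23: "limitin (prod_topology (gtop G) (gtop G)) (\<lambda>x. snd x) (g2, g3) ?F"
      using lim0 by (simp_all add: limitin_pairwise o_def)
    have l2: "limitin (gtop G) (\<lambda>x. fst (snd x)) g2 ?F" and l3: "limitin (gtop G) (\<lambda>x. snd (snd x)) g3 ?F"
      using l23 by (simp_all add: limitin_pairwise o_def)
    have lf: "limitin (gtop G) ?f (?f (g1, g2, g3)) ?F"
      using lim_frame[OF l1 l2 l3 tt] by (simp add: case_prod_unfold)
    have "?f (g1, g2, g3) \<in> {h \<in> carrier G. h <# K \<in> V}"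
      using lim_carrier[OF lf] t(2) \<Phi>_frame(1)[OF g tt] tg by simp
    from limitinD[OF lf openin_coset_space[OF V] this]
    have "\<exists>Q. openin ?X Q \<and> (g1, g2, g3) \<in> Q \<and> (\<forall>h\<in>Q. ?f h \<in> {h \<in> carrier G. h <# K \<in> V})"
      unfolding eventually_nhdsin using top by blast
    then obtain Q where Q: "openin ?X Q" "(g1, g2, g3) \<in> Q" "\<forall>h\<in>Q. ?f h \<in> {h \<in> carrier G. h <# K \<in> V}"
      by (elim exE conjE)
    from Q(1)[unfolded openin_prod_topology_alt[of "gtop G" "prod_topology (gtop G) (gtop G)"], rule_format, OF Q(2)]
    obtain Q1 Q' where Q1: "openin (gtop G) Q1" "openin (prod_topology (gtop G) (gtop G)) Q'"
      "g1 \<in> Q1" "(g2, g3) \<in> Q'" "Q1 \<times> Q' \<subseteq> Q" by (elim exE conjE)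
    from Q1(2)[unfolded openin_prod_topology_alt[of "gtop G" "gtop G"], rule_format, OF Q1(4)]
    obtain Q2 Q3 where Q2: "openin (gtop G) Q2" "openin (gtop G) Q3"
      "g2 \<in> Q2" "g3 \<in> Q3" "Q2 \<times> Q3 \<subseteq> Q'" by (elim exE conjE)
    define R where "R = (\<lambda>g. g <# P) ` Q1 \<times> (\<lambda>g. g <# P) ` Q2 \<times> (\<lambda>g. g <# P) ` Q3"
    have "openin ?Y R"
      unfolding R_def by (simp add: openin_prod_Times_iff open_coset_image[OF subgroup_P] Q1 Q2)
    then have "openin (opposite_triples_topology G P w0) (triples \<inter> R)"
      unfolding opposite_triples_topology_def openin_subtopology by blast
    moreover have "t \<in> triples \<inter> R" using t(1) Q1 Q2 by (simp add: R_def tg)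
    moreover have "triples \<inter> R \<subseteq> {t \<in> topspace (opposite_triples_topology G P w0). \<Phi> t \<in> V}"
    proof
      fix s assume s: "s \<in> triples \<inter> R"
      then obtain h1 h2 h3 where h: "h1 \<in> Q1" "h2 \<in> Q2" "h3 \<in> Q3" and sh: "s = (h1 <# P, h2 <# P, h3 <# P)"
        by (auto simp: R_def)
      have hc: "h1 \<in> carrier G" "h2 \<in> carrier G" "h3 \<in> carrier G"
        using h openin_subset[OF Q1(1)] openin_subset[OF Q2(1)] openin_subset[OF Q2(2)] topspace_gtop by auto
      have "(h1, h2, h3) \<in> Q" using h Q1(5) Q2(5) by blast
      then have "(frame h1 h2 \<otimes> \<beta> (inv (frame h1 h2) \<otimes> h3)) <# K \<in> V" using Q(3) by fastforce
      then have "\<Phi> s \<in> V" using \<Phi>_frame(1)[OF hc] s sh by simp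
      then show "s \<in> {t \<in> topspace (opposite_triples_topology G P w0). \<Phi> t \<in> V}"
        using s by (simp add: topspace_triples)
    qed
    ultimately show "\<exists>T. openin (opposite_triples_topology G P w0) T \<and> t \<in> T \<and>
        T \<subseteq> {t \<in> topspace (opposite_triples_topology G P w0). \<Phi> t \<in> V}" by blast
  qed
qed

end

theorem theorem3:
  fixes G :: "('a, 'e::euclidean_space) lie_group"
    and K A M N P :: "'a set"
    and \<p> \<a> :: "'e set"
    and \<Sigma>p :: "('e \<Rightarrow> real) set"
    and w\<^sub>0 :: 'a
  assumes "lie_group G"
    and "connected_space (gtop G)"
    and "semisimple G"
    and "noncompact_type G"
    and "finite (group_center G)"
    and "maximal_compact_subgroup G K"
    and "cartan_decomposition G (lie_of G K) \<p>"
    and "maximal_abelian_in G \<p> \<a>"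
    and "positive_roots G \<a> \<Sigma>p"
    and "A = lie_exp G ` \<a>"
    and "M = centralizer_in G K A"
    and "N = analytic_subgroup G (positive_root_sum G \<a> \<Sigma>p)"
    and "P = M <#>\<^bsub>G\<^esub> A <#>\<^bsub>G\<^esub> N"
    and "represents_longest G K \<a> \<Sigma>p w\<^sub>0"
    and "\<forall>X\<in>\<a>. Ad G w\<^sub>0 X = - X"
  shows "\<exists>\<Phi>. continuous_map (opposite_triples_topology G P w\<^sub>0) (coset_space G K) \<Phi> \<and>
           (\<forall>g\<in>carrier G. \<forall>(x, y, z)\<in>opposite_triples G P w\<^sub>0.
              \<Phi> (g <#\<^bsub>G\<^esub> x, g <#\<^bsub>G\<^esub> y, g <#\<^bsub>G\<^esub> z) = g <#\<^bsub>G\<^esub> \<Phi> (x, y, z)) \<and>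
           (\<forall>(x, y, z)\<in>opposite_triples G P w\<^sub>0. \<Phi> (x, y, z) \<in> flat_through G K A P x y)"
proof -
  obtain \<theta> where \<theta>: "cartan_involution G \<theta>" "lie_of G K = {X. \<theta> X = X}" "\<p> = {X. \<theta> X = - X}"
    using assms(7) by (auto simp: cartan_decomposition_def)
  obtain H0 where H0: "H0 \<in> \<a>" "\<And>\<alpha>. \<alpha> \<in> restricted_roots G \<a> \<Longrightarrow> \<alpha> H0 \<noteq> 0"
    "\<Sigma>p = {\<alpha> \<in> restricted_roots G \<a>. \<alpha> H0 > 0}"
    using assms(9) by (auto simp: positive_roots_def)
  interpret S: flag_setup G K \<theta> \<a> H0 w\<^sub>0
  proof (intro flag_setup.intro flag_setup_axioms.intro)
    show "subgroup K G" "compactin (gtop G) K"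
      using assms(6) by (auto simp: maximal_compact_subgroup_def)
    show "w\<^sub>0 \<in> normalizer_in G K (lie_exp G ` \<a>)"
      using assms(14) by (simp add: represents_longest_def Let_def)
  qed (use assms \<theta> H0 in auto)
  have A: "A = S.A" using assms(10) by (simp add: S.A_def)
  have M: "M = S.M" using assms(11) A by (simp add: S.M_def)
  have N: "N = S.horo H0" using assms(12) H0(3) S.nilp_eq_psum by (simp add: S.horo_def)
  have P: "P = S.P" using assms(13) A M N by (simp add: S.P_def)
  show ?thesis
    unfolding P A using S.\<Phi>_continuous S.\<Phi>_equivariant S.\<Phi>_flat by (intro exI[of _ S.\<Phi>]) auto
qed

end
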